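(* Let the centered stationary Gaussian field $G$ and its covariance $\mathcal C$ satisfy the standing assumptions (stated in the context) with $\beta>1$. There is a finite constant $c$, independent of $\varepsilon$, $f$ and $g$, such that the following holds. Let $f,g\in C^1([0,1])$, let $u_\varepsilon$ be the solution of $$(a(\tfrac{x}{\varepsilon})u_\varepsilon'(x))'=f'(x)\ \text{ on }(0,1),\qquad u_\varepsilon(0)=u_\varepsilon(1)=0,$$ and let $v_\varepsilon$ be the solution of the same problem with $f$ replaced by $g$. Set $I_\varepsilon(f,g):=\int_0^1u_\varepsilon'(x)g(x)dx=\int_0^1v_\varepsilon'(x)f(x)dx$ and $\sigma_\varepsilon(f,g):=\sqrt{\varepsilon^{-1}\mathrm{Var}[I_\varepsilon(f,g)]}$. Then there exists a finite constant $M$, depending on $f$ and $g$ but not on $\varepsilon$, such that for all $\varepsilon\in(0,\frac12]$ with $\sigma_\varepsilon(f,g)\neq0$ $$d_{TV}\Big(\frac{I_\varepsilon(f,g)-\mathbb E[I_\varepsilon(f,g)]}{\sqrt{\varepsilon}\,\sigma_\varepsilon(f,g)},\mathcal N\Big)\le \frac{M}{\sigma_\varepsilon(f,g)^2}\,\sqrt{\varepsilon}\,\exp\big(c\,|\log\varepsilon|^{\frac12}\big),$$ where $\mathcal N$ is a centered normal random variable of variance one.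
   Context: Standing assumptions. $G:\mathbb R\to\mathbb R$ is a stationary centered Gaussian random field with covariance function $\mathcal C:\mathbb R\to\mathbb R$, that is, $\mathbb E[G(x)G(y)]=\mathcal C(x-y)$, where $\mathcal C$ is Hölder continuous at zero. For the given $\beta$ and a finite constant $K$ one has $|\mathcal C(x)|\le K(1+|x|)^{-\beta}$ for all $x\in\mathbb R$. Moreover $\mathcal C=\mathcal C^\circ\star\mathcal C^\circ$ (convolution) for some $\mathcal C^\circ$ satisfying, for all $x\in\mathbb R$ (when $\beta>1$), $\sup_{B(x)}|\mathcal C^\circ|\le K(1+|x|)^{-\frac{1+\beta}{2}}$, where $B(x)$ is the unit ball centered at $x$. Realizations of $G$ are almost surely continuous (continuous version). The random coefficient field is $a(x)=\exp(G(x))$. The solution $u_\varepsilon\in C^1([0,1])$ is random, with $$u_\varepsilon'(x)=\frac{1}{a(x/\varepsilon)}\Big(f(x)-\Big(\int_0^1\frac{1}{a(y/\varepsilon)}dy\Big)^{-1}\int_0^1\frac{f(y)}{a(y/\varepsilon)}dy\Big).$$ The total variation distance between random variables $\mathcal M_1,\mathcal M_2$ with laws $\mu_1,\mu_2$ is $d_{TV}(\mathcal M_1,\mathcal M_2)=\sup_A|\mu_1(A)-\mu_2(A)|$, the supremum being over Borel sets $A\subset\mathbb R$. *)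

theory Defs
  imports "HOL-Probability.Probability"
begin

(* Degenerate (zero) Gaussians are allowed; normal_density with standard deviation 0 is not a
   probability density, so that case is separated out. *)
definition centered_gaussian_rv :: "'w measure \<Rightarrow> ('w \<Rightarrow> real) \<Rightarrow> bool" where
  "centered_gaussian_rv P X \<longleftrightarrow>
     X \<in> borel_measurable P \<and>
     ((AE \<omega> in P. X \<omega> = 0) \<or>
      (\<exists>s>0. distributed P lborel X (\<lambda>x. ennreal (normal_density 0 s x))))"

definition centered_gaussian_field :: "'w measure \<Rightarrow> (real \<Rightarrow> 'w \<Rightarrow> real) \<Rightarrow> bool" where
  "centered_gaussian_field P G \<longleftrightarrow>
     (\<forall>S c. finite S \<longrightarrow> centered_gaussian_rv P (\<lambda>\<omega>. \<Sum>x\<in>S. c x * G x \<omega>))"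

(* The covariance depends only on x - y; for a centered Gaussian field this is stationarity. *)
definition has_stationary_covariance ::
  "'w measure \<Rightarrow> (real \<Rightarrow> 'w \<Rightarrow> real) \<Rightarrow> (real \<Rightarrow> real) \<Rightarrow> bool" where
  "has_stationary_covariance P G C \<longleftrightarrow>
     (\<forall>x y. (\<integral>\<omega>. G x \<omega> * G y \<omega> \<partial>P) = C (x - y))"

definition holder_continuous_at_zero :: "(real \<Rightarrow> real) \<Rightarrow> bool" where
  "holder_continuous_at_zero C \<longleftrightarrow>
     (\<exists>\<alpha> L \<delta>. 0 < \<alpha> \<and> \<alpha> \<le> 1 \<and> 0 < \<delta> \<and>
        (\<forall>x. \<bar>x\<bar> \<le> \<delta> \<longrightarrow> \<bar>C x - C 0\<bar> \<le> L * \<bar>x\<bar> powr \<alpha>))"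

definition fun_convolution :: "(real \<Rightarrow> real) \<Rightarrow> (real \<Rightarrow> real) \<Rightarrow> real \<Rightarrow> real" where
  "fun_convolution h k x = (\<integral>y. h (x - y) * k y \<partial>lebesgue)"

(* C1([0,1]), with one-sided derivatives at the end points (C1_differentiable_on would
   require two-sided ones). *)
definition C1_01 :: "(real \<Rightarrow> real) \<Rightarrow> bool" where
  "C1_01 h \<longleftrightarrow>
     (\<exists>D. (\<forall>x\<in>{0..1}. (h has_real_derivative D x) (at x within {0..1})) \<and>
          continuous_on {0..1} D)"

definition coeff_field :: "(real \<Rightarrow> 'w \<Rightarrow> real) \<Rightarrow> 'w \<Rightarrow> real \<Rightarrow> real" where
  "coeff_field G \<omega> x = exp (G x \<omega>)"

definition solves_bvp ::
  "(real \<Rightarrow> real) \<Rightarrow> real \<Rightarrow> (real \<Rightarrow> real) \<Rightarrow> (real \<Rightarrow> real) \<Rightarrow> bool" where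
  "solves_bvp a \<epsilon> f u \<longleftrightarrow>
     C1_01 u \<and> u 0 = 0 \<and> u 1 = 0 \<and>
     (\<forall>x\<in>{0<..<1}. ((\<lambda>y. a (y / \<epsilon>) * deriv u y) has_real_derivative deriv f x) (at x))"

(* Sample paths of G are continuous only almost surely, so the equation is required only almost
   surely. Asking that u be a random element of C1([0,1]) makes the derivative of u, and
   integrals of it, random variables on any, not necessarily complete, probability space. *)
definition random_solution ::
  "'w measure \<Rightarrow> (real \<Rightarrow> 'w \<Rightarrow> real) \<Rightarrow> real \<Rightarrow> (real \<Rightarrow> real) \<Rightarrow> ('w \<Rightarrow> real \<Rightarrow> real) \<Rightarrow> bool" where
  "random_solution P G \<epsilon> f u \<longleftrightarrow>
     (\<forall>x\<in>{0..1}. (\<lambda>\<omega>. u \<omega> x) \<in> borel_measurable P) \<and>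
     (\<forall>\<omega>\<in>space P. C1_01 (u \<omega>)) \<and>
     (AE \<omega> in P. solves_bvp (coeff_field G \<omega>) \<epsilon> f (u \<omega>))"

(* The value of deriv at the end points is irrelevant: they form a null set. *)
definition grad_integral :: "('w \<Rightarrow> real \<Rightarrow> real) \<Rightarrow> (real \<Rightarrow> real) \<Rightarrow> 'w \<Rightarrow> real" where
  "grad_integral u g \<omega> = (LBINT x:{0..1}. deriv (u \<omega>) x * g x)"

definition rescaled_sd :: "'w measure \<Rightarrow> real \<Rightarrow> ('w \<Rightarrow> real) \<Rightarrow> real" where
  "rescaled_sd P \<epsilon> X = sqrt (inverse \<epsilon> * prob_space.variance P X)"

(* Total variation distance of two laws on the real line, without a factor 2. *)
definition tv_dist :: "real measure \<Rightarrow> real measure \<Rightarrow> real" where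
  "tv_dist \<mu> \<nu> = (SUP A\<in>sets borel. \<bar>measure \<mu> A - measure \<nu> A\<bar>)"

end

theory Submission
  imports Defs
begin

text \<open>Put \<open>b(x) = exp (- G (x / \<epsilon>))\<close>. Integrating the equation once and using the boundary values gives
\<open>I = \<integral>b f g - (\<integral>b f) (\<integral>b g) / \<integral>b\<close>, which is symmetric in \<open>f\<close> and \<open>g\<close> and does not change when
constants are added to \<open>f\<close> and \<open>g\<close>. If \<open>f\<close> and \<open>g\<close> have mean zero, then \<open>\<integral>b f\<close> and \<open>\<integral>b g\<close> are fluctuations of
order \<open>\<surd>\<epsilon>\<close>, because the correlations of \<open>G\<close> are integrable. Hence \<open>I\<close> is, up to a remainder of order \<open>\<epsilon>\<close>
in mean square, the linear functional \<open>L\<close> of \<open>b\<close> with weight \<open>f g\<close>.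

Normality comes from Stein's method: for the solution \<open>\<phi>\<close> of Stein's equation (lemma \<open>stein_solution\<close>)
one has to compare \<open>E[F \<phi>(F)]\<close> with \<open>E[\<phi>'(F)]\<close>, where \<open>F\<close> is the normalised \<open>I\<close>. The integration by parts that
this calls for is elementary here, since \<open>b(x)\<close> is a multiple of a Cameron-Martin density: multiplying by \<open>b(x)\<close>
amounts to shifting \<open>G\<close> by a translate of its covariance (lemmas \<open>cameron_martin\<close> and \<open>cameron_martin_exp\<close>). Switching the
shift on gradually, with a parameter \<open>t\<close> running from \<open>0\<close> to \<open>1\<close>, produces \<open>E[\<phi>'(F) T\<^sub>t]\<close> with an explicit
kernel \<open>T\<^sub>t\<close>. The kernel is of order \<open>\<epsilon>\<close>, its expectation integrates to the variance of \<open>L\<close>, and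
its fluctuations are of order \<open>\<epsilon> powr (3/2)\<close> (lemma \<open>stein_kernel_concentration\<close>), because covariances of products of
lognormal variables are explicit and each of the three covariances linking four points of integration gains a
factor \<open>\<epsilon>\<close>. The variances of \<open>L\<close> and \<open>I\<close> also differ by \<open>\<epsilon> powr (3/2)\<close> only. Division by the
variance \<open>\<epsilon> \<sigma>\<^sup>2\<close> leaves a discrepancy of order \<open>\<surd>\<epsilon> / \<sigma>\<^sup>2\<close> (lemma \<open>stein_discrepancy\<close>).

Negative moments of \<open>\<integral>b\<close> never enter: the quotient \<open>\<bar>\<integral>b f\<bar> / \<integral>b\<close> is bounded by the supremum of \<open>f\<close>, and the
event that \<open>\<integral>b\<close> is small has small probability. In particular suprema of \<open>G\<close> over long intervals
do not occur, and the constant \<open>c = 0\<close> will do.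

The estimates are proved for midpoint sums in place of integrals, uniformly in the mesh, so that only
finitely many Gaussian variables occur at a time. Almost sure convergence and bounded fourth moments carry them over to \<open>I\<close>
(lemma \<open>grad_integral_normal_approximation\<close>), and inner regularity leads from continuous test functions to
Borel sets (lemma \<open>tv_dist_le_continuous\<close>).\<close>

section \<open>Joint laws are determined by characteristic functions\<close>

text \<open>After division by the total mass, both sides of \<open>eq\<close> are characteristic functions of probability
laws on the line, so that Levy's uniqueness theorem applies. The lower bound on the weights keeps the mass positive.\<close>

lemma real_weight_law_unique:
  fixes X :: "'a \<Rightarrow> real" and Y :: "'b \<Rightarrow> real" and r :: "'a \<Rightarrow> real" and r' :: "'b \<Rightarrow> real"
  assumes "prob_space M" "prob_space N"
    and [measurable]: "X \<in> borel_measurable M" "Y \<in> borel_measurable N"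
      "r \<in> borel_measurable M" "r' \<in> borel_measurable N"
    and r: "\<And>x. 1 \<le> r x" "\<And>x. r x \<le> 3" and r': "\<And>x. 1 \<le> r' x" "\<And>x. r' x \<le> 3"
    and eq: "\<And>\<theta>. (\<integral>x. complex_of_real (r x) * iexp (\<theta> * X x) \<partial>M) = (\<integral>y. of_real (r' y) * iexp (\<theta> * Y y) \<partial>N)"
    and B: "B \<in> sets borel"
  shows "(\<integral>x. r x * indicator B (X x) \<partial>M) = (\<integral>y. r' y * indicator B (Y y) \<partial>N)"
proof -
  interpret M: prob_space M by fact
  interpret N: prob_space N by fact
  define Z where "Z = (\<integral>x. r x \<partial>M)"
  have ir: "integrable M r" by (rule M.integrable_const_bound[of _ 3]) (use r in \<open>auto intro!: AE_I2 simp: abs_le_iff intro: order_trans[OF _ r(1)]\<close>, smt (verit) r(1))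
  have ir': "integrable N r'" by (rule N.integrable_const_bound[of _ 3]) (use r' in \<open>auto intro!: AE_I2 simp: abs_le_iff\<close>, smt (verit) r'(1))
  have Z1: "1 \<le> Z" unfolding Z_def by (rule M.integral_ge_const[OF ir]) (use r in auto)
  have Z2: "Z = (\<integral>y. r' y \<partial>N)" using eq[of 0] unfolding Z_def by simp
  define \<mu> where "\<mu> = distr (density M (\<lambda>x. ennreal (r x / Z))) borel X"
  define \<nu> where "\<nu> = distr (density N (\<lambda>x. ennreal (r' x / Z))) borel Y"
  have n: "0 \<le> r x / Z" "0 \<le> r' y / Z" for x y using r(1)[of x] r'(1)[of y] Z1 by auto
  have "prob_space (density M (\<lambda>x. ennreal (r x / Z)))"
    by (rule prob_spaceI) (use n Z1 ir in \<open>simp add: emeasure_density nn_integral_eq_integral Z_def[symmetric] cong: nn_integral_cong\<close>)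
  then have pm: "real_distribution \<mu>" unfolding \<mu>_def
    by (intro real_distribution.intro prob_space.prob_space_distr real_distribution_axioms.intro) auto
  have "prob_space (density N (\<lambda>x. ennreal (r' x / Z)))"
    by (rule prob_spaceI) (use n Z1 ir' in \<open>simp add: emeasure_density nn_integral_eq_integral Z2[symmetric] cong: nn_integral_cong\<close>)
  then have pn: "real_distribution \<nu>" unfolding \<nu>_def
    by (intro real_distribution.intro prob_space.prob_space_distr real_distribution_axioms.intro) auto
  have "char \<mu> \<theta> = char \<nu> \<theta>" for \<theta>
  proof -
    have "char \<mu> \<theta> = (\<integral>x. of_real (r x / Z) * iexp (\<theta> * X x) \<partial>M)" unfolding char_def \<mu>_def
      by (subst integral_distr, measurable, subst integral_density) (use n in \<open>auto simp: scaleR_conv_of_real\<close>)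
    also have "\<dots> = (\<integral>x. of_real (r x) * iexp (\<theta> * X x) \<partial>M) / Z"
      by (subst integral_divide_zero[symmetric]) (auto simp: field_simps)
    also have "\<dots> = (\<integral>x. of_real (r' x) * iexp (\<theta> * Y x) \<partial>N) / Z" using eq by simp
    also have "\<dots> = (\<integral>x. of_real (r' x / Z) * iexp (\<theta> * Y x) \<partial>N)"
      by (subst integral_divide_zero[symmetric]) (auto simp: field_simps)
    also have "\<dots> = char \<nu> \<theta>" unfolding char_def \<nu>_def
      by (subst integral_distr, measurable, subst integral_density) (use n in \<open>auto simp: scaleR_conv_of_real\<close>)
    finally show ?thesis .
  qed
  then have "\<mu> = \<nu>" by (intro Levy_uniqueness pm pn) auto
  then have "(\<integral>z. indicator B z \<partial>\<mu>) = (\<integral>z. indicator B z \<partial>\<nu> :: real)" by simp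
  moreover have "(\<integral>z. indicator B z \<partial>\<mu> :: real) = (\<integral>x. r x * indicator B (X x) \<partial>M) / Z" unfolding \<mu>_def
    by (subst integral_distr, measurable, use B in simp, subst integral_density) (use n B in \<open>auto simp: integral_divide_zero[symmetric] simp del: integral_divide_zero\<close>)
  moreover have "(\<integral>z. indicator B z \<partial>\<nu> :: real) = (\<integral>x. r' x * indicator B (Y x) \<partial>N) / Z" unfolding \<nu>_def
    by (subst integral_distr, measurable, use B in simp, subst integral_density) (use n B in \<open>auto simp: integral_divide_zero[symmetric] simp del: integral_divide_zero\<close>)
  ultimately show ?thesis using Z1 by simp
qed

text \<open>The weight \<open>W\<close> is recovered from the positive weights \<open>2 + Re (u * W)\<close> with \<open>u = 1\<close> and \<open>u = \<i>\<close>. Integrals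
against these involve only \<open>W\<close> and its conjugate, and conjugation corresponds to a change of sign of \<open>\<theta>\<close>.\<close>

lemma complex_weight_law_unique:
  fixes X :: "'a \<Rightarrow> real" and Y :: "'b \<Rightarrow> real" and W :: "'a \<Rightarrow> complex" and W' :: "'b \<Rightarrow> complex"
  assumes "prob_space M" "prob_space N"
    and [measurable]: "X \<in> borel_measurable M" "Y \<in> borel_measurable N"
      "W \<in> borel_measurable M" "W' \<in> borel_measurable N"
    and W: "\<And>x. norm (W x) \<le> 1" "\<And>x. norm (W' x) \<le> 1"
    and eq1: "\<And>\<theta>. (\<integral>x. iexp (\<theta> * X x) \<partial>M) = (\<integral>y. iexp (\<theta> * Y y) \<partial>N)"
    and eq: "\<And>\<theta>. (\<integral>x. W x * iexp (\<theta> * X x) \<partial>M) = (\<integral>y. W' y * iexp (\<theta> * Y y) \<partial>N)"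
    and B[measurable]: "B \<in> sets borel"
  shows "(\<integral>x. W x * indicator B (X x) \<partial>M) = (\<integral>y. W' y * indicator B (Y y) \<partial>N)"
proof -
  interpret M: prob_space M by fact
  interpret N: prob_space N by fact
  have expand: "(\<integral>x. complex_of_real (2 + Re (u * V x)) * iexp (\<theta> * S x) \<partial>Q)
      = 2 * (\<integral>x. iexp (\<theta> * S x) \<partial>Q) + (u * (\<integral>x. V x * iexp (\<theta> * S x) \<partial>Q) + cnj (u * (\<integral>x. V x * iexp (- \<theta> * S x) \<partial>Q))) / 2"
    if Q: "prob_space Q" and [measurable]: "S \<in> borel_measurable Q" "V \<in> borel_measurable Q" and V: "\<And>x. norm (V x) \<le> 1"
    for Q :: "'c measure" and S V \<theta> u
  proof -
    interpret Q: prob_space Q by fact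
    have i0: "integrable Q (\<lambda>x. iexp (\<theta> * S x))" for \<theta>
      by (rule Q.integrable_const_bound[of _ 1]) auto
    have i1: "integrable Q (\<lambda>x. V x * iexp (\<theta> * S x))" for \<theta>
      by (rule Q.integrable_const_bound[of _ 1]) (use V in \<open>auto simp: norm_mult\<close>)
    have pw: "complex_of_real (2 + Re (u * V x)) * iexp (\<theta> * S x) = 2 * iexp (\<theta> * S x) + (u * (V x * iexp (\<theta> * S x)) + cnj (u * (V x * iexp (- \<theta> * S x)))) / 2" for x
    proof -
      have "complex_of_real (Re z) = (z + cnj z) / 2" for z by (simp add: complex_add_cnj)
      from this[of "u * V x"] have "complex_of_real (Re (u * V x)) = (u * V x + cnj (u * V x)) / 2" .
      moreover have "cnj (iexp (- \<theta> * S x)) = iexp (\<theta> * S x)" by (simp add: exp_cnj)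
      ultimately show ?thesis by (simp only: of_real_add complex_cnj_mult) (simp add: field_simps)
    qed
    have lin: "(\<integral>x. 2 * a x + (u * b x + cnj (u * d x)) / 2 \<partial>Q) = 2 * (\<integral>x. a x \<partial>Q) + (u * (\<integral>x. b x \<partial>Q) + cnj (u * (\<integral>x. d x \<partial>Q))) / 2"
      if "integrable Q a" "integrable Q b" "integrable Q d" for a b d :: "'c \<Rightarrow> complex"
      using that by simp
    show ?thesis unfolding pw by (rule lin) (rule i0 i1)+
  qed
  have key: "(\<integral>x. (2 + Re (u * W x)) * indicator B (X x) \<partial>M) = (\<integral>y. (2 + Re (u * W' y)) * indicator B (Y y) \<partial>N)"
    if u: "norm u = 1" for u
  proof (rule real_weight_law_unique[OF assms(1-4) _ _ _ _ _ _ _ B])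
    show "(\<lambda>x. 2 + Re (u * W x)) \<in> borel_measurable M" "(\<lambda>x. 2 + Re (u * W' x)) \<in> borel_measurable N"
      by simp_all
    have "\<bar>Re (u * z)\<bar> \<le> 1" if "norm z \<le> 1" for z
      using abs_Re_le_cmod[of "u * z"] u that by (simp add: norm_mult)
    then have a: "\<bar>Re (u * W x)\<bar> \<le> 1" "\<bar>Re (u * W' y)\<bar> \<le> 1" for x y using W by auto
    show "1 \<le> 2 + Re (u * W x)" "2 + Re (u * W x) \<le> 3" for x using a(1)[of x] by auto
    show "1 \<le> 2 + Re (u * W' x)" "2 + Re (u * W' x) \<le> 3" for x using a(2)[of x] by auto
    show "(\<integral>x. complex_of_real (2 + Re (u * W x)) * iexp (\<theta> * X x) \<partial>M) = (\<integral>y. of_real (2 + Re (u * W' y)) * iexp (\<theta> * Y y) \<partial>N)" for \<theta>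
      unfolding expand[OF assms(1,3,5) W(1)] expand[OF assms(2,4,6) W(2)] eq eq1 ..
  qed
  have zero: "(\<integral>x. indicator B (X x) \<partial>M :: real) = (\<integral>y. indicator B (Y y) \<partial>N)"
  proof -
    have "(\<integral>x. 1 * indicator B (X x) \<partial>M :: real) = (\<integral>y. 1 * indicator B (Y y) \<partial>N)"
    proof (rule real_weight_law_unique[OF assms(1-4)])
      show "(\<integral>x. complex_of_real 1 * iexp (\<theta> * X x) \<partial>M) = (\<integral>y. complex_of_real 1 * iexp (\<theta> * Y y) \<partial>N)" for \<theta>
        unfolding of_real_1 mult_1 by (rule eq1)
    qed (use B in auto)
    then show ?thesis by (simp only: mult_1)
  qed
  have iW: "integrable M (\<lambda>x. W x * indicator B (X x))" 
    by (rule M.integrable_const_bound[of _ 1]) (use W in \<open>auto simp: norm_mult indicator_def\<close>)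
  have iW': "integrable N (\<lambda>x. W' x * indicator B (Y x))" 
    by (rule N.integrable_const_bound[of _ 1]) (use W in \<open>auto simp: norm_mult indicator_def\<close>)
  have iu: "integrable M (\<lambda>x. indicator B (X x) :: real)" "integrable N (\<lambda>x. indicator B (Y x) :: real)"
    by (auto intro!: M.integrable_const_bound[of _ 1] N.integrable_const_bound[of _ 1] simp: indicator_def)
  have part: "Re (u * (\<integral>x. W x * indicator B (X x) \<partial>M)) = Re (u * (\<integral>x. W' x * indicator B (Y x) \<partial>N))" if "norm u = 1" for u
  proof -
    have "Re (u * (\<integral>x. W x * indicator B (X x) \<partial>M)) = (\<integral>x. Re (u * (W x * indicator B (X x))) \<partial>M)"
      using iW by (simp add: integral_Re[symmetric] del: times_complex.sel)
    also have "\<dots> = (\<integral>x. (2 + Re (u * W x)) * indicator B (X x) - 2 * indicator B (X x) \<partial>M)"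
      by (intro Bochner_Integration.integral_cong) (auto simp: indicator_def)
    also have "\<dots> = (\<integral>x. (2 + Re (u * W x)) * indicator B (X x) \<partial>M) - 2 * (\<integral>x. indicator B (X x) \<partial>M)"
    proof (subst Bochner_Integration.integral_diff)
      have "integrable M (\<lambda>x. 2 * indicator B (X x) + Re (u * (W x * indicator B (X x))))"
        using iW iu by (intro Bochner_Integration.integrable_add integrable_mult_right integrable_Re) auto
      then show "integrable M (\<lambda>x. (2 + Re (u * W x)) * indicator B (X x))"
        by (rule Bochner_Integration.integrable_cong[THEN iffD1, rotated -1]) (auto simp: indicator_def)
    qed (use iu in auto)
    also have "\<dots> = (\<integral>x. (2 + Re (u * W' x)) * indicator B (Y x) \<partial>N) - 2 * (\<integral>x. indicator B (Y x) \<partial>N)"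
      using key[OF that] zero by simp
    also have "\<dots> = (\<integral>x. (2 + Re (u * W' x)) * indicator B (Y x) - 2 * indicator B (Y x) \<partial>N)"
    proof (subst Bochner_Integration.integral_diff)
      have "integrable N (\<lambda>x. 2 * indicator B (Y x) + Re (u * (W' x * indicator B (Y x))))"
        using iW' iu by (intro Bochner_Integration.integrable_add integrable_mult_right integrable_Re) auto
      then show "integrable N (\<lambda>x. (2 + Re (u * W' x)) * indicator B (Y x))"
        by (rule Bochner_Integration.integrable_cong[THEN iffD1, rotated -1]) (auto simp: indicator_def)
    qed (use iu in auto)
    also have "\<dots> = (\<integral>x. Re (u * (W' x * indicator B (Y x))) \<partial>N)"
      by (intro Bochner_Integration.integral_cong) (auto simp: indicator_def)
    also have "\<dots> = Re (u * (\<integral>x. W' x * indicator B (Y x) \<partial>N))"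
      using iW' by (simp add: integral_Re[symmetric] del: times_complex.sel)
    finally show ?thesis .
  qed
  from part[of 1] part[of \<i>] show ?thesis by (intro complex_eqI) auto
qed

text \<open>Uniqueness in several dimensions follows from uniqueness on the line: the factors \<open>iexp (\<theta> j * X j)\<close> are
traded for indicators of Borel sets one coordinate at a time, while all other factors form the
complex weight.\<close>

lemma law_eqI_char:
  fixes X :: "'i \<Rightarrow> 'a \<Rightarrow> real" and Y :: "'i \<Rightarrow> 'b \<Rightarrow> real"
  assumes PM: "prob_space M" and PN: "prob_space N" and J: "finite J"
    and X[measurable]: "\<And>j. j \<in> J \<Longrightarrow> X j \<in> borel_measurable M"
    and Y[measurable]: "\<And>j. j \<in> J \<Longrightarrow> Y j \<in> borel_measurable N"
    and eq: "\<And>\<theta>. (\<integral>x. iexp (\<Sum>j\<in>J. \<theta> j * X j x) \<partial>M) = (\<integral>y. iexp (\<Sum>j\<in>J. \<theta> j * Y j y) \<partial>N)"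
  shows "distr M (\<Pi>\<^sub>M j\<in>J. borel) (\<lambda>x. \<lambda>j\<in>J. X j x) = distr N (\<Pi>\<^sub>M j\<in>J. borel) (\<lambda>x. \<lambda>j\<in>J. Y j x)"
proof -
  interpret M: prob_space M by fact
  interpret N: prob_space N by fact
  have single: "(\<integral>x. iexp (t * X k x) \<partial>M) = (\<integral>y. iexp (t * Y k y) \<partial>N)" if "k \<in> J" for k t
  proof -
    have "(\<Sum>j\<in>J. (if j = k then t else 0) * Z j) = t * Z k" for Z :: "'i \<Rightarrow> real"
      using that J by (subst sum.remove[of _ k]) (auto intro!: sum.neutral)
    then show ?thesis using eq[of "\<lambda>j. if j = k then t else 0"] by simp
  qed
  have P: "(\<integral>x. (\<Prod>j\<in>S. indicator (B j) (X j x)) * iexp (\<Sum>j\<in>J-S. \<theta> j * X j x) \<partial>M)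
      = (\<integral>x. (\<Prod>j\<in>S. indicator (B j) (Y j x)) * iexp (\<Sum>j\<in>J-S. \<theta> j * Y j x) \<partial>N)"
    if "S \<subseteq> J" "\<And>j. j \<in> S \<Longrightarrow> B j \<in> sets borel" for S B \<theta>
    using finite_subset[OF \<open>S \<subseteq> J\<close> J] that
  proof (induction S arbitrary: \<theta> rule: finite_induct)
    case empty
    then show ?case using eq by simp
  next
    case (insert k S)
    have kJ: "k \<in> J" and SJ: "\<And>j. j \<in> S \<Longrightarrow> j \<in> J" and [measurable]: "\<And>j. j \<in> S \<Longrightarrow> B j \<in> sets borel" "B k \<in> sets borel" using insert by auto
    note [measurable] = X[OF kJ] Y[OF kJ]
    have [measurable]: "\<And>j. j \<in> S \<Longrightarrow> X j \<in> borel_measurable M" "\<And>j. j \<in> S \<Longrightarrow> Y j \<in> borel_measurable N"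
      using SJ X Y by auto
    have n: "norm ((\<Prod>j\<in>S. indicator (B j) (Z j)) :: complex) \<le> 1" for Z :: "'i \<Rightarrow> real"
      unfolding prod_norm[symmetric] by (intro prod_le_1) (auto simp: indicator_def)
    let ?R = "J - insert k S"
    have "(\<integral>x. ((\<Prod>j\<in>S. indicator (B j) (X j x)) * iexp (\<Sum>j\<in>?R. \<theta> j * X j x)) * indicator (B k) (X k x) \<partial>M)
        = (\<integral>x. ((\<Prod>j\<in>S. indicator (B j) (Y j x)) * iexp (\<Sum>j\<in>?R. \<theta> j * Y j x)) * indicator (B k) (Y k x) \<partial>N)"
    proof (rule complex_weight_law_unique[OF PM PN])
      fix t
      have e: "exp (\<i> * complex_of_real (\<Sum>j\<in>?R. \<theta> j * Z j)) * iexp (t * Z k) = iexp (\<Sum>j\<in>J-S. (\<theta>(k := t)) j * Z j)" for Z :: "'i \<Rightarrow> real"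
      proof -
        have "(\<Sum>j\<in>J-S. (\<theta>(k := t)) j * Z j) = t * Z k + (\<Sum>j\<in>?R. (\<theta>(k := t)) j * Z j)"
          using kJ J insert.hyps by (subst sum.remove[of _ k]) (auto intro!: arg_cong2[where f=sum])
        also have "(\<Sum>j\<in>?R. (\<theta>(k := t)) j * Z j) = (\<Sum>j\<in>?R. \<theta> j * Z j)" by (intro sum.cong) auto
        finally show ?thesis by (simp add: exp_add[symmetric] distrib_left add.commute)
      qed
      show "(\<integral>x. ((\<Prod>j\<in>S. indicator (B j) (X j x)) * iexp (\<Sum>j\<in>?R. \<theta> j * X j x)) * iexp (t * X k x) \<partial>M)
        = (\<integral>x. ((\<Prod>j\<in>S. indicator (B j) (Y j x)) * iexp (\<Sum>j\<in>?R. \<theta> j * Y j x)) * iexp (t * Y k x) \<partial>N)"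
        unfolding mult.assoc e[of "\<lambda>j. X j x" for x] e[of "\<lambda>j. Y j x" for x] using insert by (intro insert.IH) auto
    qed (use n single[OF kJ] in \<open>auto simp: norm_mult simp del: of_real_sum\<close>)
    then show ?case using insert.hyps by (simp add: mult_ac)
  qed
  have R: "emeasure M {x\<in>space M. \<forall>j\<in>J. X j x \<in> B j} = emeasure N {x\<in>space N. \<forall>j\<in>J. Y j x \<in> B j}"
    if B[measurable]: "\<And>j. j \<in> J \<Longrightarrow> B j \<in> sets borel" for B
  proof -
    have i: "(\<Prod>j\<in>J. indicator (B j) (Z j)) = (if \<forall>j\<in>J. Z j \<in> B j then 1 else 0 :: complex)" for Z :: "'i \<Rightarrow> real"
      using J by (induction J) (auto simp: indicator_def)
    have "complex_of_real (measure M {x\<in>space M. \<forall>j\<in>J. X j x \<in> B j}) = (\<integral>x. (\<Prod>j\<in>J. indicator (B j) (X j x)) \<partial>M)"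
    proof -
      have "(\<integral>x. (\<Prod>j\<in>J. indicator (B j) (X j x)) \<partial>M) = (\<integral>x. complex_of_real (indicator {x\<in>space M. \<forall>j\<in>J. X j x \<in> B j} x) \<partial>M)"
        unfolding i by (intro Bochner_Integration.integral_cong) (auto simp: indicator_def)
      then show ?thesis using J by simp
    qed
    also have "\<dots> = (\<integral>x. (\<Prod>j\<in>J. indicator (B j) (Y j x)) \<partial>N)" using P[of J B] B by simp
    also have "\<dots> = complex_of_real (measure N {x\<in>space N. \<forall>j\<in>J. Y j x \<in> B j})"
    proof -
      have "(\<integral>x. (\<Prod>j\<in>J. indicator (B j) (Y j x)) \<partial>N) = (\<integral>x. complex_of_real (indicator {x\<in>space N. \<forall>j\<in>J. Y j x \<in> B j} x) \<partial>N)"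
        unfolding i by (intro Bochner_Integration.integral_cong) (auto simp: indicator_def)
      then show ?thesis using J by simp
    qed
    finally show ?thesis by (simp add: M.emeasure_eq_measure N.emeasure_eq_measure)
  qed
  show ?thesis
  proof (rule measure_eqI_PiM_finite[OF J])
    fix A :: "'i \<Rightarrow> real set" assume A: "\<And>i. i \<in> J \<Longrightarrow> A i \<in> sets borel"
    have "(\<lambda>x. \<lambda>j\<in>J. X j x) -` Pi\<^sub>E J A \<inter> space M = {x\<in>space M. \<forall>j\<in>J. X j x \<in> A j}"
      "(\<lambda>x. \<lambda>j\<in>J. Y j x) -` Pi\<^sub>E J A \<inter> space N = {x\<in>space N. \<forall>j\<in>J. Y j x \<in> A j}"
      by (auto simp: PiE_iff)
    then show "emeasure (distr M (Pi\<^sub>M J (\<lambda>j. borel)) (\<lambda>x. \<lambda>j\<in>J. X j x)) (Pi\<^sub>E J A) =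
        emeasure (distr N (Pi\<^sub>M J (\<lambda>j. borel)) (\<lambda>x. \<lambda>j\<in>J. Y j x)) (Pi\<^sub>E J A)"
      using A R[of A] J by (subst (1 2) emeasure_distr) (auto intro!: sets_PiM_I_finite)
  next
    show "range (\<lambda>_::nat. space (Pi\<^sub>M J (\<lambda>_. borel))) \<subseteq> prod_algebra J (\<lambda>_. borel :: real measure)"
      using J by (auto simp: prod_algebra_eq_finite space_PiM)
    show "(\<Union>i::nat. space (Pi\<^sub>M J (\<lambda>_. borel :: real measure))) = space (Pi\<^sub>M J (\<lambda>_. borel))" by auto
    show "emeasure (distr M (Pi\<^sub>M J (\<lambda>j. borel)) (\<lambda>x. \<lambda>j\<in>J. X j x)) (space (Pi\<^sub>M J (\<lambda>_. borel))) \<noteq> \<infinity>" for i :: nat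
      by (subst emeasure_distr) auto
  qed auto
qed

section \<open>Gaussian vectors and the Cameron-Martin formula\<close>

lemma (in prob_space) centered_gaussian_rv_facts:
  assumes "centered_gaussian_rv M X"
  shows centered_gaussian_rv_measurable: "X \<in> borel_measurable M"
    and centered_gaussian_rv_square_integrable: "integrable M (\<lambda>x. (X x)\<^sup>2)"
    and centered_gaussian_rv_char: "(\<integral>x. iexp (X x) \<partial>M) = of_real (exp (- expectation (\<lambda>x. (X x)\<^sup>2) / 2))"
    and centered_gaussian_rv_pos: "expectation (\<lambda>x. (X x)\<^sup>2) = V \<Longrightarrow> V \<noteq> 0 \<Longrightarrow>
        V > 0 \<and> distributed M lborel X (\<lambda>x. ennreal (normal_density 0 (sqrt V) x))"
proof -
  show [measurable]: "X \<in> borel_measurable M" using assms by (simp add: centered_gaussian_rv_def)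
  have "integrable M (\<lambda>x. (X x)\<^sup>2) \<and> (\<integral>x. iexp (X x) \<partial>M) = of_real (exp (- expectation (\<lambda>x. (X x)\<^sup>2) / 2))
    \<and> (expectation (\<lambda>x. (X x)\<^sup>2) = V \<longrightarrow> V \<noteq> 0 \<longrightarrow>
        V > 0 \<and> distributed M lborel X (\<lambda>x. ennreal (normal_density 0 (sqrt V) x)))"
  proof (cases "AE x in M. X x = 0")
    case True
    have "integrable M (\<lambda>x. (X x)\<^sup>2) \<longleftrightarrow> integrable M (\<lambda>_. 0 :: real)"
      by (rule integrable_cong_AE) (use True in auto)
    moreover have "expectation (\<lambda>x. (X x)\<^sup>2) = expectation (\<lambda>_. 0)"
      by (rule integral_cong_AE) (use True in auto)
    moreover have "(\<integral>x. iexp (X x) \<partial>M) = (\<integral>x. 1 \<partial>M)"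
      by (rule integral_cong_AE) (use True in auto)
    ultimately show ?thesis by (auto simp: prob_space)
  next
    case False
    then obtain s where s: "s > 0" and D: "distributed M lborel X (\<lambda>x. ennreal (normal_density 0 s x))"
      using assms by (auto simp: centered_gaussian_rv_def)
    have E0: "expectation X = 0" using normal_distributed_expectation[OF s D] .
    have E2: "expectation (\<lambda>x. (X x)\<^sup>2) = s\<^sup>2" using normal_distributed_variance[OF s D] E0 by simp
    have "integrable lborel (\<lambda>x. normal_density 0 s x * (x - 0)^2)" by (rule integrable_normal_moment[OF s])
    then have i: "integrable M (\<lambda>x. (X x)\<^sup>2)"
      using distributed_integrable[OF D, of "\<lambda>x. x\<^sup>2"] by simp
    have Ds: "distributed M lborel (\<lambda>x. (X x - 0) / s) (\<lambda>x. ennreal (std_normal_density x))"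
      using normal_standard_normal_convert[OF s, of X 0] D by simp
    then have "distr M lborel (\<lambda>x. X x / s) = std_normal_distribution"
      by (simp add: distributed_distr_eq_density)
    then have "char std_normal_distribution s = (\<integral>z. iexp (s * z) \<partial>distr M lborel (\<lambda>x. X x / s))"
      by (simp add: char_def)
    also have "\<dots> = (\<integral>x. iexp (X x) \<partial>M)"
      using s by (subst integral_distr) (auto simp del: of_real_mult of_real_divide)
    finally show ?thesis using E2 i s D by (auto simp add: char_std_normal_distribution)
  qed
  then show "integrable M (\<lambda>x. (X x)\<^sup>2)" "(\<integral>x. iexp (X x) \<partial>M) = of_real (exp (- expectation (\<lambda>x. (X x)\<^sup>2) / 2))"
    "expectation (\<lambda>x. (X x)\<^sup>2) = V \<Longrightarrow> V \<noteq> 0 \<Longrightarrow>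
        V > 0 \<and> distributed M lborel X (\<lambda>x. ennreal (normal_density 0 (sqrt V) x))" by auto
qed

locale gaussian_vector = prob_space P for P :: "'w measure" +
  fixes J :: "'i set" and G :: "'i \<Rightarrow> 'w \<Rightarrow> real" and c :: "'i \<Rightarrow> 'i \<Rightarrow> real" and V :: real
  assumes finJ: "finite J"
    and gaussian: "\<And>a. centered_gaussian_rv P (\<lambda>\<omega>. \<Sum>j\<in>J. a j * G j \<omega>)"
    and cov: "\<And>i j. i \<in> J \<Longrightarrow> j \<in> J \<Longrightarrow> expectation (\<lambda>\<omega>. G i \<omega> * G j \<omega>) = c i j"
    and var: "\<And>i. i \<in> J \<Longrightarrow> c i i = V"
begin

abbreviation Jborel :: "('i \<Rightarrow> real) measure" where "Jborel \<equiv> \<Pi>\<^sub>M j\<in>J. borel"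

lemma gaussian_coord: "j \<in> J \<Longrightarrow> centered_gaussian_rv P (G j)"
proof -
  assume j: "j \<in> J"
  have "(\<Sum>i\<in>J. (if i = j then 1 else 0) * G i \<omega>) = G j \<omega>" for \<omega>
    using j finJ by (subst sum.remove[of _ j]) (auto intro!: sum.neutral)
  then show ?thesis using gaussian[of "\<lambda>i. if i = j then 1 else 0"] by simp
qed

lemma measurable_coord[measurable]: "j \<in> J \<Longrightarrow> G j \<in> borel_measurable P"
  using centered_gaussian_rv_measurable gaussian_coord by auto

lemma integrable_coord_mult: "i \<in> J \<Longrightarrow> j \<in> J \<Longrightarrow> integrable P (\<lambda>\<omega>. G i \<omega> * G j \<omega>)"
proof -
  assume [simp]: "i \<in> J" "j \<in> J"
  have "\<bar>a * b\<bar> \<le> a\<^sup>2 + b\<^sup>2" for a b :: real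
  proof -
    have "2 * \<bar>a\<bar> * \<bar>b\<bar> \<le> a\<^sup>2 + b\<^sup>2" using sum_squares_bound[of "\<bar>a\<bar>" "\<bar>b\<bar>"] by simp
    moreover have "0 \<le> \<bar>a\<bar> * \<bar>b\<bar>" by simp
    ultimately show ?thesis unfolding abs_mult by linarith
  qed
  then show ?thesis
    by (intro Bochner_Integration.integrable_bound[OF Bochner_Integration.integrable_add[OF
          centered_gaussian_rv_square_integrable[OF gaussian_coord[of i]] centered_gaussian_rv_square_integrable[OF gaussian_coord[of j]]]]) auto
qed

lemma expectation_linear_square:
  "expectation (\<lambda>\<omega>. (\<Sum>j\<in>J. a j * G j \<omega>)\<^sup>2) = (\<Sum>i\<in>J. \<Sum>j\<in>J. a i * a j * c i j)"
proof -
  have "(\<Sum>j\<in>J. a j * G j \<omega>)\<^sup>2 = (\<Sum>i\<in>J. \<Sum>j\<in>J. (a i * a j) * (G i \<omega> * G j \<omega>))" for \<omega>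
    by (simp add: power2_eq_square sum_product mult_ac)
  then have "expectation (\<lambda>\<omega>. (\<Sum>j\<in>J. a j * G j \<omega>)\<^sup>2)
      = expectation (\<lambda>\<omega>. \<Sum>i\<in>J. \<Sum>j\<in>J. (a i * a j) * (G i \<omega> * G j \<omega>))" by simp
  also have "\<dots> = (\<Sum>i\<in>J. \<Sum>j\<in>J. expectation (\<lambda>\<omega>. (a i * a j) * (G i \<omega> * G j \<omega>)))"
  proof -
    have i: "integrable P (\<lambda>\<omega>. (a i * a j) * (G i \<omega> * G j \<omega>))" if "i \<in> J" "j \<in> J" for i j
      using integrable_coord_mult[OF that] by simp
    show ?thesis
      by (subst Bochner_Integration.integral_sum, rule Bochner_Integration.integrable_sum, rule i, assumption, assumption,
          rule sum.cong, rule refl, rule Bochner_Integration.integral_sum, rule i)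
  qed
  also have "\<dots> = (\<Sum>i\<in>J. \<Sum>j\<in>J. a i * a j * c i j)"
    by (intro sum.cong refl) (simp add: cov)
  finally show ?thesis .
qed

lemma char_linear:
  "(\<integral>\<omega>. iexp (\<Sum>j\<in>J. a j * G j \<omega>) \<partial>P) = of_real (exp (- (\<Sum>i\<in>J. \<Sum>j\<in>J. a i * a j * c i j) / 2))"
  using centered_gaussian_rv_char[OF gaussian[of a]] by (simp add: expectation_linear_square)

lemma cov_sym: "i \<in> J \<Longrightarrow> j \<in> J \<Longrightarrow> c i j = c j i"
  using cov[of i j] cov[of j i] by (simp add: mult.commute)

lemma degenerate:
  assumes "V = 0" "i \<in> J"
  shows "AE \<omega> in P. G i \<omega> = 0" and "j \<in> J \<Longrightarrow> c i j = 0"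
proof -
  have "expectation (\<lambda>\<omega>. (G i \<omega>)\<^sup>2) = 0" using cov[of i i] var[of i] assms by (simp add: power2_eq_square)
  then have "AE \<omega> in P. (G i \<omega>)\<^sup>2 = 0"
    using integral_nonneg_eq_0_iff_AE[OF centered_gaussian_rv_square_integrable[OF gaussian_coord[OF assms(2)]]] by simp
  then show A: "AE \<omega> in P. G i \<omega> = 0" by simp
  assume j: "j \<in> J"
  have "expectation (\<lambda>\<omega>. G i \<omega> * G j \<omega>) = expectation (\<lambda>_. 0)"
    by (rule integral_cong_AE) (use A assms j in auto)
  then show "c i j = 0" using cov[OF assms(2) j] by simp
qed

text \<open>The component of the vector along \<open>G x\<close> may be replaced by an independent copy: both vectors are
centered Gaussian with the same covariance. In the new representation the coordinate \<open>x\<close> depends on the second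
component of the product space alone and the part of the vector that is uncorrelated with it depends on the
first, which reduces the Cameron-Martin formula to a statement on the line.\<close>

lemma law_resampled:
  assumes x: "x \<in> J" and V: "V \<noteq> 0"
  shows "distr (P \<Otimes>\<^sub>M P) Jborel (\<lambda>z. \<lambda>j\<in>J. G j (fst z) + c x j / V * (G x (snd z) - G x (fst z)))
       = distr P Jborel (\<lambda>\<omega>. \<lambda>j\<in>J. G j \<omega>)"
proof (rule law_eqI_char)
  interpret PP: pair_prob_space P P ..
  show "prob_space (P \<Otimes>\<^sub>M P)" "prob_space P" by unfold_locales
  show "finite J" by (rule finJ)
  show "(\<lambda>z. G j (fst z) + c x j / V * (G x (snd z) - G x (fst z))) \<in> borel_measurable (P \<Otimes>\<^sub>M P)" if "j \<in> J" for j
    using that x by measurable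
  show "G j \<in> borel_measurable P" if "j \<in> J" for j using that by measurable
  fix \<theta> :: "'i \<Rightarrow> real"
  define \<kappa> where "\<kappa> = (\<Sum>j\<in>J. \<theta> j * c x j) / V"
  define a where "a j = \<theta> j - (if j = x then \<kappa> else 0)" for j
  define b where "b j = (if j = x then \<kappa> else 0)" for j
  have sb: "(\<Sum>j\<in>J. b j * h j) = \<kappa> * h x" for h
    using x finJ unfolding b_def by (subst sum.remove[of _ x]) (auto intro!: sum.neutral)
  have sa: "(\<Sum>j\<in>J. a j * h j) = (\<Sum>j\<in>J. \<theta> j * h j) - \<kappa> * h x" for h
    unfolding sb[symmetric] by (simp add: a_def b_def left_diff_distrib sum_subtractf)
  have split: "(\<Sum>j\<in>J. \<theta> j * (G j u + c x j / V * (G x v - G x u))) = (\<Sum>j\<in>J. a j * G j u) + (\<Sum>j\<in>J. b j * G j v)" for u v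
  proof -
    have "(\<Sum>j\<in>J. \<theta> j * (G j u + c x j / V * (G x v - G x u))) = (\<Sum>j\<in>J. \<theta> j * G j u) + \<kappa> * (G x v - G x u)"
      by (simp add: \<kappa>_def distrib_left sum.distrib sum_divide_distrib sum_distrib_right mult.assoc)
    then show ?thesis by (simp add: sa sb algebra_simps)
  qed
  define Q where "Q a = (\<Sum>i\<in>J. \<Sum>j\<in>J. a i * a j * c i j)" for a :: "'i \<Rightarrow> real"
  have QQ: "Q a = (\<Sum>i\<in>J. a i * (\<Sum>j\<in>J. a j * c i j))" for a
    by (simp add: Q_def sum_distrib_left mult.assoc)
  have cx: "(\<Sum>j\<in>J. \<theta> j * c x j) = \<kappa> * V" using V by (simp add: \<kappa>_def)
  have cx': "(\<Sum>j\<in>J. \<theta> j * c j x) = \<kappa> * V" unfolding cx[symmetric] using x by (intro sum.cong) (auto simp: cov_sym)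
  have Qb: "Q b = \<kappa> * \<kappa> * V" unfolding QQ sb by (simp add: var x)
  have "Q a = (\<Sum>i\<in>J. a i * (\<Sum>j\<in>J. \<theta> j * c i j)) - \<kappa> * (\<Sum>i\<in>J. a i * c i x)"
    unfolding QQ sa by (simp add: right_diff_distrib sum_subtractf sum_distrib_left mult_ac)
  also have "\<dots> = Q \<theta> - \<kappa> * (\<Sum>j\<in>J. \<theta> j * c x j) - \<kappa> * (\<kappa> * V - \<kappa> * V)"
    unfolding sa by (simp add: QQ cx' var x)
  finally have Qa: "Q a = Q \<theta> - \<kappa> * \<kappa> * V" by (simp add: cx)
  have "(\<integral>z. iexp (\<Sum>j\<in>J. \<theta> j * (G j (fst z) + c x j / V * (G x (snd z) - G x (fst z)))) \<partial>(P \<Otimes>\<^sub>M P))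
      = (\<integral>z. iexp (\<Sum>j\<in>J. a j * G j (fst z)) * iexp (\<Sum>j\<in>J. b j * G j (snd z)) \<partial>(P \<Otimes>\<^sub>M P))"
    unfolding split by (simp add: exp_add[symmetric] distrib_left)
  also have "\<dots> = (\<integral>u. \<integral>v. iexp (\<Sum>j\<in>J. a j * G j u) * iexp (\<Sum>j\<in>J. b j * G j v) \<partial>P \<partial>P)"
  proof (subst PP.integral_fst'[symmetric])
    show "integrable (P \<Otimes>\<^sub>M P) (\<lambda>z. iexp (\<Sum>j\<in>J. a j * G j (fst z)) * iexp (\<Sum>j\<in>J. b j * G j (snd z)))"
      by (rule PP.integrable_const_bound[of _ 1]) (auto simp: norm_mult simp del: of_real_sum)
  qed simp
  also have "\<dots> = (\<integral>u. iexp (\<Sum>j\<in>J. a j * G j u) \<partial>P) * (\<integral>v. iexp (\<Sum>j\<in>J. b j * G j v) \<partial>P)"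
    by (simp only: integral_mult_right_zero integral_mult_left_zero)
  also have "\<dots> = of_real (exp (- Q a / 2) * exp (- Q b / 2))"
    unfolding char_linear Q_def by simp
  also have "exp (- Q a / 2) * exp (- Q b / 2) = exp (- Q \<theta> / 2)"
    unfolding Qa Qb exp_add[symmetric] by (simp add: field_simps)
  also have "of_real (exp (- Q \<theta> / 2)) = (\<integral>\<omega>. iexp (\<Sum>j\<in>J. \<theta> j * G j \<omega>) \<partial>P)"
    unfolding char_linear Q_def ..
  finally show "(\<integral>z. iexp (\<Sum>j\<in>J. \<theta> j * (G j (fst z) + c x j / V * (G x (snd z) - G x (fst z)))) \<partial>(P \<Otimes>\<^sub>M P))
    = (\<integral>\<omega>. iexp (\<Sum>j\<in>J. \<theta> j * G j \<omega>) \<partial>P)" .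
qed

text \<open>Cameron-Martin density of the shift of the vector by \<open>- s\<close> times the row of \<open>x\<close> in the covariance matrix. For \<open>s = 1\<close> it is
also the lognormal variable \<open>exp (- G x)\<close> divided by its mean; this double role is what the proof rests on.\<close>

definition w :: "real \<Rightarrow> 'i \<Rightarrow> 'w \<Rightarrow> real" where
  "w s x \<omega> = exp (- s * G x \<omega> - s\<^sup>2 * V / 2)"

lemma w_pos[simp]: "0 < w s x \<omega>" by (simp add: w_def)

lemma w_measurable[measurable]: "x \<in> J \<Longrightarrow> w s x \<in> borel_measurable P"
  unfolding w_def by measurable

lemma normal_tilt:
  fixes g :: "real \<Rightarrow> ennreal"
  assumes [measurable]: "g \<in> borel_measurable borel" and V: "0 < V"
  shows "(\<integral>\<^sup>+z. ennreal (normal_density 0 (sqrt V) z) * (ennreal (exp (- s * z - s\<^sup>2 * V / 2)) * g z) \<partial>lborel)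
       = (\<integral>\<^sup>+z. ennreal (normal_density 0 (sqrt V) z) * g (z - s * V) \<partial>lborel)"
proof -
  have n: "normal_density 0 (sqrt V) z * exp (- s * z - s\<^sup>2 * V / 2) = normal_density 0 (sqrt V) (z + s * V)" for z
  proof -
    have "(z + s * V)\<^sup>2 / (2 * V) = z\<^sup>2 / (2 * V) + s * z + s\<^sup>2 * V / 2"
      using V by (simp add: field_simps power2_eq_square)
    then show ?thesis using V by (simp add: normal_density_def exp_add[symmetric] algebra_simps)
  qed
  have "(\<integral>\<^sup>+z. ennreal (normal_density 0 (sqrt V) z) * g (z - s * V) \<partial>lborel)
      = (\<integral>\<^sup>+z. ennreal (normal_density 0 (sqrt V) (s * V + z)) * g z \<partial>lborel)"
    by (subst nn_integral_real_affine[where c=1 and t="s * V"]) auto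
  also have "\<dots> = (\<integral>\<^sup>+z. ennreal (normal_density 0 (sqrt V) z) * (ennreal (exp (- s * z - s\<^sup>2 * V / 2)) * g z) \<partial>lborel)"
    by (simp add: n[symmetric] ennreal_mult mult.assoc add.commute)
  finally show ?thesis ..
qed

text \<open>Conditionally on the first component of \<open>law_resampled\<close>, only \<open>G x\<close> is random, and
\<open>normal_tilt\<close> shifts it by \<open>- s * V\<close>; the vector then moves by \<open>- s * c x j\<close> in the coordinate \<open>j\<close>.\<close>

lemma tilted_law:
  assumes x: "x \<in> J"
  shows "distr (density P (\<lambda>\<omega>. ennreal (w s x \<omega>))) Jborel (\<lambda>\<omega>. \<lambda>j\<in>J. G j \<omega>)
       = distr P Jborel (\<lambda>\<omega>. \<lambda>j\<in>J. G j \<omega> - s * c x j)"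
proof (cases "V = 0")
  case True
  have "density P (\<lambda>\<omega>. ennreal (w s x \<omega>)) = density P (\<lambda>_. 1)"
  proof (rule density_cong)
    show "(\<lambda>\<omega>. ennreal (w s x \<omega>)) \<in> borel_measurable P" using x by measurable
    show "AE \<omega> in P. ennreal (w s x \<omega>) = 1"
      using degenerate(1)[OF True x] by eventually_elim (subst w_def, simp add: \<open>V = 0\<close>)
  qed simp
  then show ?thesis
    using degenerate(2)[OF True x] by (simp add: density_1 cong: restrict_cong)
next
  case False
  interpret PP: pair_prob_space P P ..
  have vx: "expectation (\<lambda>\<omega>. (G x \<omega>)\<^sup>2) = V" using cov[OF x x] var[OF x] by (simp add: power2_eq_square)
  have V: "0 < V" and D: "distributed P lborel (G x) (\<lambda>z. ennreal (normal_density 0 (sqrt V) z))"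
    using centered_gaussian_rv_pos[OF gaussian_coord[OF x] vx False] by auto
  let ?H = "\<lambda>z. \<lambda>j\<in>J. G j (fst z) + c x j / V * (G x (snd z) - G x (fst z))"
  have Hm[measurable]: "?H \<in> (P \<Otimes>\<^sub>M P) \<rightarrow>\<^sub>M Jborel"
    using x by (intro measurable_restrict) measurable
  have Gm[measurable]: "(\<lambda>\<omega>. \<lambda>j\<in>J. G j \<omega>) \<in> P \<rightarrow>\<^sub>M Jborel"
    by (intro measurable_restrict) measurable
  have law: "(\<integral>\<^sup>+\<omega>. \<Psi> (\<lambda>j\<in>J. G j \<omega>) \<partial>P) = (\<integral>\<^sup>+u. \<integral>\<^sup>+v. \<Psi> (?H (u, v)) \<partial>P \<partial>P)"
    if [measurable]: "\<Psi> \<in> borel_measurable Jborel" for \<Psi> :: "('i \<Rightarrow> real) \<Rightarrow> ennreal"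
  proof -
    have "(\<integral>\<^sup>+z. \<Psi> (?H z) \<partial>(P \<Otimes>\<^sub>M P)) = (\<integral>\<^sup>+v. \<Psi> v \<partial>distr (P \<Otimes>\<^sub>M P) Jborel ?H)"
      by (rule nn_integral_distr[OF Hm, symmetric]) simp
    also have "\<dots> = (\<integral>\<^sup>+v. \<Psi> v \<partial>distr P Jborel (\<lambda>\<omega>. \<lambda>j\<in>J. G j \<omega>))"
      by (simp only: law_resampled[OF x False])
    also have "\<dots> = (\<integral>\<^sup>+\<omega>. \<Psi> (\<lambda>j\<in>J. G j \<omega>) \<partial>P)"
      by (rule nn_integral_distr[OF Gm]) simp
    finally have "(\<integral>\<^sup>+\<omega>. \<Psi> (\<lambda>j\<in>J. G j \<omega>) \<partial>P) = (\<integral>\<^sup>+z. \<Psi> (?H z) \<partial>(P \<Otimes>\<^sub>M P))" ..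
    then show ?thesis using measurable_compose[OF Hm that] by (subst (asm) nn_integral_fst[symmetric]) simp_all
  qed
  show ?thesis
  proof (rule measure_eqI)
    fix A assume "A \<in> sets (distr (density P (\<lambda>\<omega>. ennreal (w s x \<omega>))) Jborel (\<lambda>\<omega>. \<lambda>j\<in>J. G j \<omega>))"
    then have A[measurable]: "A \<in> sets Jborel" by simp
    have xm[measurable]: "(\<lambda>v. v x) \<in> borel_measurable Jborel" using x by measurable
    have sm[measurable]: "(\<lambda>v. \<lambda>j\<in>J. v j - s * c x j) \<in> Jborel \<rightarrow>\<^sub>M Jborel"
      by (intro measurable_restrict) measurable
    have inner: "(\<integral>\<^sup>+v. ennreal (exp (- s * (?H (u, v)) x - s\<^sup>2 * V / 2)) * indicator A (?H (u, v)) \<partial>P)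
       = (\<integral>\<^sup>+v. indicator A (\<lambda>j\<in>J. (?H (u, v)) j - s * c x j) \<partial>P)" for u
    proof -
      define g :: "real \<Rightarrow> ennreal" where "g z = indicator A (\<lambda>j\<in>J. G j u + c x j / V * (z - G x u))" for z
      have [measurable]: "(\<lambda>z. \<lambda>j\<in>J. G j u + c x j / V * (z - G x u)) \<in> borel \<rightarrow>\<^sub>M Jborel"
        by (intro measurable_restrict) measurable
      have [measurable]: "g \<in> borel_measurable borel" unfolding g_def by measurable
      have "(\<integral>\<^sup>+v. ennreal (exp (- s * (?H (u, v)) x - s\<^sup>2 * V / 2)) * indicator A (?H (u, v)) \<partial>P)
        = (\<integral>\<^sup>+v. ennreal (exp (- s * G x v - s\<^sup>2 * V / 2)) * g (G x v) \<partial>P)"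
        using x V by (simp add: g_def var)
      also have "\<dots> = (\<integral>\<^sup>+z. ennreal (normal_density 0 (sqrt V) z) * (ennreal (exp (- s * z - s\<^sup>2 * V / 2)) * g z) \<partial>lborel)"
        by (subst distributed_nn_integral[OF D]) auto
      also have "\<dots> = (\<integral>\<^sup>+z. ennreal (normal_density 0 (sqrt V) z) * g (z - s * V) \<partial>lborel)"
        by (rule normal_tilt[OF _ V]) measurable
      also have "\<dots> = (\<integral>\<^sup>+v. g (G x v - s * V) \<partial>P)"
        by (subst distributed_nn_integral[OF D]) auto
      also have "\<dots> = (\<integral>\<^sup>+v. indicator A (\<lambda>j\<in>J. (?H (u, v)) j - s * c x j) \<partial>P)"
        unfolding g_def using V by (intro nn_integral_cong arg_cong[where f="indicator A"]) (auto simp: fun_eq_iff restrict_def field_simps)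
      finally show ?thesis .
    qed
    have "emeasure (distr (density P (\<lambda>\<omega>. ennreal (w s x \<omega>))) Jborel (\<lambda>\<omega>. \<lambda>j\<in>J. G j \<omega>)) A
       = (\<integral>\<^sup>+v. indicator A v \<partial>(distr (density P (\<lambda>\<omega>. ennreal (w s x \<omega>))) Jborel (\<lambda>\<omega>. \<lambda>j\<in>J. G j \<omega>)))"
      by simp
    also have "\<dots> = (\<integral>\<^sup>+\<omega>. ennreal (w s x \<omega>) * indicator A (\<lambda>j\<in>J. G j \<omega>) \<partial>P)"
      using x by (subst nn_integral_distr, measurable, subst nn_integral_density) auto
    also have "\<dots> = (\<integral>\<^sup>+\<omega>. (\<lambda>v. ennreal (exp (- s * v x - s\<^sup>2 * V / 2)) * indicator A v) (\<lambda>j\<in>J. G j \<omega>) \<partial>P)"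
      using x by (simp add: w_def)
    also have "\<dots> = (\<integral>\<^sup>+u. \<integral>\<^sup>+v. ennreal (exp (- s * (?H (u, v)) x - s\<^sup>2 * V / 2)) * indicator A (?H (u, v)) \<partial>P \<partial>P)"
      by (rule law) measurable
    also have "\<dots> = (\<integral>\<^sup>+u. \<integral>\<^sup>+v. (\<lambda>y. indicator A (\<lambda>j\<in>J. y j - s * c x j)) (?H (u, v)) \<partial>P \<partial>P)"
      unfolding inner ..
    also have "\<dots> = (\<integral>\<^sup>+\<omega>. (\<lambda>y. indicator A (\<lambda>j\<in>J. y j - s * c x j)) (\<lambda>j\<in>J. G j \<omega>) \<partial>P)"
      by (rule law[symmetric]) measurable
    also have "\<dots> = (\<integral>\<^sup>+\<omega>. indicator A (\<lambda>j\<in>J. G j \<omega> - s * c x j) \<partial>P)" by (simp cong: restrict_cong)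
    also have "\<dots> = (\<integral>\<^sup>+v. indicator A v \<partial>distr P Jborel (\<lambda>\<omega>. \<lambda>j\<in>J. G j \<omega> - s * c x j))"
      by (subst nn_integral_distr) (auto intro!: measurable_restrict)
    also have "\<dots> = emeasure (distr P Jborel (\<lambda>\<omega>. \<lambda>j\<in>J. G j \<omega> - s * c x j)) A" by simp
    finally show "emeasure (distr (density P (\<lambda>\<omega>. ennreal (w s x \<omega>))) Jborel (\<lambda>\<omega>. \<lambda>j\<in>J. G j \<omega>)) A
       = emeasure (distr P Jborel (\<lambda>\<omega>. \<lambda>j\<in>J. G j \<omega> - s * c x j)) A" .
  qed simp
qed

lemma cameron_martin:
  fixes \<Psi> :: "('i \<Rightarrow> real) \<Rightarrow> real"
  assumes x: "x \<in> J" and [measurable]: "\<Psi> \<in> borel_measurable Jborel"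
  shows "expectation (\<lambda>\<omega>. w s x \<omega> * \<Psi> (\<lambda>j\<in>J. G j \<omega>)) = expectation (\<lambda>\<omega>. \<Psi> (\<lambda>j\<in>J. G j \<omega> - s * c x j))"
    and "integrable P (\<lambda>\<omega>. w s x \<omega> * \<Psi> (\<lambda>j\<in>J. G j \<omega>)) \<longleftrightarrow> integrable P (\<lambda>\<omega>. \<Psi> (\<lambda>j\<in>J. G j \<omega> - s * c x j))"
proof -
  have [measurable]: "(\<lambda>\<omega>. \<lambda>j\<in>J. G j \<omega>) \<in> P \<rightarrow>\<^sub>M Jborel" "(\<lambda>\<omega>. \<lambda>j\<in>J. G j \<omega> - s * c x j) \<in> P \<rightarrow>\<^sub>M Jborel"
    by (intro measurable_restrict, measurable)+
  have "(\<integral>v. \<Psi> v \<partial>distr (density P (\<lambda>\<omega>. ennreal (w s x \<omega>))) Jborel (\<lambda>\<omega>. \<lambda>j\<in>J. G j \<omega>))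
    = (\<integral>v. \<Psi> v \<partial>distr P Jborel (\<lambda>\<omega>. \<lambda>j\<in>J. G j \<omega> - s * c x j))"
    by (simp only: tilted_law[OF x])
  then show "expectation (\<lambda>\<omega>. w s x \<omega> * \<Psi> (\<lambda>j\<in>J. G j \<omega>)) = expectation (\<lambda>\<omega>. \<Psi> (\<lambda>j\<in>J. G j \<omega> - s * c x j))"
    using x by (simp add: integral_distr integral_density less_imp_le)
  have "integrable (distr (density P (\<lambda>\<omega>. ennreal (w s x \<omega>))) Jborel (\<lambda>\<omega>. \<lambda>j\<in>J. G j \<omega>)) \<Psi>
    \<longleftrightarrow> integrable (distr P Jborel (\<lambda>\<omega>. \<lambda>j\<in>J. G j \<omega> - s * c x j)) \<Psi>"
    by (simp only: tilted_law[OF x])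
  then show "integrable P (\<lambda>\<omega>. w s x \<omega> * \<Psi> (\<lambda>j\<in>J. G j \<omega>)) \<longleftrightarrow> integrable P (\<lambda>\<omega>. \<Psi> (\<lambda>j\<in>J. G j \<omega> - s * c x j))"
    using x by (simp add: integrable_distr_eq integrable_density less_imp_le)
qed

end

section \<open>Averages of lognormal variables\<close>

lemma abs_exp_minus_one_le:
  fixes t :: real
  assumes "\<bar>t\<bar> \<le> b"
  shows "\<bar>exp t - 1\<bar> \<le> exp b * \<bar>t\<bar>"
proof (cases "t \<ge> 0")
  case True
  have "exp t - 1 \<le> t * exp t"
    using exp_ge_add_one_self[of "- t"] mult_left_mono[of "1 - t" "exp (- t)" "exp t"]
    by (simp add: exp_minus algebra_simps)
  also have "\<dots> \<le> t * exp b" using True assms by (intro mult_left_mono) auto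
  finally show ?thesis using True by (simp add: mult.commute)
next
  case False
  have "exp t < 1" using False by simp
  with exp_ge_add_one_self[of t] have "\<bar>exp t - 1\<bar> \<le> \<bar>t\<bar>" by linarith
  also have "\<dots> \<le> exp b * \<bar>t\<bar>"
    using mult_right_mono[of 1 "exp b" "\<bar>t\<bar>"] assms one_le_exp_iff[of b] by simp
  finally show ?thesis .
qed

text \<open>Jensen's inequality for weights of arbitrary total mass.\<close>

lemma weighted_power_mean:
  fixes q u :: "'i \<Rightarrow> real"
  assumes J: "finite J" and q: "\<And>j. j \<in> J \<Longrightarrow> 0 \<le> q j" and u: "\<And>j. j \<in> J \<Longrightarrow> 0 \<le> u j"
  shows "(\<Sum>j\<in>J. q j * u j) ^ Suc n \<le> (\<Sum>j\<in>J. q j) ^ n * (\<Sum>j\<in>J. q j * u j ^ Suc n)"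
proof (cases "(\<Sum>j\<in>J. q j) = 0")
  case True
  then have "\<And>j. j \<in> J \<Longrightarrow> q j = 0" using sum_nonneg_eq_0_iff[OF J] q by auto
  then show ?thesis by simp
next
  case False
  define quot where "quot = (\<Sum>j\<in>J. q j)"
  have quot: "0 < quot" using False q sum_nonneg[of J q] unfolding quot_def by fastforce
  have "convex_on {0::real..} (\<lambda>x. x ^ Suc n)"
    by (cases "even (Suc n)") (auto intro: convex_power_odd convex_on_subset[OF convex_power_even] simp del: power_Suc)
  then have "(\<Sum>j\<in>J. (q j / quot) *\<^sub>R u j) ^ Suc n \<le> (\<Sum>j\<in>J. q j / quot * u j ^ Suc n)"
    using False q u quot by (intro convex_on_sum[OF J]) (auto simp: quot_def sum_divide_distrib[symmetric])
  then have "((\<Sum>j\<in>J. q j * u j) / quot) ^ Suc n \<le> (\<Sum>j\<in>J. q j * u j ^ Suc n) / quot"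
    by (simp add: sum_divide_distrib)
  then have "quot ^ Suc n * ((\<Sum>j\<in>J. q j * u j) / quot) ^ Suc n \<le> quot ^ Suc n * ((\<Sum>j\<in>J. q j * u j ^ Suc n) / quot)"
    using quot by (intro mult_left_mono zero_le_power) auto
  moreover have "quot ^ Suc n * ((\<Sum>j\<in>J. q j * u j) / quot) ^ Suc n = (\<Sum>j\<in>J. q j * u j) ^ Suc n"
    using quot by (simp only: power_mult_distrib[symmetric]) simp
  moreover have "quot ^ Suc n * ((\<Sum>j\<in>J. q j * u j ^ Suc n) / quot) = quot ^ n * (\<Sum>j\<in>J. q j * u j ^ Suc n)"
    using quot by simp
  ultimately show ?thesis unfolding quot_def[symmetric] by (simp only:)
qed

context gaussian_vector
begin

lemma V_nonneg: "J \<noteq> {} \<Longrightarrow> 0 \<le> V"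
proof -
  assume "J \<noteq> {}"
  then obtain i where "i \<in> J" by blast
  moreover have "0 \<le> expectation (\<lambda>\<omega>. G i \<omega> * G i \<omega>)" by (rule Bochner_Integration.integral_nonneg) simp
  ultimately show ?thesis using cov[of i i] var[of i] by simp
qed

lemma cov_le_V: assumes "i \<in> J" "j \<in> J" shows "\<bar>c i j\<bar> \<le> V"
proof -
  have "2 * \<bar>c i j\<bar> = \<bar>expectation (\<lambda>\<omega>. 2 * (G i \<omega> * G j \<omega>))\<bar>" using assms by (simp add: cov)
  also have "\<dots> \<le> expectation (\<lambda>\<omega>. \<bar>2 * (G i \<omega> * G j \<omega>)\<bar>)" by (rule integral_abs_bound)
  also have "\<dots> \<le> expectation (\<lambda>\<omega>. G i \<omega> * G i \<omega> + G j \<omega> * G j \<omega>)"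
  proof (intro integral_mono integrable_abs Bochner_Integration.integrable_add Bochner_Integration.integrable_mult_right integrable_coord_mult assms)
    fix \<omega> show "\<bar>2 * (G i \<omega> * G j \<omega>)\<bar> \<le> G i \<omega> * G i \<omega> + G j \<omega> * G j \<omega>"
      using sum_squares_bound[of "\<bar>G i \<omega>\<bar>" "\<bar>G j \<omega>\<bar>"] by (simp add: abs_mult power2_eq_square)
  qed
  also have "\<dots> = 2 * V" using assms by (simp add: integrable_coord_mult cov var)
  finally show ?thesis by simp
qed

definition wprod :: "(real \<times> 'i) list \<Rightarrow> 'w \<Rightarrow> real" where
  "wprod xs \<omega> = prod_list (map (\<lambda>(a, y). w a y \<omega>) xs)"

primrec wexp :: "(real \<times> 'i) list \<Rightarrow> real" where
  "wexp [] = 0"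
| "wexp (z # xs) = sum_list (map (\<lambda>z'. fst z * fst z' * c (snd z) (snd z')) xs) + wexp xs"

text \<open>Each factor of the product is a density; removing it by the Cameron-Martin formula multiplies the remaining
factors by constants. In contrast to a direct computation, this needs no case distinction between equal and distinct indices.\<close>

lemma wprod_moment:
  assumes "\<forall>z\<in>set xs. snd z \<in> J"
  shows "integrable P (wprod xs)" "expectation (wprod xs) = exp (wexp xs)"
proof -
  have "integrable P (wprod xs) \<and> expectation (wprod xs) = exp (wexp xs)" using assms
  proof (induction xs)
    case Nil
    then show ?case by (simp add: wprod_def[abs_def] prob_space)
  next
    case (Cons z xs)
    obtain a x where z: "z = (a, x)" by fastforce
    have x: "x \<in> J" and xs: "\<forall>z\<in>set xs. snd z \<in> J" using Cons.prems z by auto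
    define \<Psi> where "\<Psi> ys v = prod_list (map (\<lambda>(b, y). exp (- b * v y - b\<^sup>2 * V / 2)) ys)" for ys and v :: "'i \<Rightarrow> real"
    have m: "\<Psi> xs \<in> borel_measurable Jborel" using xs
    proof (induction xs)
      case (Cons z' ys)
      have [measurable]: "snd z' \<in> J" "\<Psi> ys \<in> borel_measurable Jborel" using Cons by auto
      then have [measurable]: "(\<lambda>v. v (snd z')) \<in> borel_measurable Jborel" by measurable
      have "\<Psi> (z' # ys) = (\<lambda>v. exp (- fst z' * v (snd z') - (fst z')\<^sup>2 * V / 2) * \<Psi> ys v)"
        by (auto simp: \<Psi>_def fun_eq_iff split: prod.splits)
      then show ?case by simp
    qed (simp add: \<Psi>_def[abs_def])
    have e1: "\<Psi> xs (\<lambda>j\<in>J. G j \<omega>) = wprod xs \<omega>" for \<omega>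
      using xs unfolding \<Psi>_def wprod_def w_def by (intro arg_cong[where f=prod_list] map_cong) auto
    have e2: "\<Psi> xs (\<lambda>j\<in>J. G j \<omega> - a * c x j) = exp (sum_list (map (\<lambda>z'. a * fst z' * c x (snd z')) xs)) * wprod xs \<omega>" for \<omega>
      using xs
    proof (induction xs)
      case (Cons z' ys)
      have "\<Psi> (z' # ys) (\<lambda>j\<in>J. G j \<omega> - a * c x j) =
        exp (a * fst z' * c x (snd z')) * w (fst z') (snd z') \<omega> * \<Psi> ys (\<lambda>j\<in>J. G j \<omega> - a * c x j)"
        using Cons.prems by (auto simp: \<Psi>_def w_def exp_add[symmetric] algebra_simps split: prod.splits)
      moreover have "wprod (z' # ys) \<omega> = w (fst z') (snd z') \<omega> * wprod ys \<omega>"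
        by (simp add: wprod_def split: prod.splits)
      moreover have "\<Psi> ys (\<lambda>j\<in>J. G j \<omega> - a * c x j) = exp (sum_list (map (\<lambda>z'. a * fst z' * c x (snd z')) ys)) * wprod ys \<omega>"
        by (rule Cons.IH) (use Cons.prems in simp)
      ultimately show ?case by (simp only: list.map sum_list.Cons exp_add mult_ac)
    qed (simp add: \<Psi>_def wprod_def)
    have IH: "integrable P (wprod xs)" "expectation (wprod xs) = exp (wexp xs)" using Cons.IH xs by auto
    have eq: "wprod (z # xs) = (\<lambda>\<omega>. w a x \<omega> * \<Psi> xs (\<lambda>j\<in>J. G j \<omega>))"
      by (simp add: fun_eq_iff e1) (simp add: wprod_def z)
    show ?case unfolding eq cameron_martin[OF x m] using IH
      by (simp add: e2 z exp_add)
  qed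
  then show "integrable P (wprod xs)" "expectation (wprod xs) = exp (wexp xs)" by auto
qed

lemma w_integrable: "x \<in> J \<Longrightarrow> integrable P (w a x)"
  and w_expectation: "x \<in> J \<Longrightarrow> expectation (w a x) = 1"
  using wprod_moment[of "[(a, x)]"] by (simp_all add: wprod_def[abs_def])

lemma w2_integrable: "x \<in> J \<Longrightarrow> y \<in> J \<Longrightarrow> integrable P (\<lambda>\<omega>. w a x \<omega> * w b y \<omega>)"
  and w2_expectation: "x \<in> J \<Longrightarrow> y \<in> J \<Longrightarrow> expectation (\<lambda>\<omega>. w a x \<omega> * w b y \<omega>) = exp (a * b * c x y)"
  using wprod_moment[of "[(a, x), (b, y)]"] by (auto simp add: wprod_def[abs_def])

lemma w4_integrable: "x \<in> J \<Longrightarrow> y \<in> J \<Longrightarrow> x' \<in> J \<Longrightarrow> y' \<in> J \<Longrightarrow> integrable P (\<lambda>\<omega>. (w a x \<omega> * w b y \<omega>) * (w a' x' \<omega> * w b' y' \<omega>))"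
  and w4_expectation: "x \<in> J \<Longrightarrow> y \<in> J \<Longrightarrow> x' \<in> J \<Longrightarrow> y' \<in> J \<Longrightarrow> expectation (\<lambda>\<omega>. (w a x \<omega> * w b y \<omega>) * (w a' x' \<omega> * w b' y' \<omega>))
     = exp (a * b * c x y + a' * b' * c x' y') * exp (a * a' * c x x' + a * b' * c x y' + b * a' * c y x' + b * b' * c y y')"
  using wprod_moment[of "[(a, x), (b, y), (a', x'), (b', y')]"]
  by (simp_all add: wprod_def[abs_def] mult.assoc exp_add[symmetric] algebra_simps)

lemma w_power: "w a x \<omega> ^ n = exp ((real n)\<^sup>2 * a\<^sup>2 * V / 2 - real n * a\<^sup>2 * V / 2) * w (real n * a) x \<omega>"
  unfolding w_def exp_of_nat_mult[symmetric] exp_add[symmetric] by (simp add: power_mult_distrib algebra_simps)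

lemma w_power_integrable: "x \<in> J \<Longrightarrow> integrable P (\<lambda>\<omega>. w a x \<omega> ^ n)"
  unfolding w_power by (simp add: w_integrable)

lemma w_power_expectation: "x \<in> J \<Longrightarrow> expectation (\<lambda>\<omega>. w a x \<omega> ^ n) = exp ((real n)\<^sup>2 * a\<^sup>2 * V / 2 - real n * a\<^sup>2 * V / 2)"
  unfolding w_power by (simp add: w_integrable w_expectation)

text \<open>All functionals of the field depend on the normalised exponentials only, and the Cameron-Martin shift acts on them by the
multiplication \<open>tilt\<close>.\<close>

definition ev :: "'w \<Rightarrow> 'i \<Rightarrow> real" where "ev \<omega> = (\<lambda>j\<in>J. w 1 j \<omega>)"

definition tilt :: "real \<Rightarrow> 'i \<Rightarrow> ('i \<Rightarrow> real) \<Rightarrow> 'i \<Rightarrow> real" where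
  "tilt s x u = (\<lambda>j\<in>J. u j * exp (s * c x j))"

lemma ev_pos: "j \<in> J \<Longrightarrow> 0 < ev \<omega> j" by (simp add: ev_def)
lemma ev_eq: "j \<in> J \<Longrightarrow> ev \<omega> j = w 1 j \<omega>" by (simp add: ev_def)
lemma tilt_pos: "j \<in> J \<Longrightarrow> 0 < u j \<Longrightarrow> 0 < tilt s x u j" by (simp add: tilt_def)
lemma tilt_0: "u \<in> extensional J \<Longrightarrow> tilt 0 x u = u" by (auto simp: tilt_def fun_eq_iff extensional_def)
lemma ev_ext[simp]: "ev \<omega> \<in> extensional J" by (simp add: ev_def)

lemma ev_measurable[measurable]: "ev \<in> P \<rightarrow>\<^sub>M Jborel"
  unfolding ev_def[abs_def] by (intro measurable_restrict w_measurable)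

lemma tilt_measurable[measurable]: "tilt s x \<in> Jborel \<rightarrow>\<^sub>M Jborel"
  unfolding tilt_def[abs_def] by (intro measurable_restrict) measurable

lemma cameron_martin_exp:
  fixes \<Phi> :: "('i \<Rightarrow> real) \<Rightarrow> real"
  assumes x: "x \<in> J" and [measurable]: "\<Phi> \<in> borel_measurable Jborel"
  shows "expectation (\<lambda>\<omega>. w s x \<omega> * \<Phi> (ev \<omega>)) = expectation (\<lambda>\<omega>. \<Phi> (tilt s x (ev \<omega>)))"
    and "integrable P (\<lambda>\<omega>. w s x \<omega> * \<Phi> (ev \<omega>)) \<longleftrightarrow> integrable P (\<lambda>\<omega>. \<Phi> (tilt s x (ev \<omega>)))"
proof -
  define \<Psi> where "\<Psi> v = \<Phi> (\<lambda>j\<in>J. exp (- v j - V / 2))" for v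
  have "(\<lambda>v. \<lambda>j\<in>J. exp (- v j - V / 2)) \<in> Jborel \<rightarrow>\<^sub>M Jborel" by (intro measurable_restrict) measurable
  then have m: "\<Psi> \<in> borel_measurable Jborel" unfolding \<Psi>_def by measurable
  have 1: "\<Psi> (\<lambda>j\<in>J. G j \<omega>) = \<Phi> (ev \<omega>)" for \<omega>
    unfolding \<Psi>_def ev_def w_def by (intro arg_cong[where f=\<Phi>]) (auto simp: fun_eq_iff)
  have 2: "\<Psi> (\<lambda>j\<in>J. G j \<omega> - s * c x j) = \<Phi> (tilt s x (ev \<omega>))" for \<omega>
    unfolding \<Psi>_def ev_def w_def tilt_def by (intro arg_cong[where f=\<Phi>]) (auto simp: fun_eq_iff exp_add[symmetric] algebra_simps)
  show "expectation (\<lambda>\<omega>. w s x \<omega> * \<Phi> (ev \<omega>)) = expectation (\<lambda>\<omega>. \<Phi> (tilt s x (ev \<omega>)))"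
    "integrable P (\<lambda>\<omega>. w s x \<omega> * \<Phi> (ev \<omega>)) \<longleftrightarrow> integrable P (\<lambda>\<omega>. \<Phi> (tilt s x (ev \<omega>)))"
    using cameron_martin[OF x m, of s] by (simp_all add: 1 2)
qed

end

text \<open>The indices are sample points of weight \<open>p\<close>, and \<open>\<eta>\<close> bounds the average correlation with a given point. For
the field with the argument scaled by \<open>\<epsilon>\<close> it is proportional to \<open>\<epsilon>\<close>, and the powers of \<open>\<eta>\<close> below are to be read as powers of \<open>\<epsilon>\<close>.\<close>

locale lognormal_average = gaussian_vector P J G c V
  for P :: "'w measure" and J :: "'i set" and G c V +
  fixes p \<eta> :: real
  assumes p_pos: "0 < p" and p_sum: "(\<Sum>j\<in>J. p) = 1"
    and eta_pos: "0 < \<eta>" and eta: "\<And>x. x \<in> J \<Longrightarrow> (\<Sum>y\<in>J. p * \<bar>c x y\<bar>) \<le> \<eta>"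
begin

lemma J_ne: "J \<noteq> {}" using p_sum by auto
lemma V0: "0 \<le> V" using V_nonneg J_ne by auto

definition avg :: "('i \<Rightarrow> real) \<Rightarrow> ('i \<Rightarrow> real) \<Rightarrow> real" where "avg h u = (\<Sum>j\<in>J. p * h j * u j)"
abbreviation mass :: "('i \<Rightarrow> real) \<Rightarrow> real" where "mass \<equiv> avg (\<lambda>_. 1)"

lemma avg_measurable[measurable]: "avg h \<in> borel_measurable Jborel"
  unfolding avg_def[abs_def] by measurable

lemma avg_ev_measurable[measurable]: "(\<lambda>\<omega>. avg h (ev \<omega>)) \<in> borel_measurable P"
  by measurable

lemma mass_pos: "(\<And>j. j \<in> J \<Longrightarrow> 0 < u j) \<Longrightarrow> 0 < mass u"
  unfolding avg_def using J_ne finJ p_pos by (intro sum_pos) auto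

lemma mass_ev_pos: "0 < mass (ev \<omega>)" by (rule mass_pos) (rule ev_pos)

lemma abs_S_le:
  assumes "\<And>j. j \<in> J \<Longrightarrow> \<bar>h j\<bar> \<le> H" "\<And>j. j \<in> J \<Longrightarrow> 0 \<le> u j"
  shows "\<bar>avg h u\<bar> \<le> H * mass u"
proof -
  have "\<bar>avg h u\<bar> \<le> (\<Sum>j\<in>J. \<bar>p * h j * u j\<bar>)" unfolding avg_def by (rule sum_abs)
  also have "\<dots> \<le> (\<Sum>j\<in>J. H * (p * 1 * u j))"
    using assms p_pos by (intro sum_mono) (auto simp: abs_mult intro!: mult_right_mono)
  finally show ?thesis by (simp add: avg_def sum_distrib_left)
qed

lemma abs_S_ev_le:
  assumes "\<And>j. j \<in> J \<Longrightarrow> \<bar>h j\<bar> \<le> H"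
  shows "\<bar>avg h (ev \<omega>)\<bar> \<le> H * mass (ev \<omega>)"
  using assms ev_pos by (intro abs_S_le) (auto intro: less_imp_le)

lemma mass_power4: "mass (ev \<omega>) ^ 4 \<le> (\<Sum>j\<in>J. p * w 1 j \<omega> ^ 4)"
proof -
  have "(\<Sum>j\<in>J. p * ev \<omega> j) ^ Suc 3 \<le> (\<Sum>j\<in>J. p) ^ 3 * (\<Sum>j\<in>J. p * ev \<omega> j ^ Suc 3)"
    using p_pos ev_pos by (intro weighted_power_mean[OF finJ]) (auto intro: less_imp_le)
  then show ?thesis unfolding p_sum by (simp add: avg_def ev_eq eval_nat_numeral)
qed

lemma mass_power4_integrable: "integrable P (\<lambda>\<omega>. mass (ev \<omega>) ^ 4)"
proof (rule Bochner_Integration.integrable_bound)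
  show "integrable P (\<lambda>\<omega>. \<Sum>j\<in>J. p * w 1 j \<omega> ^ 4)"
    by (intro Bochner_Integration.integrable_sum Bochner_Integration.integrable_mult_right w_power_integrable)
  show "AE \<omega> in P. norm (mass (ev \<omega>) ^ 4) \<le> norm (\<Sum>j\<in>J. p * w 1 j \<omega> ^ 4)"
  proof (rule AE_I2)
    fix \<omega>
    have "norm (mass (ev \<omega>) ^ 4) = mass (ev \<omega>) ^ 4" by simp
    also have "\<dots> \<le> (\<Sum>j\<in>J. p * w 1 j \<omega> ^ 4)" by (rule mass_power4)
    also have "\<dots> \<le> norm (\<Sum>j\<in>J. p * w 1 j \<omega> ^ 4)" by simp
    finally show "norm (mass (ev \<omega>) ^ 4) \<le> norm (\<Sum>j\<in>J. p * w 1 j \<omega> ^ 4)" .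
  qed
qed simp

lemma mass_power4_expectation: "expectation (\<lambda>\<omega>. mass (ev \<omega>) ^ 4) \<le> exp (6 * V)"
proof -
  have "expectation (\<lambda>\<omega>. mass (ev \<omega>) ^ 4) \<le> expectation (\<lambda>\<omega>. \<Sum>j\<in>J. p * w 1 j \<omega> ^ 4)"
    by (intro integral_mono mass_power4_integrable mass_power4 Bochner_Integration.integrable_sum
        Bochner_Integration.integrable_mult_right w_power_integrable)
  also have "\<dots> = (\<Sum>j\<in>J. p) * exp (6 * V)" unfolding sum_distrib_right
    by (subst Bochner_Integration.integral_sum) (auto intro!: sum.cong w_power_integrable simp: w_power_expectation)
  finally show ?thesis by (simp only: p_sum mult_1)
qed

text \<open>All functionals that occur are bounded by a power of \<open>1 + mass\<close>, and the fourth moment of the mass is bounded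
independently of the number of points.\<close>

lemma integrable_poly_mass:
  assumes [measurable]: "Y \<in> borel_measurable P" and b: "\<And>\<omega>. \<bar>Y \<omega>\<bar> \<le> C * (1 + mass (ev \<omega>)) ^ n" and n: "n \<le> 4"
  shows "integrable P Y"
proof (rule Bochner_Integration.integrable_bound[of P "\<lambda>\<omega>. C * (8 * (1 + mass (ev \<omega>) ^ 4))"])
  show "AE \<omega> in P. norm (Y \<omega>) \<le> norm (C * (8 * (1 + mass (ev \<omega>) ^ 4)))"
  proof (rule AE_I2)
    fix \<omega> let ?m = "mass (ev \<omega>)"
    have m: "0 < ?m" by (rule mass_ev_pos)
    have "0 \<le> C * (1 + ?m) ^ n" using b[of \<omega>] abs_ge_zero order_trans by blast
    moreover have a: "0 < (1 + ?m) ^ n" using m by simp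
    ultimately have C: "0 \<le> C" using mult_neg_pos[of C, OF _ a] by linarith
    have "(1 + ?m) ^ n \<le> (1 + ?m) ^ 4" using m n by (intro power_increasing) auto
    also have "(1 + ?m) ^ 4 \<le> 8 * (1 + ?m ^ 4)"
    proof -
      have "0 \<le> (?m - 1)^2 * (7 * ?m^2 + 10 * ?m + 7)" using m by (intro mult_nonneg_nonneg add_nonneg_nonneg) auto
      then show ?thesis by (simp add: power2_eq_square power4_eq_xxxx algebra_simps)
    qed
    finally have "C * (1 + ?m) ^ n \<le> C * (8 * (1 + ?m ^ 4))" using C by (intro mult_left_mono)
    then show "norm (Y \<omega>) \<le> norm (C * (8 * (1 + ?m ^ 4)))" using b[of \<omega>] C by simp
  qed
qed (use mass_power4_integrable in simp_all)

lemma avg_expectation: "expectation (\<lambda>\<omega>. avg h (ev \<omega>)) = avg h (\<lambda>_. 1)"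
proof -
  have "expectation (\<lambda>\<omega>. avg h (ev \<omega>)) = (\<Sum>j\<in>J. expectation (\<lambda>\<omega>. p * h j * ev \<omega> j))"
    unfolding avg_def by (rule Bochner_Integration.integral_sum) (auto simp: ev_eq w_integrable)
  also have "\<dots> = (\<Sum>j\<in>J. p * h j * 1)" by (intro sum.cong) (auto simp: ev_eq w_expectation)
  finally show ?thesis by (simp add: avg_def)
qed

definition fluct :: "('i \<Rightarrow> real) \<Rightarrow> ('i \<Rightarrow> real) \<Rightarrow> real" where "fluct h u = avg h u - avg h (\<lambda>_. 1)"

lemma fluct_alt: "fluct h u = (\<Sum>j\<in>J. p * h j * (u j - 1))"
  by (simp add: fluct_def avg_def sum_subtractf algebra_simps)

lemma fluct_measurable[measurable]: "fluct h \<in> borel_measurable Jborel"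
  unfolding fluct_def[abs_def] by measurable

lemma abs_X_le:
  assumes H: "\<And>j. j \<in> J \<Longrightarrow> \<bar>h j\<bar> \<le> H"
  shows "\<bar>fluct h (ev \<omega>)\<bar> \<le> H * (1 + mass (ev \<omega>))"
proof -
  have "\<bar>avg h (\<lambda>_. 1)\<bar> \<le> H * mass (\<lambda>_. 1)" by (rule abs_S_le[OF H]) auto
  also have "mass (\<lambda>_. 1) = 1" using p_sum by (simp add: avg_def)
  finally show ?thesis using abs_S_ev_le[of h H \<omega>, OF H] unfolding fluct_def by (simp add: algebra_simps)
qed

lemma fluct_power_integrable:
  assumes H: "\<And>j. j \<in> J \<Longrightarrow> \<bar>h j\<bar> \<le> H" and n: "n \<le> 4"
  shows "integrable P (\<lambda>\<omega>. fluct h (ev \<omega>) ^ n)"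
proof (rule integrable_poly_mass[OF _ _ n])
  show "\<bar>fluct h (ev \<omega>) ^ n\<bar> \<le> H ^ n * (1 + mass (ev \<omega>)) ^ n" for \<omega>
    using abs_X_le[of h H \<omega>, OF H] by (simp add: power_abs power_mono power_mult_distrib[symmetric])
qed simp

lemma exp_cov_bound: "x \<in> J \<Longrightarrow> y \<in> J \<Longrightarrow> \<bar>exp (c x y) - 1\<bar> \<le> exp V * \<bar>c x y\<bar>"
  by (rule abs_exp_minus_one_le) (rule cov_le_V)

lemma fluct_product:
  "expectation (\<lambda>\<omega>. fluct h (ev \<omega>) * fluct k (ev \<omega>)) = (\<Sum>x\<in>J. \<Sum>y\<in>J. p * p * h x * k y * (exp (c x y) - 1))"
proof -
  have pw: "fluct h (ev \<omega>) * fluct k (ev \<omega>) = (\<Sum>x\<in>J. \<Sum>y\<in>J. p * p * h x * k y * (w 1 x \<omega> * w 1 y \<omega> - w 1 x \<omega> - w 1 y \<omega> + 1))" for \<omega>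
    unfolding fluct_alt sum_product by (intro sum.cong) (auto simp: ev_eq algebra_simps)
  have i: "integrable P (\<lambda>\<omega>. w 1 x \<omega> * w 1 y \<omega> - w 1 x \<omega> - w 1 y \<omega> + 1)" if "x \<in> J" "y \<in> J" for x y
    using that by (simp add: w2_integrable w_integrable)
  have e: "expectation (\<lambda>\<omega>. w 1 x \<omega> * w 1 y \<omega> - w 1 x \<omega> - w 1 y \<omega> + 1) = exp (c x y) - 1" if "x \<in> J" "y \<in> J" for x y
    using that by (simp add: w2_integrable w_integrable w2_expectation w_expectation prob_space)
  have "expectation (\<lambda>\<omega>. \<Sum>x\<in>J. \<Sum>y\<in>J. p * p * h x * k y * (w 1 x \<omega> * w 1 y \<omega> - w 1 x \<omega> - w 1 y \<omega> + 1))
    = (\<Sum>x\<in>J. \<Sum>y\<in>J. expectation (\<lambda>\<omega>. p * p * h x * k y * (w 1 x \<omega> * w 1 y \<omega> - w 1 x \<omega> - w 1 y \<omega> + 1)))"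
    by (subst Bochner_Integration.integral_sum, rule Bochner_Integration.integrable_sum, rule Bochner_Integration.integrable_mult_right, rule i, assumption, assumption,
          rule sum.cong, rule refl, rule Bochner_Integration.integral_sum, rule Bochner_Integration.integrable_mult_right, rule i)
  also have "\<dots> = (\<Sum>x\<in>J. \<Sum>y\<in>J. p * p * h x * k y * (exp (c x y) - 1))"
    by (intro sum.cong refl) (simp only: integral_mult_right_zero e)
  finally show ?thesis unfolding pw .
qed

lemma cov_double_sum: 
  shows "(\<Sum>x\<in>J. \<Sum>y\<in>J. p * p * \<bar>c x y\<bar>) \<le> \<eta>"
proof -
  have "(\<Sum>x\<in>J. \<Sum>y\<in>J. p * p * \<bar>c x y\<bar>) = (\<Sum>x\<in>J. p * (\<Sum>y\<in>J. p * \<bar>c x y\<bar>))" by (simp add: sum_distrib_left mult.assoc)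
  also have "\<dots> \<le> (\<Sum>x\<in>J. p * \<eta>)" using eta p_pos by (intro sum_mono mult_left_mono) auto
  finally show ?thesis by (simp only: sum_distrib_right[symmetric] p_sum mult_1)
qed

lemma fluct_second_moment:
  assumes H: "\<And>j. j \<in> J \<Longrightarrow> \<bar>h j\<bar> \<le> H"
  shows "expectation (\<lambda>\<omega>. (fluct h (ev \<omega>))\<^sup>2) \<le> H\<^sup>2 * exp V * \<eta>"
proof -
  have "expectation (\<lambda>\<omega>. (fluct h (ev \<omega>))\<^sup>2) = (\<Sum>x\<in>J. \<Sum>y\<in>J. p * p * h x * h y * (exp (c x y) - 1))"
    by (simp add: power2_eq_square fluct_product)
  also have "\<dots> \<le> (\<Sum>x\<in>J. \<Sum>y\<in>J. H\<^sup>2 * exp V * (p * p * \<bar>c x y\<bar>))"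
  proof (intro sum_mono)
    fix x y assume xy: "x \<in> J" "y \<in> J"
    have "p * p * h x * h y * (exp (c x y) - 1) \<le> \<bar>p * p * h x * h y * (exp (c x y) - 1)\<bar>" by simp
    also have "\<dots> = (p * p) * (\<bar>h x\<bar> * \<bar>h y\<bar>) * \<bar>exp (c x y) - 1\<bar>" using p_pos by (simp add: abs_mult)
    also have "\<dots> \<le> (p * p) * (H * H) * (exp V * \<bar>c x y\<bar>)"
      using xy H[of x] H[of y] p_pos by (intro mult_mono exp_cov_bound) auto
    finally show "p * p * h x * h y * (exp (c x y) - 1) \<le> H\<^sup>2 * exp V * (p * p * \<bar>c x y\<bar>)"
      by (simp add: power2_eq_square mult_ac)
  qed
  also have "\<dots> = H\<^sup>2 * exp V * (\<Sum>x\<in>J. \<Sum>y\<in>J. p * p * \<bar>c x y\<bar>)" by (simp add: sum_distrib_left)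
  also have "\<dots> \<le> H\<^sup>2 * exp V * \<eta>" using cov_double_sum by (intro mult_left_mono) auto
  finally show ?thesis .
qed

text \<open>Up to constants, this is the change of an average under the shift at \<open>x\<close>.\<close>

definition delta :: "'i \<Rightarrow> ('i \<Rightarrow> real) \<Rightarrow> real" where "delta x u = (\<Sum>y\<in>J. p * \<bar>c x y\<bar> * u y)"

lemma delta_measurable[measurable]: "delta x \<in> borel_measurable Jborel"
  unfolding delta_def[abs_def] by measurable

lemma delta_nonneg: "0 \<le> delta x (ev \<omega>)"
  unfolding delta_def using p_pos by (intro sum_nonneg) (auto intro!: mult_nonneg_nonneg less_imp_le[OF ev_pos])

lemma delta_le_mass: "x \<in> J \<Longrightarrow> delta x (ev \<omega>) \<le> V * mass (ev \<omega>)"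
  unfolding delta_def avg_def sum_distrib_left using p_pos ev_pos cov_le_V
  by (intro sum_mono) (auto simp: mult_ac intro!: mult_left_mono mult_right_mono less_imp_le)

lemma delta_power_integrable: "x \<in> J \<Longrightarrow> n \<le> 4 \<Longrightarrow> integrable P (\<lambda>\<omega>. delta x (ev \<omega>) ^ n)"
proof (rule integrable_poly_mass[where C="V ^ n" and n=n])
  fix \<omega> assume x: "x \<in> J"
  have "\<bar>delta x (ev \<omega>) ^ n\<bar> = delta x (ev \<omega>) ^ n" using delta_nonneg by simp
  also have "\<dots> \<le> (V * (1 + mass (ev \<omega>))) ^ n"
    using delta_le_mass[OF x, of \<omega>] delta_nonneg V0 by (intro power_mono) (auto simp: algebra_simps)
  finally show "\<bar>delta x (ev \<omega>) ^ n\<bar> \<le> V ^ n * (1 + mass (ev \<omega>)) ^ n" by (simp only: power_mult_distrib)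
qed auto

lemma delta_moment:
  assumes x: "x \<in> J"
  shows "expectation (\<lambda>\<omega>. delta x (ev \<omega>) ^ Suc n) \<le> \<eta> ^ Suc n * exp ((real (Suc n))\<^sup>2 * V / 2 - real (Suc n) * V / 2)"
proof -
  let ?K = "exp ((real (Suc n))\<^sup>2 * V / 2 - real (Suc n) * V / 2)"
  let ?q = "\<lambda>y. p * \<bar>c x y\<bar>"
  have q0: "0 \<le> ?q y" for y using p_pos by simp
  have i: "integrable P (\<lambda>\<omega>. \<eta> ^ n * (\<Sum>y\<in>J. ?q y * w 1 y \<omega> ^ Suc n))"
    by (intro Bochner_Integration.integrable_sum Bochner_Integration.integrable_mult_right w_power_integrable)
  have le: "delta x (ev \<omega>) ^ Suc n \<le> \<eta> ^ n * (\<Sum>y\<in>J. ?q y * w 1 y \<omega> ^ Suc n)" for \<omega>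
  proof -
    have "(\<Sum>y\<in>J. ?q y * ev \<omega> y) ^ Suc n \<le> (\<Sum>y\<in>J. ?q y) ^ n * (\<Sum>y\<in>J. ?q y * ev \<omega> y ^ Suc n)"
      using q0 ev_pos by (intro weighted_power_mean[OF finJ]) (auto intro: less_imp_le)
    also have "\<dots> \<le> \<eta> ^ n * (\<Sum>y\<in>J. ?q y * ev \<omega> y ^ Suc n)"
      using q0 ev_pos eta[OF x] p_pos by (intro mult_right_mono power_mono sum_nonneg mult_nonneg_nonneg zero_le_power) (auto intro: less_imp_le)
    finally show ?thesis by (simp add: delta_def ev_eq cong: sum.cong)
  qed
  have "expectation (\<lambda>\<omega>. delta x (ev \<omega>) ^ Suc n) \<le> expectation (\<lambda>\<omega>. \<eta> ^ n * (\<Sum>y\<in>J. ?q y * w 1 y \<omega> ^ Suc n))"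
    by (rule integral_mono'[OF i le])
       (intro mult_nonneg_nonneg sum_nonneg zero_le_power q0 less_imp_le[OF eta_pos] less_imp_le[OF w_pos])
  also have "\<dots> = \<eta> ^ n * (\<Sum>y\<in>J. ?q y * ?K)"
    unfolding integral_mult_right_zero
    by (subst Bochner_Integration.integral_sum) (auto intro!: sum.cong w_power_integrable simp: w_power_expectation simp del: power_Suc)
  also have "\<dots> \<le> \<eta> ^ n * (\<eta> * ?K)"
    unfolding sum_distrib_right[symmetric] using eta[OF x] eta_pos by (intro mult_left_mono mult_right_mono) auto
  finally show ?thesis by (simp add: mult_ac)
qed

end

text \<open>Differentiation under the integral sign: the mean value theorem bounds the difference quotients by \<open>W\<close>.\<close>

lemma has_real_derivative_integral:
  fixes f f' :: "real \<Rightarrow> 'a \<Rightarrow> real"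
  assumes t: "a < t" "t < b"
    and i: "\<And>s. a < s \<Longrightarrow> s < b \<Longrightarrow> integrable M (f s)"
    and m': "f' t \<in> borel_measurable M"
    and d: "\<And>s \<omega>. a < s \<Longrightarrow> s < b \<Longrightarrow> ((\<lambda>s. f s \<omega>) has_real_derivative f' s \<omega>) (at s)"
    and bnd: "\<And>s \<omega>. a < s \<Longrightarrow> s < b \<Longrightarrow> \<bar>f' s \<omega>\<bar> \<le> W \<omega>"
    and W: "integrable M W"
  shows "((\<lambda>s. \<integral>\<omega>. f s \<omega> \<partial>M) has_real_derivative (\<integral>\<omega>. f' t \<omega> \<partial>M)) (at t)"
proof -
  let ?S = "{a<..<b}"
  have at: "at t = at t within ?S" by (rule at_within_open[symmetric]) (use t in auto)
  show ?thesis unfolding has_field_derivative_iff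
  proof (subst at, unfold tendsto_at_iff_sequentially, intro allI impI)
    fix X assume X: "\<forall>i. X i \<in> ?S - {t}" "X \<longlonglongrightarrow> t"
    have Xs: "a < X n" "X n < b" "X n \<noteq> t" for n using X(1) by auto
    have eq: "((\<lambda>y. ((\<integral>\<omega>. f y \<omega> \<partial>M) - (\<integral>\<omega>. f t \<omega> \<partial>M)) / (y - t)) \<circ> X) = (\<lambda>n. \<integral>\<omega>. (f (X n) \<omega> - f t \<omega>) / (X n - t) \<partial>M)"
      using i Xs t by (auto simp: fun_eq_iff)
    show "((\<lambda>y. ((\<integral>\<omega>. f y \<omega> \<partial>M) - (\<integral>\<omega>. f t \<omega> \<partial>M)) / (y - t)) \<circ> X) \<longlonglongrightarrow> (\<integral>\<omega>. f' t \<omega> \<partial>M)"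
      unfolding eq
    proof (rule integral_dominated_convergence[OF m' _ W])
      show "(\<lambda>\<omega>. (f (X n) \<omega> - f t \<omega>) / (X n - t)) \<in> borel_measurable M" for n
        using borel_measurable_integrable[OF i[of "X n"]] borel_measurable_integrable[OF i[of t]] Xs t by simp
      show "AE \<omega> in M. (\<lambda>n. (f (X n) \<omega> - f t \<omega>) / (X n - t)) \<longlonglongrightarrow> f' t \<omega>"
      proof (rule AE_I2)
        fix \<omega>
        have "((\<lambda>y. (f y \<omega> - f t \<omega>) / (y - t)) \<longlongrightarrow> f' t \<omega>) (at t)"
          using d[OF t, of \<omega>] by (simp add: has_field_derivative_iff)
        then show "(\<lambda>n. (f (X n) \<omega> - f t \<omega>) / (X n - t)) \<longlonglongrightarrow> f' t \<omega>"
          using X Xs unfolding tendsto_at_iff_sequentially comp_def by auto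
      qed
      show "AE \<omega> in M. norm ((f (X n) \<omega> - f t \<omega>) / (X n - t)) \<le> W \<omega>" for n
      proof (rule AE_I2)
        fix \<omega>
        have "norm (f (X n) \<omega> - f t \<omega>) \<le> W \<omega> * norm (X n - t)"
        proof (rule field_differentiable_bound[of ?S])
          show "((\<lambda>s. f s \<omega>) has_field_derivative f' z \<omega>) (at z within ?S)" if "z \<in> ?S" for z
            using d[of z \<omega>] that by (auto intro: has_field_derivative_at_within)
        qed (use bnd Xs t in auto)
        then show "norm ((f (X n) \<omega> - f t \<omega>) / (X n - t)) \<le> W \<omega>"
          using Xs by (simp add: divide_le_eq)
      qed
    qed
  qed
qed

context lognormal_average
begin

lemma exp_V_ge_1: "1 \<le> exp V" using V0 by simp

lemma fluct_tilt:
  assumes x: "x \<in> J" and H: "\<And>j. j \<in> J \<Longrightarrow> \<bar>h j\<bar> \<le> H"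
  shows "\<bar>fluct h (tilt 1 x (ev \<omega>)) - fluct h (ev \<omega>)\<bar> \<le> H * exp V * delta x (ev \<omega>)"
proof -
  have H0: "0 \<le> H" using H J_ne by force
  have "fluct h (tilt 1 x (ev \<omega>)) - fluct h (ev \<omega>) = (\<Sum>j\<in>J. p * h j * ev \<omega> j * (exp (c x j) - 1))"
    by (simp add: fluct_def avg_def tilt_def sum_subtractf[symmetric] algebra_simps)
  then have "\<bar>fluct h (tilt 1 x (ev \<omega>)) - fluct h (ev \<omega>)\<bar> \<le> (\<Sum>j\<in>J. \<bar>p * h j * ev \<omega> j * (exp (c x j) - 1)\<bar>)"
    by (simp add: sum_abs)
  also have "\<dots> \<le> (\<Sum>j\<in>J. H * exp V * (p * \<bar>c x j\<bar> * ev \<omega> j))"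
  proof (rule sum_mono)
    fix j assume j: "j \<in> J"
    have "\<bar>p * h j * ev \<omega> j * (exp (c x j) - 1)\<bar> = (p * ev \<omega> j) * (\<bar>h j\<bar> * \<bar>exp (c x j) - 1\<bar>)"
      using p_pos ev_pos[OF j, of \<omega>] by (simp add: abs_mult)
    also have "\<dots> \<le> (p * ev \<omega> j) * (H * (exp V * \<bar>c x j\<bar>))"
      using p_pos ev_pos[OF j, of \<omega>] H0 by (intro mult_left_mono mult_mono H j exp_cov_bound x) auto
    finally show "\<bar>p * h j * ev \<omega> j * (exp (c x j) - 1)\<bar> \<le> H * exp V * (p * \<bar>c x j\<bar> * ev \<omega> j)" by (simp add: mult_ac)
  qed
  finally show ?thesis by (simp add: delta_def sum_distrib_left)
qed

text \<open>Young's inequality is weighted so that the quartic term has the coefficient \<open>1 / 2\<close> and can be absorbed in the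
estimate of the fourth moment.\<close>

lemma cubic_increment_bound:
  fixes y \<Delta> D h H :: real
  assumes D: "\<bar>\<Delta>\<bar> \<le> D" and h: "\<bar>h\<bar> \<le> H" and H: "0 < H"
  shows "h * ((y + \<Delta>) ^ 3 - y ^ 3) \<le> y ^ 4 / 2 + 81 / 8 * H\<^sup>2 * D\<^sup>2 + 5 / 2 * H * D ^ 3"
proof -
  have D0: "0 \<le> D" using D by linarith
  have e: "(y + \<Delta>) ^ 3 - y ^ 3 = 3 * y\<^sup>2 * \<Delta> + 3 * y * \<Delta>\<^sup>2 + \<Delta> ^ 3"
    by (simp add: power2_eq_square power3_eq_cube algebra_simps)
  have c3: "\<bar>\<Delta>\<bar> ^ 3 \<le> D ^ 3" using D by (intro power_mono) auto
  have y2D: "y\<^sup>2 * \<bar>\<Delta>\<bar> \<le> y\<^sup>2 * D" using D by (intro mult_left_mono) auto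
  have "\<bar>y\<bar> * \<Delta>\<^sup>2 = \<bar>\<Delta>\<bar> * (\<bar>y\<bar> * \<bar>\<Delta>\<bar>)" by (simp add: power2_eq_square)
  also have "\<dots> \<le> \<bar>\<Delta>\<bar> * ((y\<^sup>2 + \<Delta>\<^sup>2) / 2)"
    using sum_squares_bound[of "\<bar>y\<bar>" "\<bar>\<Delta>\<bar>"] by (intro mult_left_mono) auto
  also have "\<dots> = (y\<^sup>2 * \<bar>\<Delta>\<bar>) / 2 + \<bar>\<Delta>\<bar> ^ 3 / 2" by (simp add: power2_eq_square power3_eq_cube algebra_simps)
  finally have yD2: "\<bar>y\<bar> * \<Delta>\<^sup>2 \<le> (y\<^sup>2 * \<bar>\<Delta>\<bar>) / 2 + \<bar>\<Delta>\<bar> ^ 3 / 2" .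
  have "\<bar>(y + \<Delta>) ^ 3 - y ^ 3\<bar> \<le> 3 * (y\<^sup>2 * \<bar>\<Delta>\<bar>) + 3 * (\<bar>y\<bar> * \<Delta>\<^sup>2) + \<bar>\<Delta>\<bar> ^ 3"
    unfolding e by (intro order_trans[OF abs_triangle_ineq] add_mono) (auto simp: abs_mult power_abs)
  with yD2 y2D c3 have "\<bar>(y + \<Delta>) ^ 3 - y ^ 3\<bar> \<le> 9 / 2 * (y\<^sup>2 * D) + 5 / 2 * D ^ 3" by linarith
  then have "\<bar>h\<bar> * \<bar>(y + \<Delta>) ^ 3 - y ^ 3\<bar> \<le> H * (9 / 2 * (y\<^sup>2 * D) + 5 / 2 * D ^ 3)"
    using h H by (intro mult_mono) auto
  then have "h * ((y + \<Delta>) ^ 3 - y ^ 3) \<le> H * (9 / 2 * (y\<^sup>2 * D) + 5 / 2 * D ^ 3)"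
    unfolding abs_mult[symmetric] by (rule order_trans[OF abs_ge_self])
  also have "\<dots> = 9 / 2 * H * y\<^sup>2 * D + 5 / 2 * H * D ^ 3" by (simp add: algebra_simps)
  also have "9 / 2 * H * y\<^sup>2 * D \<le> y ^ 4 / 2 + 81 / 8 * H\<^sup>2 * D\<^sup>2"
    using zero_le_power2[of "y\<^sup>2 - 9 / 2 * H * D"] by (simp add: power2_eq_square power4_eq_xxxx algebra_simps)
  finally show ?thesis by simp
qed

text \<open>One factor of the fourth power is expanded into densities \<open>w 1 x\<close>. By the Cameron-Martin formula it turns
the remaining cube into its increment under a shift, which contains at least one factor \<open>delta\<close>. Young's inequality splits off half of the
fourth moment and leaves terms with two or three factors \<open>delta\<close>, so that the fourth moment scales like the square of the second.\<close>

lemma fluct_fourth_moment: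
  assumes H: "\<And>j. j \<in> J \<Longrightarrow> \<bar>h j\<bar> \<le> H" and H0: "0 < H"
  shows "expectation (\<lambda>\<omega>. fluct h (ev \<omega>) ^ 4) \<le> 21 * H ^ 4 * exp V ^ 6 * (1 + \<eta>) * \<eta>\<^sup>2"
proof -
  define D where "D x \<omega> = H * exp V * delta x (ev \<omega>)" for x \<omega>
  have Xi: "n \<le> 4 \<Longrightarrow> integrable P (\<lambda>\<omega>. fluct h (ev \<omega>) ^ n)" for n by (rule fluct_power_integrable[OF H])
  have Di: "x \<in> J \<Longrightarrow> n \<le> 4 \<Longrightarrow> integrable P (\<lambda>\<omega>. D x \<omega> ^ n)" for x n
    unfolding D_def power_mult_distrib[of _ "delta _ _"] by (intro Bochner_Integration.integrable_mult_right delta_power_integrable)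
  have Xb: "\<bar>fluct h (ev \<omega>)\<bar> \<le> H * (1 + mass (ev \<omega>))" for \<omega> by (rule abs_X_le[OF H])
  have ti: "integrable P (\<lambda>\<omega>. fluct h (tilt 1 x (ev \<omega>)) ^ 3)" if x: "x \<in> J" for x
  proof (rule integrable_poly_mass[where n=3 and C="(H + H * exp V * V) ^ 3"])
    fix \<omega> let ?m = "mass (ev \<omega>)"
    have "\<bar>fluct h (tilt 1 x (ev \<omega>))\<bar> \<le> \<bar>fluct h (ev \<omega>)\<bar> + H * exp V * delta x (ev \<omega>)"
      using fluct_tilt[where h=h and H=H and x=x and \<omega>=\<omega>, OF x H] by linarith
    also have "H * exp V * delta x (ev \<omega>) \<le> H * exp V * (V * ?m)"
      using H0 by (intro mult_left_mono delta_le_mass x) auto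
    also have "\<dots> \<le> H * exp V * V * (1 + ?m)" using H0 V0 by (simp add: algebra_simps)
    finally have "\<bar>fluct h (tilt 1 x (ev \<omega>))\<bar> \<le> (H + H * exp V * V) * (1 + ?m)"
      using Xb[of \<omega>] by (simp add: algebra_simps)
    then show "\<bar>fluct h (tilt 1 x (ev \<omega>)) ^ 3\<bar> \<le> (H + H * exp V * V) ^ 3 * (1 + ?m) ^ 3"
      by (simp only: power_abs power_mult_distrib[symmetric]) (rule power_mono, auto)
  qed auto
  have X3m: "(\<lambda>u. fluct h u ^ 3) \<in> borel_measurable Jborel" by measurable
  have wi: "integrable P (\<lambda>\<omega>. w 1 x \<omega> * fluct h (ev \<omega>) ^ 3)" if "x \<in> J" for x
    using cameron_martin_exp(2)[OF that X3m, of 1] ti[OF that] by simp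
  have we: "expectation (\<lambda>\<omega>. w 1 x \<omega> * fluct h (ev \<omega>) ^ 3) = expectation (\<lambda>\<omega>. fluct h (tilt 1 x (ev \<omega>)) ^ 3)" if "x \<in> J" for x
    using cameron_martin_exp(1)[OF that X3m, of 1] by simp
  have "expectation (\<lambda>\<omega>. fluct h (ev \<omega>) ^ 4) = expectation (\<lambda>\<omega>. \<Sum>x\<in>J. p * h x * (w 1 x \<omega> * fluct h (ev \<omega>) ^ 3 - fluct h (ev \<omega>) ^ 3))"
  proof (intro Bochner_Integration.integral_cong refl)
    fix \<omega>
    have "fluct h (ev \<omega>) ^ 4 = (\<Sum>x\<in>J. p * h x * (ev \<omega> x - 1)) * fluct h (ev \<omega>) ^ 3"
      unfolding fluct_alt[symmetric] by (simp add: eval_nat_numeral)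
    then show "fluct h (ev \<omega>) ^ 4 = (\<Sum>x\<in>J. p * h x * (w 1 x \<omega> * fluct h (ev \<omega>) ^ 3 - fluct h (ev \<omega>) ^ 3))"
      unfolding sum_distrib_right by (simp only:, intro sum.cong refl) (simp add: ev_eq algebra_simps)
  qed
  also have "\<dots> = (\<Sum>x\<in>J. p * (h x * (expectation (\<lambda>\<omega>. fluct h (tilt 1 x (ev \<omega>)) ^ 3) - expectation (\<lambda>\<omega>. fluct h (ev \<omega>) ^ 3))))"
  proof -
    have d: "expectation (\<lambda>\<omega>. w 1 x \<omega> * fluct h (ev \<omega>) ^ 3 - fluct h (ev \<omega>) ^ 3)
        = expectation (\<lambda>\<omega>. fluct h (tilt 1 x (ev \<omega>)) ^ 3) - expectation (\<lambda>\<omega>. fluct h (ev \<omega>) ^ 3)" if "x \<in> J" for x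
      using that Xi by (simp add: wi we)
    show ?thesis
      by (subst Bochner_Integration.integral_sum) (use Xi in \<open>auto intro!: sum.cong wi simp: d mult.assoc\<close>)
  qed
  also have "\<dots> = (\<Sum>x\<in>J. p * expectation (\<lambda>\<omega>. h x * (fluct h (tilt 1 x (ev \<omega>)) ^ 3 - fluct h (ev \<omega>) ^ 3)))"
    using ti Xi by (intro sum.cong refl) simp
  also have "\<dots> \<le> (\<Sum>x\<in>J. p * (expectation (\<lambda>\<omega>. fluct h (ev \<omega>) ^ 4) / 2 + 81 / 8 * H\<^sup>2 * (H\<^sup>2 * exp V ^ 3 * \<eta>\<^sup>2) + 5 / 2 * H * (H ^ 3 * exp V ^ 6 * \<eta> ^ 3)))"
  proof (intro sum_mono mult_left_mono)
    fix x assume x: "x \<in> J"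
    have "expectation (\<lambda>\<omega>. h x * (fluct h (tilt 1 x (ev \<omega>)) ^ 3 - fluct h (ev \<omega>) ^ 3))
      \<le> expectation (\<lambda>\<omega>. fluct h (ev \<omega>) ^ 4 / 2 + 81 / 8 * H\<^sup>2 * D x \<omega> ^ 2 + 5 / 2 * H * D x \<omega> ^ 3)"
    proof (rule integral_mono)
      fix \<omega>
      show "h x * (fluct h (tilt 1 x (ev \<omega>)) ^ 3 - fluct h (ev \<omega>) ^ 3) \<le> fluct h (ev \<omega>) ^ 4 / 2 + 81 / 8 * H\<^sup>2 * D x \<omega> ^ 2 + 5 / 2 * H * D x \<omega> ^ 3"
        using cubic_increment_bound[OF fluct_tilt[where h=h and H=H and x=x and \<omega>=\<omega>, OF x H] H[OF x] H0, of "fluct h (ev \<omega>)"] by (simp add: D_def)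
    qed (use x ti Xi Di in simp_all)
    also have "\<dots> = expectation (\<lambda>\<omega>. fluct h (ev \<omega>) ^ 4) / 2 + 81 / 8 * H\<^sup>2 * expectation (\<lambda>\<omega>. D x \<omega> ^ 2) + 5 / 2 * H * expectation (\<lambda>\<omega>. D x \<omega> ^ 3)"
      using x Xi[of 4] Di[of x 2] Di[of x 3] by simp
    also have "expectation (\<lambda>\<omega>. D x \<omega> ^ 2) \<le> H\<^sup>2 * exp V ^ 3 * \<eta>\<^sup>2"
    proof -
      have "expectation (\<lambda>\<omega>. D x \<omega> ^ 2) = (H * exp V) ^ 2 * expectation (\<lambda>\<omega>. delta x (ev \<omega>) ^ 2)"
        unfolding D_def power_mult_distrib[of _ "delta _ _"] by simp
      also have "\<dots> \<le> (H * exp V) ^ 2 * (\<eta> ^ 2 * exp V)"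
        using delta_moment[OF x, of 1] by (intro mult_left_mono) (auto simp: numeral_2_eq_2)
      finally show ?thesis by (simp add: power_mult_distrib eval_nat_numeral mult_ac)
    qed
    also have "expectation (\<lambda>\<omega>. D x \<omega> ^ 3) \<le> H ^ 3 * exp V ^ 6 * \<eta> ^ 3"
    proof -
      have "expectation (\<lambda>\<omega>. D x \<omega> ^ 3) = (H * exp V) ^ 3 * expectation (\<lambda>\<omega>. delta x (ev \<omega>) ^ 3)"
        unfolding D_def power_mult_distrib[of _ "delta _ _"] by simp
      also have "\<dots> \<le> (H * exp V) ^ 3 * (\<eta> ^ 3 * exp V ^ 3)"
      proof (intro mult_left_mono)
        have "exp ((real (Suc 2))\<^sup>2 * V / 2 - real (Suc 2) * V / 2) = exp V ^ 3"
          by (simp add: exp_of_nat_mult[symmetric] power2_eq_square)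
        then show "expectation (\<lambda>\<omega>. delta x (ev \<omega>) ^ 3) \<le> \<eta> ^ 3 * exp V ^ 3"
          using delta_moment[OF x, of 2] by (simp add: numeral_3_eq_3 numeral_2_eq_2)
      qed (use H0 in simp)
      finally show ?thesis by (simp add: power_mult_distrib eval_nat_numeral mult_ac)
    qed
    finally show "expectation (\<lambda>\<omega>. h x * (fluct h (tilt 1 x (ev \<omega>)) ^ 3 - fluct h (ev \<omega>) ^ 3))
      \<le> expectation (\<lambda>\<omega>. fluct h (ev \<omega>) ^ 4) / 2 + 81 / 8 * H\<^sup>2 * (H\<^sup>2 * exp V ^ 3 * \<eta>\<^sup>2) + 5 / 2 * H * (H ^ 3 * exp V ^ 6 * \<eta> ^ 3)"
      using H0 by (simp add: mult_left_mono)
  qed (use p_pos in simp)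
  also have "\<dots> = expectation (\<lambda>\<omega>. fluct h (ev \<omega>) ^ 4) / 2 + 81 / 8 * H\<^sup>2 * (H\<^sup>2 * exp V ^ 3 * \<eta>\<^sup>2) + 5 / 2 * H * (H ^ 3 * exp V ^ 6 * \<eta> ^ 3)"
    by (simp only: sum_distrib_right[symmetric] p_sum mult_1)
  finally have "expectation (\<lambda>\<omega>. fluct h (ev \<omega>) ^ 4) \<le> 81 / 4 * H ^ 4 * exp V ^ 3 * \<eta>\<^sup>2 + 5 * H ^ 4 * exp V ^ 6 * \<eta> ^ 3"
    by (simp add: eval_nat_numeral mult_ac)
  also have "\<dots> \<le> 21 * H ^ 4 * exp V ^ 6 * \<eta>\<^sup>2 + 21 * H ^ 4 * exp V ^ 6 * \<eta> ^ 3"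
    using exp_V_ge_1 eta_pos by (intro add_mono mult_right_mono mult_mono power_increasing) auto
  also have "\<dots> = 21 * H ^ 4 * exp V ^ 6 * (1 + \<eta>) * \<eta>\<^sup>2" by (simp add: eval_nat_numeral algebra_simps)
  finally show ?thesis .
qed

end

section \<open>The quotient functional and its Stein kernel\<close>

text \<open>Constant in the \<open>L\<^sup>1\<close> bound on the fluctuations of the Stein kernel; the first summand stems from the random
quotients, the second one from the linear kernel.\<close>

definition kernel_const :: "real \<Rightarrow> real \<Rightarrow> real" where
  "kernel_const \<kappa> V = \<kappa> ^ 3 * (exp V ^ 6 + 32 * \<kappa>\<^sup>2 * exp V) + (4 * \<kappa> ^ 8 * exp V ^ 6 + 1) / 2"

text \<open>Centering \<open>f\<close> and \<open>g\<close> loses nothing, as \<open>quotient_centering\<close> shows, and it turns \<open>avg f\<close> and \<open>avg g\<close> into pure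
fluctuations. The square root \<open>q\<close> of \<open>\<eta>\<close> is a parameter because the estimates contain odd powers of it.\<close>

locale lognormal_quotient = lognormal_average P J G c V p \<eta>
  for P :: "'w measure" and J :: "'i set" and G c V p \<eta> +
  fixes f g :: "'i \<Rightarrow> real" and \<kappa> q :: real
  assumes kappa_pos: "0 < \<kappa>"
    and f_bound: "\<And>j. j \<in> J \<Longrightarrow> \<bar>f j\<bar> \<le> \<kappa>" and g_bound: "\<And>j. j \<in> J \<Longrightarrow> \<bar>g j\<bar> \<le> \<kappa>"
    and f_centered: "(\<Sum>j\<in>J. p * f j) = 0" and g_centered: "(\<Sum>j\<in>J. p * g j) = 0"
    and q_pos: "0 < q" and eta_q: "\<eta> = q\<^sup>2"
begin

abbreviation fg :: "'i \<Rightarrow> real" where "fg j \<equiv> f j * g j"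

lemma fg_bound: "j \<in> J \<Longrightarrow> \<bar>fg j\<bar> \<le> \<kappa>\<^sup>2"
  unfolding abs_mult power2_eq_square using f_bound g_bound kappa_pos by (intro mult_mono) auto

text \<open>Discrete version of the random variable of interest, divided by the mean of \<open>exp (- G)\<close>. Its derivative in the
direction of the shift at \<open>x\<close> is \<open>quot_deriv x\<close>, in which the derivative of the quotient factorises.\<close>

definition quot :: "('i \<Rightarrow> real) \<Rightarrow> real" where "quot u = avg fg u - avg f u * avg g u / mass u"

definition quot_deriv :: "'i \<Rightarrow> ('i \<Rightarrow> real) \<Rightarrow> real" where
  "quot_deriv x u = (\<Sum>y\<in>J. p * c x y * u y * ((f y - avg f u / mass u) * (g y - avg g u / mass u)))"

lemma quot_measurable[measurable]: "quot \<in> borel_measurable Jborel"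
  unfolding quot_def[abs_def] by measurable

lemma quot_deriv_measurable[measurable]: "quot_deriv x \<in> borel_measurable Jborel"
  unfolding quot_deriv_def[abs_def] by measurable

lemma ratio_bound:
  assumes "\<And>j. j \<in> J \<Longrightarrow> 0 < u j"
  shows "\<bar>avg f u / mass u\<bar> \<le> \<kappa>" "\<bar>avg g u / mass u\<bar> \<le> \<kappa>"
  using abs_S_le[of f \<kappa> u] abs_S_le[of g \<kappa> u] f_bound g_bound mass_pos[of u] assms
  by (auto simp: divide_le_eq less_imp_le)

lemma quot_bound: "\<bar>quot (ev \<omega>)\<bar> \<le> 2 * \<kappa>\<^sup>2 * mass (ev \<omega>)"
proof -
  have m: "0 < mass (ev \<omega>)" by (rule mass_ev_pos)
  have "\<bar>avg f (ev \<omega>) * avg g (ev \<omega>) / mass (ev \<omega>)\<bar> = \<bar>avg f (ev \<omega>) / mass (ev \<omega>)\<bar> * \<bar>avg g (ev \<omega>)\<bar>"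
    by (simp add: abs_mult)
  also have "\<dots> \<le> \<kappa> * (\<kappa> * mass (ev \<omega>))"
    using kappa_pos by (intro mult_mono ratio_bound abs_S_ev_le g_bound ev_pos) auto
  finally have "\<bar>avg f (ev \<omega>) * avg g (ev \<omega>) / mass (ev \<omega>)\<bar> \<le> \<kappa>\<^sup>2 * mass (ev \<omega>)" by (simp add: power2_eq_square)
  moreover have "\<bar>avg fg (ev \<omega>)\<bar> \<le> \<kappa>\<^sup>2 * mass (ev \<omega>)" by (rule abs_S_ev_le[OF fg_bound])
  ultimately show ?thesis unfolding quot_def by (intro order_trans[OF abs_triangle_ineq4]) linarith
qed

lemma avg_tilt_deriv:
  "((\<lambda>s. avg h (tilt s x u)) has_real_derivative avg (\<lambda>j. c x j * h j) (tilt t x u)) (at t)"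
proof -
  have e: "avg h (tilt s x u) = (\<Sum>j\<in>J. p * h j * (u j * exp (s * c x j)))" for h s
    unfolding avg_def tilt_def by (intro sum.cong) auto
  show ?thesis unfolding e by (auto intro!: derivative_eq_intros sum.cong simp: mult_ac)
qed

lemma quot_tilt_deriv:
  assumes u: "\<And>j. j \<in> J \<Longrightarrow> 0 < u j"
  shows "((\<lambda>s. quot (tilt s x u)) has_real_derivative quot_deriv x (tilt t x u)) (at t)"
proof -
  define v where "v = tilt t x u"
  have vp: "0 < mass v" unfolding v_def by (intro mass_pos tilt_pos u)
  have "((\<lambda>s. quot (tilt s x u)) has_real_derivative
     avg (\<lambda>j. c x j * fg j) v - ((avg (\<lambda>j. c x j * f j) v * avg g v + avg f v * avg (\<lambda>j. c x j * g j) v) * mass v - avg f v * avg g v * avg (\<lambda>j. c x j * 1) v) / (mass v * mass v)) (at t)"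
    unfolding quot_def v_def using vp unfolding v_def
    by (auto intro!: derivative_eq_intros avg_tilt_deriv)
  also have "avg (\<lambda>j. c x j * fg j) v - ((avg (\<lambda>j. c x j * f j) v * avg g v + avg f v * avg (\<lambda>j. c x j * g j) v) * mass v - avg f v * avg g v * avg (\<lambda>j. c x j * 1) v) / (mass v * mass v)
    = avg (\<lambda>j. c x j * fg j) v - (avg g v / mass v) * avg (\<lambda>j. c x j * f j) v - (avg f v / mass v) * avg (\<lambda>j. c x j * g j) v + (avg f v / mass v) * (avg g v / mass v) * avg (\<lambda>j. c x j * 1) v"
    using vp by (simp add: field_simps)
  also have "\<dots> = quot_deriv x v"
    unfolding quot_deriv_def avg_def[of "\<lambda>j. c x j * h j" v for h] sum_distrib_left sum_subtractf[symmetric] sum.distrib[symmetric]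
    by (intro sum.cong refl) (simp add: algebra_simps)
  finally show ?thesis by (simp add: v_def)
qed

lemma quot_deriv_bound:
  assumes u: "\<And>j. j \<in> J \<Longrightarrow> 0 < u j"
  shows "\<bar>quot_deriv x u\<bar> \<le> 4 * \<kappa>\<^sup>2 * delta x u"
proof -
  have "\<bar>quot_deriv x u\<bar> \<le> (\<Sum>y\<in>J. \<bar>p * c x y * u y * ((f y - avg f u / mass u) * (g y - avg g u / mass u))\<bar>)"
    unfolding quot_deriv_def by (rule sum_abs)
  also have "\<dots> \<le> (\<Sum>y\<in>J. (p * \<bar>c x y\<bar> * u y) * ((2 * \<kappa>) * (2 * \<kappa>)))"
  proof (rule sum_mono)
    fix y assume y: "y \<in> J"
    have "\<bar>p * c x y * u y * ((f y - avg f u / mass u) * (g y - avg g u / mass u))\<bar>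
      = (p * \<bar>c x y\<bar> * u y) * (\<bar>f y - avg f u / mass u\<bar> * \<bar>g y - avg g u / mass u\<bar>)"
      using p_pos u[OF y] by (simp add: abs_mult)
    also have "\<dots> \<le> (p * \<bar>c x y\<bar> * u y) * ((2 * \<kappa>) * (2 * \<kappa>))"
    proof (intro mult_left_mono mult_mono mult_nonneg_nonneg)
      have "\<bar>avg f u / mass u\<bar> \<le> \<kappa>" "\<bar>avg g u / mass u\<bar> \<le> \<kappa>" by (rule ratio_bound, erule u)+
      then show "\<bar>f y - avg f u / mass u\<bar> \<le> 2 * \<kappa>" "\<bar>g y - avg g u / mass u\<bar> \<le> 2 * \<kappa>"
        using f_bound[OF y] g_bound[OF y] by linarith+
    qed (use p_pos u[OF y] kappa_pos in auto)
    finally show "\<bar>p * c x y * u y * ((f y - avg f u / mass u) * (g y - avg g u / mass u))\<bar> \<le> (p * \<bar>c x y\<bar> * u y) * ((2 * \<kappa>) * (2 * \<kappa>))" .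
  qed
  finally show ?thesis by (simp add: delta_def sum_distrib_left power2_eq_square mult_ac)
qed

lemma delta_tilt:
  assumes x: "x \<in> J" and t: "\<bar>t\<bar> \<le> 2"
  shows "delta x (tilt t x (ev \<omega>)) \<le> exp (2 * V) * delta x (ev \<omega>)"
  unfolding delta_def sum_distrib_left
proof (rule sum_mono)
  fix y assume y: "y \<in> J"
  have "t * c x y \<le> \<bar>t\<bar> * \<bar>c x y\<bar>" by (metis abs_ge_self abs_mult)
  also have "\<dots> \<le> 2 * V" using t cov_le_V[OF x y] by (intro mult_mono) auto
  finally have "exp (t * c x y) \<le> exp (2 * V)" by simp
  then have "(p * \<bar>c x y\<bar> * ev \<omega> y) * exp (t * c x y) \<le> (p * \<bar>c x y\<bar> * ev \<omega> y) * exp (2 * V)"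
    using p_pos ev_pos[OF y, of \<omega>] by (intro mult_left_mono) auto
  then show "p * \<bar>c x y\<bar> * tilt t x (ev \<omega>) y \<le> exp (2 * V) * (p * \<bar>c x y\<bar> * ev \<omega> y)"
    using y by (simp add: tilt_def mult_ac)
qed

lemma quot_deriv_tilt_bound:
  assumes x: "x \<in> J" and t: "\<bar>t\<bar> \<le> 2"
  shows "\<bar>quot_deriv x (tilt t x (ev \<omega>))\<bar> \<le> 4 * \<kappa>\<^sup>2 * (exp (2 * V) * (V * mass (ev \<omega>)))"
proof -
  have "\<bar>quot_deriv x (tilt t x (ev \<omega>))\<bar> \<le> 4 * \<kappa>\<^sup>2 * delta x (tilt t x (ev \<omega>))"
    by (intro quot_deriv_bound tilt_pos ev_pos)
  also have "\<dots> \<le> 4 * \<kappa>\<^sup>2 * (exp (2 * V) * delta x (ev \<omega>))"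
    by (intro mult_left_mono delta_tilt x t) auto
  also have "\<dots> \<le> 4 * \<kappa>\<^sup>2 * (exp (2 * V) * (V * mass (ev \<omega>)))"
    by (intro mult_left_mono delta_le_mass x) auto
  finally show ?thesis .
qed

text \<open>Kernel for which the derivative in \<open>t\<close> of the sum over \<open>x\<close>, with the weights \<open>p * fg x\<close>, of the expectations of
\<open>\<phi> (quot (tilt t x (ev \<omega>)))\<close> is the expectation of \<open>\<phi>' (quot (ev \<omega>))\<close> times the kernel. In \<open>linear_kernel\<close> the two random quotients in
\<open>quot_deriv\<close> are dropped; it is the kernel of the linear part of \<open>quot\<close>, and \<open>\<tau>\<close> is its expectation. Double sums are written as sums
over pairs of points.\<close>

definition stein_kernel :: "real \<Rightarrow> 'w \<Rightarrow> real" where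
  "stein_kernel t \<omega> = (\<Sum>x\<in>J. p * fg x * (w t x \<omega> * quot_deriv x (ev \<omega>)))"

definition pair_weight :: "'i \<times> 'i \<Rightarrow> real" where "pair_weight z = p * p * \<bar>c (fst z) (snd z)\<bar>"
definition pair_coeff :: "'i \<times> 'i \<Rightarrow> real" where "pair_coeff z = p * p * fg (fst z) * fg (snd z) * c (fst z) (snd z)"
definition pair_tilt :: "real \<Rightarrow> 'i \<times> 'i \<Rightarrow> 'w \<Rightarrow> real" where "pair_tilt t z \<omega> = w t (fst z) \<omega> * w 1 (snd z) \<omega>"
definition pair_mean :: "real \<Rightarrow> 'i \<times> 'i \<Rightarrow> real" where "pair_mean t z = exp (t * c (fst z) (snd z))"
definition linear_kernel :: "real \<Rightarrow> 'w \<Rightarrow> real" where "linear_kernel t \<omega> = (\<Sum>z\<in>J\<times>J. pair_coeff z * pair_tilt t z \<omega>)"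
definition \<tau> :: "real \<Rightarrow> real" where "\<tau> t = (\<Sum>z\<in>J\<times>J. pair_coeff z * pair_mean t z)"

lemma pair_weight_nonneg: "0 \<le> pair_weight z" using p_pos by (simp add: pair_weight_def)
lemma pair_tilt_pos: "0 < pair_tilt t z \<omega>" by (simp add: pair_tilt_def)
lemma pair_coeff_bound: "z \<in> J \<times> J \<Longrightarrow> \<bar>pair_coeff z\<bar> \<le> \<kappa> ^ 4 * pair_weight z"
proof -
  assume z: "z \<in> J \<times> J"
  have "\<bar>pair_coeff z\<bar> = (\<bar>fg (fst z)\<bar> * \<bar>fg (snd z)\<bar>) * pair_weight z" using p_pos by (simp add: pair_coeff_def pair_weight_def abs_mult)
  also have "\<dots> \<le> (\<kappa>\<^sup>2 * \<kappa>\<^sup>2) * pair_weight z" using z pair_weight_nonneg by (intro mult_right_mono mult_mono fg_bound) auto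
  finally show ?thesis by (simp add: power2_eq_square power4_eq_xxxx)
qed
lemma pair_tilt_measurable[measurable]: "z \<in> J \<times> J \<Longrightarrow> pair_tilt t z \<in> borel_measurable P"
  unfolding pair_tilt_def[abs_def] by (intro borel_measurable_times w_measurable) auto
lemma pair_tilt_integrable: "z \<in> J \<times> J \<Longrightarrow> integrable P (pair_tilt t z)"
  unfolding pair_tilt_def[abs_def] by (intro w2_integrable) auto
lemma pair_tilt_expectation: "z \<in> J \<times> J \<Longrightarrow> expectation (pair_tilt t z) = pair_mean t z"
  unfolding pair_tilt_def[abs_def] pair_mean_def by (subst w2_expectation) auto
lemma WW_integrable: "z \<in> J \<times> J \<Longrightarrow> z' \<in> J \<times> J \<Longrightarrow> integrable P (\<lambda>\<omega>. pair_tilt t z \<omega> * pair_tilt t z' \<omega>)"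
  unfolding pair_tilt_def by (intro w4_integrable) auto

text \<open>Summing out the point of the pair that does not enter \<open>h\<close> costs a factor \<open>\<eta>\<close>; by symmetry of the covariance it
does not matter which of the two points it is.\<close>

lemma sum_pair_weight_marginal:
  assumes u: "u = fst \<or> u = snd" and h: "\<And>x. x \<in> J \<Longrightarrow> 0 \<le> h x"
  shows "(\<Sum>z\<in>J\<times>J. pair_weight z * h (u z)) \<le> \<eta> * (\<Sum>x\<in>J. p * h x)"
proof -
  have "(\<Sum>z\<in>J\<times>J. pair_weight z * h (u z)) = (\<Sum>x\<in>J. \<Sum>y\<in>J. pair_weight (x, y) * h x)"
    using u
  proof
    assume "u = fst" then show ?thesis by (simp add: sum.cartesian_product split_def)
  next
    assume "u = snd"
    then have "(\<Sum>z\<in>J\<times>J. pair_weight z * h (u z)) = (\<Sum>x\<in>J. \<Sum>y\<in>J. pair_weight (x, y) * h y)" by (simp add: sum.cartesian_product split_def)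
    also have "\<dots> = (\<Sum>y\<in>J. \<Sum>x\<in>J. pair_weight (x, y) * h y)" by (rule sum.swap)
    also have "\<dots> = (\<Sum>x\<in>J. \<Sum>y\<in>J. pair_weight (x, y) * h x)"
      by (intro sum.cong refl) (simp add: pair_weight_def cov_sym)
    finally show ?thesis .
  qed
  also have "\<dots> = (\<Sum>x\<in>J. (p * h x) * (\<Sum>y\<in>J. p * \<bar>c x y\<bar>))" by (simp add: pair_weight_def sum_distrib_left mult_ac)
  also have "\<dots> \<le> (\<Sum>x\<in>J. (p * h x) * \<eta>)"
    using h p_pos by (intro sum_mono mult_left_mono eta) auto
  finally show ?thesis by (simp add: sum_distrib_left mult_ac)
qed

lemma sum_pair_weight: "(\<Sum>z\<in>J\<times>J. pair_weight z) \<le> \<eta>"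
  using sum_pair_weight_marginal[of fst "\<lambda>_. 1"] p_sum by simp

text \<open>Two pairs joined by one covariance form a chain of four points, and summation along the three links of the chain
gains \<open>\<eta>\<close> three times.\<close>

lemma sum_pair_weight_chain:
  assumes u: "u = fst \<or> u = snd" and v: "v = fst \<or> v = snd"
  shows "(\<Sum>z\<in>J\<times>J. \<Sum>z'\<in>J\<times>J. pair_weight z * pair_weight z' * \<bar>c (u z) (v z')\<bar>) \<le> \<eta> ^ 3"
proof -
  have "(\<Sum>z\<in>J\<times>J. \<Sum>z'\<in>J\<times>J. pair_weight z * pair_weight z' * \<bar>c (u z) (v z')\<bar>) = (\<Sum>z\<in>J\<times>J. pair_weight z * (\<Sum>z'\<in>J\<times>J. pair_weight z' * \<bar>c (u z) (v z')\<bar>))"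
    by (simp add: sum_distrib_left mult.assoc)
  also have "\<dots> \<le> (\<Sum>z\<in>J\<times>J. pair_weight z * (\<eta> * \<eta>))"
  proof (intro sum_mono mult_left_mono pair_weight_nonneg)
    fix z assume z: "z \<in> J \<times> J"
    have "(\<Sum>z'\<in>J\<times>J. pair_weight z' * \<bar>c (u z) (v z')\<bar>) \<le> \<eta> * (\<Sum>x\<in>J. p * \<bar>c (u z) x\<bar>)"
      by (rule sum_pair_weight_marginal[OF v]) simp
    also have "\<dots> \<le> \<eta> * \<eta>" using z u eta_pos by (intro mult_left_mono eta) auto
    finally show "(\<Sum>z'\<in>J\<times>J. pair_weight z' * \<bar>c (u z) (v z')\<bar>) \<le> \<eta> * \<eta>" .
  qed
  also have "\<dots> \<le> \<eta> * (\<eta> * \<eta>)" unfolding sum_distrib_right[symmetric] using sum_pair_weight eta_pos by (intro mult_right_mono) auto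
  finally show ?thesis by (simp add: power3_eq_cube)
qed

text \<open>The covariance of the two lognormal products equals the product of their means times \<open>exp \<zeta> - 1\<close>, where
\<open>\<zeta>\<close> combines the four covariances between the pairs.\<close>

lemma pair_tilt_covariance_bound:
  assumes t: "0 \<le> t" "t \<le> 1" and z: "z \<in> J \<times> J" "z' \<in> J \<times> J"
  shows "\<bar>expectation (\<lambda>\<omega>. pair_tilt t z \<omega> * pair_tilt t z' \<omega>) - pair_mean t z * pair_mean t z'\<bar>
    \<le> exp V ^ 6 * (\<bar>c (fst z) (fst z')\<bar> + \<bar>c (fst z) (snd z')\<bar> + \<bar>c (snd z) (fst z')\<bar> + \<bar>c (snd z) (snd z')\<bar>)"
proof -
  obtain x y x' y' where zz: "z = (x, y)" "z' = (x', y')" and J: "x \<in> J" "y \<in> J" "x' \<in> J" "y' \<in> J" using z by auto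
  define \<zeta> where "\<zeta> = t * t * c x x' + t * 1 * c x y' + 1 * t * c y x' + 1 * 1 * c y y'"
  have tt: "t * t \<le> 1" using t by (simp add: mult_le_one)
  have small: "\<bar>r * u\<bar> \<le> \<bar>u\<bar>" if "0 \<le> r" "r \<le> 1" for r u :: real using that by (simp add: abs_mult mult_left_le_one_le)
  have \<zeta>1: "\<bar>\<zeta>\<bar> \<le> \<bar>c x x'\<bar> + \<bar>c x y'\<bar> + \<bar>c y x'\<bar> + \<bar>c y y'\<bar>"
    unfolding \<zeta>_def mult_1 mult_1_right
    by (intro order_trans[OF abs_triangle_ineq] add_mono small tt) (use t in auto)
  also have "\<dots> \<le> V + V + V + V" by (intro add_mono cov_le_V J)
  finally have \<zeta>2: "\<bar>\<zeta>\<bar> \<le> 4 * V" by simp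
  have le: "t * c i j \<le> V" if "i \<in> J" "j \<in> J" for i j
    using small[OF t, of "c i j"] cov_le_V[OF that] by linarith
  have "expectation (\<lambda>\<omega>. pair_tilt t z \<omega> * pair_tilt t z' \<omega>) - pair_mean t z * pair_mean t z' = exp (t * c x y + t * c x' y') * (exp \<zeta> - 1)"
    unfolding pair_tilt_def zz fst_conv snd_conv pair_mean_def w4_expectation[OF J] \<zeta>_def by (simp add: exp_add algebra_simps)
  then have "\<bar>expectation (\<lambda>\<omega>. pair_tilt t z \<omega> * pair_tilt t z' \<omega>) - pair_mean t z * pair_mean t z'\<bar> = exp (t * c x y + t * c x' y') * \<bar>exp \<zeta> - 1\<bar>"
    by (simp add: abs_mult)
  also have "\<dots> \<le> exp (V + V) * (exp (4 * V) * (\<bar>c x x'\<bar> + \<bar>c x y'\<bar> + \<bar>c y x'\<bar> + \<bar>c y y'\<bar>))"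
  proof (intro mult_mono order_trans[OF abs_exp_minus_one_le[OF \<zeta>2]] mult_left_mono)
    show "exp (t * c x y + t * c x' y') \<le> exp (V + V)" unfolding exp_le_cancel_iff by (intro add_mono le J)
  qed (use \<zeta>1 in auto)
  also have "\<dots> = exp V ^ 6 * (\<bar>c x x'\<bar> + \<bar>c x y'\<bar> + \<bar>c y x'\<bar> + \<bar>c y y'\<bar>)"
    by (simp add: exp_of_nat_mult[symmetric] exp_add[symmetric] mult.assoc[symmetric])
  finally show ?thesis by (simp add: zz)
qed

lemma linear_kernel_variance:
  assumes t: "0 \<le> t" "t \<le> 1"
  shows "integrable P (\<lambda>\<omega>. (linear_kernel t \<omega> - \<tau> t)\<^sup>2)"
    and "expectation (\<lambda>\<omega>. (linear_kernel t \<omega> - \<tau> t)\<^sup>2) \<le> 4 * \<kappa> ^ 8 * exp V ^ 6 * \<eta> ^ 3"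
proof -
  let ?K = "J \<times> J"
  have pw: "(linear_kernel t \<omega> - \<tau> t)\<^sup>2 = (\<Sum>z\<in>?K. \<Sum>z'\<in>?K. pair_coeff z * pair_coeff z' * (pair_tilt t z \<omega> * pair_tilt t z' \<omega> - pair_mean t z' * pair_tilt t z \<omega> - pair_mean t z * pair_tilt t z' \<omega> + pair_mean t z * pair_mean t z'))" for \<omega>
  proof -
    have "linear_kernel t \<omega> - \<tau> t = (\<Sum>z\<in>?K. pair_coeff z * (pair_tilt t z \<omega> - pair_mean t z))"
      by (simp add: linear_kernel_def \<tau>_def sum_subtractf[symmetric] algebra_simps)
    then show ?thesis unfolding power2_eq_square by (simp add: sum_product algebra_simps)
  qed
  have i: "integrable P (\<lambda>\<omega>. pair_coeff z * pair_coeff z' * (pair_tilt t z \<omega> * pair_tilt t z' \<omega> - pair_mean t z' * pair_tilt t z \<omega> - pair_mean t z * pair_tilt t z' \<omega> + pair_mean t z * pair_mean t z'))"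
    if "z \<in> ?K" "z' \<in> ?K" for z z'
    using WW_integrable[OF that, of t] pair_tilt_integrable[OF that(1), of t] pair_tilt_integrable[OF that(2), of t] by simp
  have e: "expectation (\<lambda>\<omega>. pair_coeff z * pair_coeff z' * (pair_tilt t z \<omega> * pair_tilt t z' \<omega> - pair_mean t z' * pair_tilt t z \<omega> - pair_mean t z * pair_tilt t z' \<omega> + pair_mean t z * pair_mean t z'))
     = pair_coeff z * pair_coeff z' * (expectation (\<lambda>\<omega>. pair_tilt t z \<omega> * pair_tilt t z' \<omega>) - pair_mean t z * pair_mean t z')"
    if "z \<in> ?K" "z' \<in> ?K" for z z'
    using WW_integrable[OF that, of t] pair_tilt_integrable[OF that(1), of t] pair_tilt_integrable[OF that(2), of t] pair_tilt_expectation[OF that(1), of t] pair_tilt_expectation[OF that(2), of t]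
    by (simp add: prob_space)
  show "integrable P (\<lambda>\<omega>. (linear_kernel t \<omega> - \<tau> t)\<^sup>2)"
    unfolding pw by (intro Bochner_Integration.integrable_sum i)
  let ?C = "\<lambda>z z'. \<bar>c (fst z) (fst z')\<bar> + \<bar>c (fst z) (snd z')\<bar> + \<bar>c (snd z) (fst z')\<bar> + \<bar>c (snd z) (snd z')\<bar>"
  have "expectation (\<lambda>\<omega>. (linear_kernel t \<omega> - \<tau> t)\<^sup>2) = (\<Sum>z\<in>?K. \<Sum>z'\<in>?K. pair_coeff z * pair_coeff z' * (expectation (\<lambda>\<omega>. pair_tilt t z \<omega> * pair_tilt t z' \<omega>) - pair_mean t z * pair_mean t z'))"
    unfolding pw
    by (subst Bochner_Integration.integral_sum, rule Bochner_Integration.integrable_sum, rule i, assumption, assumption,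
        rule sum.cong, rule refl, subst Bochner_Integration.integral_sum, rule i, assumption, assumption,
        rule sum.cong, rule refl, rule e)
  also have "\<dots> \<le> (\<Sum>z\<in>?K. \<Sum>z'\<in>?K. \<kappa> ^ 8 * exp V ^ 6 * (pair_weight z * pair_weight z' * ?C z z'))"
  proof (intro sum_mono)
    fix z z' assume z: "z \<in> ?K" "z' \<in> ?K"
    let ?D = "expectation (\<lambda>\<omega>. pair_tilt t z \<omega> * pair_tilt t z' \<omega>) - pair_mean t z * pair_mean t z'"
    have "pair_coeff z * pair_coeff z' * ?D \<le> \<bar>pair_coeff z * pair_coeff z' * ?D\<bar>" by simp
    also have "\<dots> = \<bar>pair_coeff z\<bar> * \<bar>pair_coeff z'\<bar> * \<bar>?D\<bar>" by (simp add: abs_mult)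
    also have "\<dots> \<le> (\<kappa> ^ 4 * pair_weight z) * (\<kappa> ^ 4 * pair_weight z') * (exp V ^ 6 * ?C z z')"
      using kappa_pos pair_weight_nonneg by (intro mult_mono pair_coeff_bound z pair_tilt_covariance_bound t mult_nonneg_nonneg) auto
    also have "\<dots> = (\<kappa> ^ 4 * \<kappa> ^ 4) * exp V ^ 6 * (pair_weight z * pair_weight z' * ?C z z')" by (simp only: mult_ac)
    finally show "pair_coeff z * pair_coeff z' * ?D \<le> \<kappa> ^ 8 * exp V ^ 6 * (pair_weight z * pair_weight z' * ?C z z')" by (simp add: power_add[symmetric])
  qed
  also have "\<dots> = \<kappa> ^ 8 * exp V ^ 6 * (\<Sum>z\<in>?K. \<Sum>z'\<in>?K. pair_weight z * pair_weight z' * ?C z z')" by (simp add: sum_distrib_left)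
  also have "(\<Sum>z\<in>?K. \<Sum>z'\<in>?K. pair_weight z * pair_weight z' * ?C z z') = (\<Sum>z\<in>?K. \<Sum>z'\<in>?K. pair_weight z * pair_weight z' * \<bar>c (fst z) (fst z')\<bar>)
      + (\<Sum>z\<in>?K. \<Sum>z'\<in>?K. pair_weight z * pair_weight z' * \<bar>c (fst z) (snd z')\<bar>) + (\<Sum>z\<in>?K. \<Sum>z'\<in>?K. pair_weight z * pair_weight z' * \<bar>c (snd z) (fst z')\<bar>)
      + (\<Sum>z\<in>?K. \<Sum>z'\<in>?K. pair_weight z * pair_weight z' * \<bar>c (snd z) (snd z')\<bar>)"
    by (simp only: distrib_left sum.distrib)
  also have "\<kappa> ^ 8 * exp V ^ 6 * \<dots> \<le> \<kappa> ^ 8 * exp V ^ 6 * (\<eta> ^ 3 + \<eta> ^ 3 + \<eta> ^ 3 + \<eta> ^ 3)"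
    using kappa_pos by (intro mult_left_mono add_mono sum_pair_weight_chain) auto
  finally show "expectation (\<lambda>\<omega>. (linear_kernel t \<omega> - \<tau> t)\<^sup>2) \<le> 4 * \<kappa> ^ 8 * exp V ^ 6 * \<eta> ^ 3" by simp
qed

definition ratio_sum :: "'w \<Rightarrow> real" where "ratio_sum \<omega> = \<bar>avg f (ev \<omega>) / mass (ev \<omega>)\<bar> + \<bar>avg g (ev \<omega>) / mass (ev \<omega>)\<bar>"

lemma ratio_sum_measurable[measurable]: "ratio_sum \<in> borel_measurable P" unfolding ratio_sum_def[abs_def] by measurable

lemma ratio_sum_bound: "0 \<le> ratio_sum \<omega>" "ratio_sum \<omega> \<le> 2 * \<kappa>"
proof -
  have "\<bar>avg f (ev \<omega>) / mass (ev \<omega>)\<bar> \<le> \<kappa>" "\<bar>avg g (ev \<omega>) / mass (ev \<omega>)\<bar> \<le> \<kappa>"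
    by (rule ratio_bound, erule ev_pos)+
  then show "0 \<le> ratio_sum \<omega>" "ratio_sum \<omega> \<le> 2 * \<kappa>" unfolding ratio_sum_def by linarith+
qed

lemma fluct_f: "fluct f (ev \<omega>) = avg f (ev \<omega>)" and fluct_g: "fluct g (ev \<omega>) = avg g (ev \<omega>)"
  and fluct_one: "fluct (\<lambda>_. 1) (ev \<omega>) = mass (ev \<omega>) - 1"
  using f_centered g_centered p_sum by (simp_all add: fluct_def avg_def)

text \<open>This is how negative moments of the mass are avoided: the denominator is harmless when the mass is
at least \<open>1 / 2\<close>, and otherwise the a priori bound on the ratio is paid for by the deviation of the mass from its mean \<open>1\<close>.\<close>

lemma ratio_square_bound:
  fixes s m k :: real
  assumes "0 < m" "\<bar>s / m\<bar> \<le> k"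
  shows "(s / m)\<^sup>2 \<le> 4 * s\<^sup>2 + 4 * k\<^sup>2 * (m - 1)\<^sup>2"
proof (cases "1 / 2 \<le> m")
  case True
  have "(1 / 2)\<^sup>2 \<le> m\<^sup>2" using True by (intro power_mono) auto
  then have "s\<^sup>2 * 1 \<le> s\<^sup>2 * (4 * m\<^sup>2)" by (intro mult_left_mono) (auto simp: power2_eq_square)
  then have "(s / m)\<^sup>2 \<le> 4 * s\<^sup>2" using assms(1) by (simp add: power_divide divide_le_eq mult_ac)
  then show ?thesis by (simp add: add_increasing2)
next
  case False
  have "(1 / 2)\<^sup>2 \<le> (1 - m)\<^sup>2" using False by (intro power_mono) auto
  then have "1 \<le> 4 * (m - 1)\<^sup>2" by (simp add: power2_eq_square algebra_simps)
  then have "k\<^sup>2 * 1 \<le> k\<^sup>2 * (4 * (m - 1)\<^sup>2)" by (intro mult_left_mono) auto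
  moreover have "(s / m)\<^sup>2 \<le> k\<^sup>2" using assms(2) by (metis abs_ge_zero abs_le_square_iff abs_of_nonneg order_trans)
  ultimately show ?thesis by (simp add: mult_ac add_increasing)
qed

lemma ratio_sum_second_moment: "expectation (\<lambda>\<omega>. (ratio_sum \<omega>)\<^sup>2) \<le> 32 * \<kappa>\<^sup>2 * exp V * \<eta>"
proof -
  let ?R = "\<lambda>\<omega>. 2 * (4 * (fluct f (ev \<omega>))\<^sup>2 + 4 * \<kappa>\<^sup>2 * (fluct (\<lambda>_. 1) (ev \<omega>))\<^sup>2) + 2 * (4 * (fluct g (ev \<omega>))\<^sup>2 + 4 * \<kappa>\<^sup>2 * (fluct (\<lambda>_. 1) (ev \<omega>))\<^sup>2)"
  have Xi: "integrable P (\<lambda>\<omega>. (fluct f (ev \<omega>))\<^sup>2)" "integrable P (\<lambda>\<omega>. (fluct g (ev \<omega>))\<^sup>2)" "integrable P (\<lambda>\<omega>. (fluct (\<lambda>_. 1) (ev \<omega>))\<^sup>2)"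
    by (rule fluct_power_integrable, erule f_bound g_bound, simp)+ (rule fluct_power_integrable[where H=1], auto)
  have "expectation (\<lambda>\<omega>. (ratio_sum \<omega>)\<^sup>2) \<le> expectation ?R"
  proof (rule integral_mono')
    show "integrable P ?R" using Xi by simp
    fix \<omega>
    let ?A = "avg f (ev \<omega>) / mass (ev \<omega>)" and ?B = "avg g (ev \<omega>) / mass (ev \<omega>)"
    have "(ratio_sum \<omega>)\<^sup>2 \<le> 2 * ?A\<^sup>2 + 2 * ?B\<^sup>2"
    proof -
      have "(\<bar>r\<bar> + \<bar>r'\<bar>)\<^sup>2 \<le> 2 * r\<^sup>2 + 2 * r'\<^sup>2" for r r' :: real
        using sum_squares_bound[of "\<bar>r\<bar>" "\<bar>r'\<bar>"] by (simp add: power2_sum)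
      then show ?thesis unfolding ratio_sum_def .
    qed
    also have "\<dots> \<le> ?R \<omega>"
      unfolding fluct_f fluct_g fluct_one by (intro add_mono mult_left_mono ratio_square_bound mass_ev_pos ratio_bound ev_pos) auto
    finally show "(ratio_sum \<omega>)\<^sup>2 \<le> ?R \<omega>" .
  qed (auto intro!: add_nonneg_nonneg)
  also have "\<dots> = 8 * expectation (\<lambda>\<omega>. (fluct f (ev \<omega>))\<^sup>2) + 8 * expectation (\<lambda>\<omega>. (fluct g (ev \<omega>))\<^sup>2) + 16 * \<kappa>\<^sup>2 * expectation (\<lambda>\<omega>. (fluct (\<lambda>_. 1) (ev \<omega>))\<^sup>2)"
    using Xi by simp
  also have "\<dots> \<le> 8 * (\<kappa>\<^sup>2 * exp V * \<eta>) + 8 * (\<kappa>\<^sup>2 * exp V * \<eta>) + 16 * \<kappa>\<^sup>2 * (1\<^sup>2 * exp V * \<eta>)"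
    by (intro add_mono mult_left_mono fluct_second_moment f_bound g_bound) auto
  finally show ?thesis by (simp add: algebra_simps)
qed

lemma pair_tilt_ratio_sum_expectation:
  assumes t: "0 \<le> t" "t \<le> 1" and z: "z \<in> J \<times> J"
  shows "integrable P (\<lambda>\<omega>. pair_tilt t z \<omega> * ratio_sum \<omega>)" "expectation (\<lambda>\<omega>. pair_tilt t z \<omega> * ratio_sum \<omega>) \<le> q * ((exp V ^ 6 + 32 * \<kappa>\<^sup>2 * exp V) / 2)"
proof -
  note [measurable] = pair_tilt_measurable[OF z, of t]
  show i: "integrable P (\<lambda>\<omega>. pair_tilt t z \<omega> * ratio_sum \<omega>)"
    by (rule Bochner_Integration.integrable_bound[OF Bochner_Integration.integrable_mult_right[OF pair_tilt_integrable[OF z, of t], of "2 * \<kappa>"]])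
       (use ratio_sum_bound pair_tilt_pos kappa_pos in \<open>auto simp: abs_mult abs_of_pos mult.commute intro!: AE_I2 mult_right_mono less_imp_le\<close>)
  obtain x y where zz: "z = (x, y)" and J: "x \<in> J" "y \<in> J" using z by auto
  have W2: "expectation (\<lambda>\<omega>. (pair_tilt t z \<omega>)\<^sup>2) \<le> exp V ^ 6"
  proof -
    have tt: "t * t \<le> 1" using t by (simp add: mult_le_one)
    have "\<bar>t * c x y\<bar> \<le> 1 * V" unfolding abs_mult using t cov_le_V[OF J] V0 by (intro mult_mono) auto
    then have tc: "t * c x y \<le> V" by linarith
    have "t * t * V \<le> V" using tt V0 by (simp add: mult_left_le_one_le)
    have "expectation (\<lambda>\<omega>. (pair_tilt t z \<omega>)\<^sup>2) = exp (t * c x y + t * c x y) * exp (t * t * V + t * c x y + t * c x y + V)"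
      using w4_expectation[OF J J, of t 1 t 1] cov_sym[OF J] J by (simp add: pair_tilt_def zz power2_eq_square var)
    also have "\<dots> \<le> exp (V + V) * exp (V + V + V + V)"
      using tc \<open>t * t * V \<le> V\<close> by (intro mult_mono) auto
    also have "\<dots> = exp V ^ 6" by (simp add: exp_of_nat_mult[symmetric] exp_add[symmetric])
    finally show ?thesis .
  qed
  have W2i: "integrable P (\<lambda>\<omega>. (pair_tilt t z \<omega>)\<^sup>2)" using WW_integrable[OF z z, of t] by (simp add: power2_eq_square)
  have Z2i: "integrable P (\<lambda>\<omega>. (ratio_sum \<omega>)\<^sup>2)"
  proof (rule integrable_const_bound[of _ "(2 * \<kappa>)\<^sup>2"])
    show "AE \<omega> in P. norm ((ratio_sum \<omega>)\<^sup>2) \<le> (2 * \<kappa>)\<^sup>2"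
      unfolding norm_power by (intro AE_I2 power_mono) (use ratio_sum_bound in auto)
  qed measurable
  have "expectation (\<lambda>\<omega>. pair_tilt t z \<omega> * ratio_sum \<omega>) \<le> expectation (\<lambda>\<omega>. q / 2 * (pair_tilt t z \<omega>)\<^sup>2 + 1 / (2 * q) * (ratio_sum \<omega>)\<^sup>2)"
  proof (rule integral_mono[OF i])
    show "integrable P (\<lambda>\<omega>. q / 2 * (pair_tilt t z \<omega>)\<^sup>2 + 1 / (2 * q) * (ratio_sum \<omega>)\<^sup>2)" using W2i Z2i by simp
    fix \<omega>
    have "0 \<le> (q * pair_tilt t z \<omega> - ratio_sum \<omega>)\<^sup>2 / (2 * q)" using q_pos by simp
    also have "\<dots> = q / 2 * (pair_tilt t z \<omega>)\<^sup>2 + 1 / (2 * q) * (ratio_sum \<omega>)\<^sup>2 - pair_tilt t z \<omega> * ratio_sum \<omega>"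
      using q_pos by (simp add: power2_diff power_mult_distrib field_simps power2_eq_square)
    finally show "pair_tilt t z \<omega> * ratio_sum \<omega> \<le> q / 2 * (pair_tilt t z \<omega>)\<^sup>2 + 1 / (2 * q) * (ratio_sum \<omega>)\<^sup>2" by simp
  qed
  also have "\<dots> = q / 2 * expectation (\<lambda>\<omega>. (pair_tilt t z \<omega>)\<^sup>2) + 1 / (2 * q) * expectation (\<lambda>\<omega>. (ratio_sum \<omega>)\<^sup>2)"
    using W2i Z2i by simp
  also have "\<dots> \<le> q / 2 * exp V ^ 6 + 1 / (2 * q) * (32 * \<kappa>\<^sup>2 * exp V * \<eta>)"
    using q_pos by (intro add_mono mult_left_mono W2 ratio_sum_second_moment) auto
  also have "\<dots> = q * ((exp V ^ 6 + 32 * \<kappa>\<^sup>2 * exp V) / 2)"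
    using q_pos by (simp add: eta_q field_simps power2_eq_square)
  finally show "expectation (\<lambda>\<omega>. pair_tilt t z \<omega> * ratio_sum \<omega>) \<le> q * ((exp V ^ 6 + 32 * \<kappa>\<^sup>2 * exp V) / 2)" .
qed

lemma stein_kernel_minus_linear_kernel: "\<bar>stein_kernel t \<omega> - linear_kernel t \<omega>\<bar> \<le> 2 * \<kappa> ^ 3 * (\<Sum>z\<in>J\<times>J. pair_weight z * (pair_tilt t z \<omega> * ratio_sum \<omega>))"
proof -
  let ?A = "avg f (ev \<omega>) / mass (ev \<omega>)" and ?B = "avg g (ev \<omega>) / mass (ev \<omega>)"
  have stein_kernel_eq: "stein_kernel t \<omega> = (\<Sum>z\<in>J\<times>J. p * p * fg (fst z) * c (fst z) (snd z) * pair_tilt t z \<omega> * ((f (snd z) - ?A) * (g (snd z) - ?B)))"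
    unfolding stein_kernel_def quot_deriv_def sum_distrib_left sum.cartesian_product
    by (intro sum.cong) (auto simp: pair_tilt_def ev_eq mult_ac)
  have "stein_kernel t \<omega> - linear_kernel t \<omega> = (\<Sum>z\<in>J\<times>J. p * p * fg (fst z) * c (fst z) (snd z) * pair_tilt t z \<omega> * ((f (snd z) - ?A) * (g (snd z) - ?B) - fg (snd z)))"
    unfolding stein_kernel_eq linear_kernel_def sum_subtractf[symmetric] by (intro sum.cong refl) (simp add: pair_coeff_def algebra_simps)
  then have "\<bar>stein_kernel t \<omega> - linear_kernel t \<omega>\<bar> \<le> (\<Sum>z\<in>J\<times>J. \<bar>p * p * fg (fst z) * c (fst z) (snd z) * pair_tilt t z \<omega> * ((f (snd z) - ?A) * (g (snd z) - ?B) - fg (snd z))\<bar>)"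
    by (simp only: sum_abs)
  also have "\<dots> \<le> (\<Sum>z\<in>J\<times>J. 2 * \<kappa> ^ 3 * (pair_weight z * (pair_tilt t z \<omega> * ratio_sum \<omega>)))"
  proof (rule sum_mono)
    fix z assume z: "z \<in> J \<times> J"
    then have zJ: "fst z \<in> J" "snd z \<in> J" by auto
    have AB: "\<bar>?A\<bar> \<le> \<kappa>" "\<bar>?B\<bar> \<le> \<kappa>" by (rule ratio_bound, erule ev_pos)+
    have "\<bar>(f (snd z) - ?A) * (g (snd z) - ?B) - fg (snd z)\<bar> = \<bar>(?A * ?B - f (snd z) * ?B) - ?A * g (snd z)\<bar>" by (simp add: algebra_simps)
    also have "\<dots> \<le> \<bar>?A\<bar> * \<bar>?B\<bar> + \<bar>f (snd z)\<bar> * \<bar>?B\<bar> + \<bar>?A\<bar> * \<bar>g (snd z)\<bar>"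
    proof -
      have "\<bar>r1 - r2 - r3\<bar> \<le> \<bar>r1\<bar> + \<bar>r2\<bar> + \<bar>r3\<bar>" for r1 r2 r3 :: real by linarith
      then show ?thesis unfolding abs_mult[symmetric] .
    qed
    also have "\<dots> \<le> \<kappa> * \<bar>?B\<bar> + \<kappa> * \<bar>?B\<bar> + \<bar>?A\<bar> * \<kappa>"
      by (intro add_mono mult_mono AB f_bound g_bound zJ) (use kappa_pos in auto)
    also have "\<dots> \<le> 2 * \<kappa> * ratio_sum \<omega>"
    proof -
      have "\<kappa> * r' + \<kappa> * r' + r * \<kappa> \<le> 2 * \<kappa> * (r + r')" if "0 \<le> r" for r r'
        using mult_nonneg_nonneg[OF less_imp_le[OF kappa_pos] that] by (simp add: algebra_simps)
      from this[OF abs_ge_zero] show ?thesis unfolding ratio_sum_def .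
    qed
    finally have d: "\<bar>(f (snd z) - ?A) * (g (snd z) - ?B) - fg (snd z)\<bar> \<le> 2 * \<kappa> * ratio_sum \<omega>" .
    have "\<bar>p * p * fg (fst z) * c (fst z) (snd z) * pair_tilt t z \<omega> * ((f (snd z) - ?A) * (g (snd z) - ?B) - fg (snd z))\<bar>
      = (pair_weight z * pair_tilt t z \<omega>) * (\<bar>fg (fst z)\<bar> * \<bar>(f (snd z) - ?A) * (g (snd z) - ?B) - fg (snd z)\<bar>)"
      using p_pos pair_tilt_pos[of t z \<omega>] by (simp add: pair_weight_def abs_mult)
    also have "\<dots> \<le> (pair_weight z * pair_tilt t z \<omega>) * (\<kappa>\<^sup>2 * (2 * \<kappa> * ratio_sum \<omega>))"
      using pair_weight_nonneg[of z] pair_tilt_pos[of t z \<omega>] by (intro mult_left_mono mult_mono d fg_bound zJ) auto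
    finally show "\<bar>p * p * fg (fst z) * c (fst z) (snd z) * pair_tilt t z \<omega> * ((f (snd z) - ?A) * (g (snd z) - ?B) - fg (snd z))\<bar> \<le> 2 * \<kappa> ^ 3 * (pair_weight z * (pair_tilt t z \<omega> * ratio_sum \<omega>))"
      by (simp add: eval_nat_numeral mult_ac)
  qed
  finally show ?thesis by (simp add: sum_distrib_left)
qed

lemma w_dQ_integrable:
  assumes x: "x \<in> J" shows "integrable P (\<lambda>\<omega>. w t x \<omega> * quot_deriv x (ev \<omega>))"
proof -
  let ?R = "\<lambda>\<omega>. 4 * \<kappa>\<^sup>2 * (\<Sum>y\<in>J. p * \<bar>c x y\<bar> * (w t x \<omega> * w 1 y \<omega>))"
  note [measurable] = w_measurable[OF x]
  have "integrable P ?R"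
    by (intro Bochner_Integration.integrable_mult_right Bochner_Integration.integrable_sum w2_integrable x)
  then show ?thesis
  proof (rule Bochner_Integration.integrable_bound)
    show "AE \<omega> in P. norm (w t x \<omega> * quot_deriv x (ev \<omega>)) \<le> norm (?R \<omega>)"
    proof (rule AE_I2)
      fix \<omega>
      have "norm (w t x \<omega> * quot_deriv x (ev \<omega>)) = w t x \<omega> * \<bar>quot_deriv x (ev \<omega>)\<bar>" by (simp add: abs_mult abs_of_pos)
      also have "\<dots> \<le> w t x \<omega> * (4 * \<kappa>\<^sup>2 * delta x (ev \<omega>))"
        by (intro mult_left_mono quot_deriv_bound ev_pos) (auto intro: less_imp_le)
      also have "\<dots> = ?R \<omega>" by (simp add: delta_def ev_eq sum_distrib_left mult_ac)
      finally show "norm (w t x \<omega> * quot_deriv x (ev \<omega>)) \<le> norm (?R \<omega>)" by simp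
    qed
  qed measurable
qed

lemma stein_kernel_integrable: "integrable P (stein_kernel t)"
  unfolding stein_kernel_def[abs_def] by (intro Bochner_Integration.integrable_sum Bochner_Integration.integrable_mult_right w_dQ_integrable)

text \<open>The distance to \<open>linear_kernel\<close> is small in \<open>L\<^sup>1\<close> because each random quotient is of order \<open>q\<close>, the distance from there to \<open>\<tau>\<close> is small
because of the variance bound.\<close>

lemma stein_kernel_concentration:
  assumes t: "0 \<le> t" "t \<le> 1"
  shows "expectation (\<lambda>\<omega>. \<bar>stein_kernel t \<omega> - \<tau> t\<bar>) \<le> kernel_const \<kappa> V * q ^ 3"
proof -
  let ?R1 = "\<lambda>\<omega>. 2 * \<kappa> ^ 3 * (\<Sum>z\<in>J\<times>J. pair_weight z * (pair_tilt t z \<omega> * ratio_sum \<omega>))"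
  let ?R2 = "\<lambda>\<omega>. 1 / (2 * q ^ 3) * (linear_kernel t \<omega> - \<tau> t)\<^sup>2 + q ^ 3 / 2"
  have i1: "integrable P ?R1"
    by (intro Bochner_Integration.integrable_mult_right Bochner_Integration.integrable_sum pair_tilt_ratio_sum_expectation t)
  have i2: "integrable P ?R2" using linear_kernel_variance(1)[OF t] by simp
  have "expectation (\<lambda>\<omega>. \<bar>stein_kernel t \<omega> - \<tau> t\<bar>) \<le> expectation (\<lambda>\<omega>. ?R1 \<omega> + ?R2 \<omega>)"
  proof (rule integral_mono)
    show "integrable P (\<lambda>\<omega>. \<bar>stein_kernel t \<omega> - \<tau> t\<bar>)" using stein_kernel_integrable[of t] by simp
    show "integrable P (\<lambda>\<omega>. ?R1 \<omega> + ?R2 \<omega>)" using i1 i2 by (rule Bochner_Integration.integrable_add)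
    fix \<omega>
    have "0 \<le> (\<bar>linear_kernel t \<omega> - \<tau> t\<bar> - q ^ 3)\<^sup>2 / (2 * q ^ 3)" using q_pos by simp
    also have "\<dots> = ?R2 \<omega> - \<bar>linear_kernel t \<omega> - \<tau> t\<bar>"
      using q_pos by (simp add: power2_diff field_simps power2_eq_square)
    finally show "\<bar>stein_kernel t \<omega> - \<tau> t\<bar> \<le> ?R1 \<omega> + ?R2 \<omega>" using stein_kernel_minus_linear_kernel[of t \<omega>] by linarith
  qed
  also have "\<dots> = expectation ?R1 + expectation ?R2" by (rule Bochner_Integration.integral_add[OF i1 i2])
  also have "expectation ?R1 = 2 * \<kappa> ^ 3 * (\<Sum>z\<in>J\<times>J. pair_weight z * expectation (\<lambda>\<omega>. pair_tilt t z \<omega> * ratio_sum \<omega>))"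
    by (subst integral_mult_right_zero, subst Bochner_Integration.integral_sum) (auto intro: pair_tilt_ratio_sum_expectation t)
  also have "\<dots> \<le> 2 * \<kappa> ^ 3 * (\<Sum>z\<in>J\<times>J. pair_weight z * (q * ((exp V ^ 6 + 32 * \<kappa>\<^sup>2 * exp V) / 2)))"
    using kappa_pos by (intro mult_left_mono sum_mono pair_tilt_ratio_sum_expectation t pair_weight_nonneg) auto
  also have "\<dots> \<le> 2 * \<kappa> ^ 3 * (\<eta> * (q * ((exp V ^ 6 + 32 * \<kappa>\<^sup>2 * exp V) / 2)))"
    unfolding sum_distrib_right[symmetric] using kappa_pos q_pos by (intro mult_left_mono mult_right_mono sum_pair_weight) auto
  also have "\<dots> = \<kappa> ^ 3 * (exp V ^ 6 + 32 * \<kappa>\<^sup>2 * exp V) * q ^ 3" by (simp add: eta_q eval_nat_numeral algebra_simps)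
  also have "expectation ?R2 = 1 / (2 * q ^ 3) * expectation (\<lambda>\<omega>. (linear_kernel t \<omega> - \<tau> t)\<^sup>2) + q ^ 3 / 2"
    using linear_kernel_variance(1)[OF t] by (simp add: prob_space)
  also have "1 / (2 * q ^ 3) * expectation (\<lambda>\<omega>. (linear_kernel t \<omega> - \<tau> t)\<^sup>2) \<le> 1 / (2 * q ^ 3) * (4 * \<kappa> ^ 8 * exp V ^ 6 * \<eta> ^ 3)"
    using q_pos by (intro mult_left_mono linear_kernel_variance t) auto
  also have "1 / (2 * q ^ 3) * (4 * \<kappa> ^ 8 * exp V ^ 6 * \<eta> ^ 3) = 4 * \<kappa> ^ 8 * exp V ^ 6 / 2 * q ^ 3"
    using q_pos by (simp add: eta_q field_simps power_mult[symmetric] power_add[symmetric])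
  finally show ?thesis by (simp add: kernel_const_def algebra_simps add_divide_distrib)
qed

end

section \<open>Stein discrepancy of the quotient functional\<close>

text \<open>Constants for the second moment of the quadratic remainder of \<open>quot\<close> and for the final bound. The argument \<open>hb\<close> is an upper bound of \<open>\<eta>\<close>
and \<open>B\<close> bounds the solution of Stein's equation.\<close>

definition remainder_const :: "real \<Rightarrow> real \<Rightarrow> real \<Rightarrow> real" where
  "remainder_const \<kappa> V hb = 168 * \<kappa> ^ 4 * exp V ^ 6 * (1 + hb)"

definition stein_const :: "real \<Rightarrow> real \<Rightarrow> real \<Rightarrow> real \<Rightarrow> real" where
  "stein_const \<kappa> V hb B =
     2 * (remainder_const \<kappa> V hb * (2 + hb) + \<kappa> ^ 4 * exp V) + 2 * kernel_const \<kappa> V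
     + B * ((1 + remainder_const \<kappa> V hb) / 2) * (1 + 2 * (\<kappa> ^ 4 * exp V + remainder_const \<kappa> V hb * hb))"

lemma weighted_AM_GM:
  fixes q x y :: real
  assumes "0 < q" shows "2 * (x * y) \<le> q * x\<^sup>2 + 1 / q * y\<^sup>2"
proof -
  have "0 \<le> (q * x - y)\<^sup>2 / q" using assms by simp
  also have "\<dots> = q * x\<^sup>2 + 1 / q * y\<^sup>2 - 2 * (x * y)"
    using assms by (simp add: field_simps power2_eq_square)
  finally show ?thesis by simp
qed

context lognormal_quotient
begin

lemma tilted_expectation_deriv:
  fixes \<phi> \<phi>' :: "real \<Rightarrow> real"
  assumes x: "x \<in> J" and t: "- 1 < t" "t < 2" and s: "0 < s"
    and d: "\<And>z. (\<phi> has_real_derivative \<phi>' z) (at z)" and c': "continuous_on UNIV \<phi>'"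
    and B: "\<And>z. \<bar>\<phi> z\<bar> \<le> B" "\<And>z. \<bar>\<phi>' z\<bar> \<le> 2"
  shows "((\<lambda>t. expectation (\<lambda>\<omega>. \<phi> ((quot (tilt t x (ev \<omega>)) - \<mu>) / s)))
      has_real_derivative expectation (\<lambda>\<omega>. \<phi>' ((quot (ev \<omega>) - \<mu>) / s) / s * (w t x \<omega> * quot_deriv x (ev \<omega>)))) (at t)"
proof -
  have [measurable]: "\<phi>' \<in> borel_measurable borel" using c' by (rule borel_measurable_continuous_onI)
  have "continuous_on UNIV \<phi>" using d by (intro DERIV_continuous_on) (auto intro: has_field_derivative_at_within)
  then have [measurable]: "\<phi> \<in> borel_measurable borel" by (rule borel_measurable_continuous_onI)
  define \<Phi> where "\<Phi> u = \<phi>' ((quot u - \<mu>) / s) / s * quot_deriv x u" for u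
  have \<Phi>m: "\<Phi> \<in> borel_measurable Jborel" unfolding \<Phi>_def by measurable
  have "((\<lambda>t. expectation (\<lambda>\<omega>. \<phi> ((quot (tilt t x (ev \<omega>)) - \<mu>) / s)))
      has_real_derivative expectation (\<lambda>\<omega>. \<Phi> (tilt t x (ev \<omega>)))) (at t)"
  proof (rule has_real_derivative_integral[OF t, where W="\<lambda>\<omega>. 2 / s * (4 * \<kappa>\<^sup>2 * (exp (2 * V) * (V * mass (ev \<omega>))))"])
    fix r :: real assume r: "- 1 < r" "r < 2"
    show "integrable P (\<lambda>\<omega>. \<phi> ((quot (tilt r x (ev \<omega>)) - \<mu>) / s))"
      by (rule integrable_const_bound[of _ B]) (use B in auto)
    show "((\<lambda>r. \<phi> ((quot (tilt r x (ev \<omega>)) - \<mu>) / s)) has_real_derivative \<Phi> (tilt r x (ev \<omega>))) (at r)" for \<omega>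
    proof -
      have "((\<lambda>r. (quot (tilt r x (ev \<omega>)) - \<mu>) / s) has_real_derivative quot_deriv x (tilt r x (ev \<omega>)) / s) (at r)"
        using s by (auto intro!: derivative_eq_intros quot_tilt_deriv ev_pos)
      from DERIV_chain2[OF d this] show ?thesis by (simp add: \<Phi>_def)
    qed
    show "\<bar>\<Phi> (tilt r x (ev \<omega>))\<bar> \<le> 2 / s * (4 * \<kappa>\<^sup>2 * (exp (2 * V) * (V * mass (ev \<omega>))))" for \<omega>
      unfolding \<Phi>_def abs_mult
    proof (intro mult_mono)
      show "\<bar>\<phi>' ((quot (tilt r x (ev \<omega>)) - \<mu>) / s) / s\<bar> \<le> 2 / s" using B(2) s by (simp add: divide_right_mono)
      show "\<bar>quot_deriv x (tilt r x (ev \<omega>))\<bar> \<le> 4 * \<kappa>\<^sup>2 * (exp (2 * V) * (V * mass (ev \<omega>)))"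
        using r by (intro quot_deriv_tilt_bound x) auto
    qed (use s in auto)
  next
    show "(\<lambda>\<omega>. \<Phi> (tilt t x (ev \<omega>))) \<in> borel_measurable P"
      by (rule measurable_compose[OF _ \<Phi>m]) measurable
    have "integrable P (\<lambda>\<omega>. mass (ev \<omega>))"
      by (rule integrable_poly_mass[where C=1 and n=1]) (use mass_ev_pos in \<open>auto simp: less_imp_le abs_of_pos\<close>)
    then show "integrable P (\<lambda>\<omega>. 2 / s * (4 * \<kappa>\<^sup>2 * (exp (2 * V) * (V * mass (ev \<omega>)))))"
      by (intro Bochner_Integration.integrable_mult_right)
  qed
  also have "expectation (\<lambda>\<omega>. \<Phi> (tilt t x (ev \<omega>))) = expectation (\<lambda>\<omega>. w t x \<omega> * \<Phi> (ev \<omega>))"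
    by (rule cameron_martin_exp(1)[OF x \<Phi>m, symmetric])
  finally show ?thesis by (simp add: \<Phi>_def mult_ac)
qed

lemma \<tau>_alt: "\<tau> t = (\<Sum>x\<in>J. \<Sum>y\<in>J. p * p * fg x * fg y * (c x y * exp (t * c x y)))"
  by (simp add: \<tau>_def pair_coeff_def pair_mean_def sum.cartesian_product split_def mult_ac)

text \<open>Both sides are compared along the interpolation \<open>t\<close> between no shift and the full shift: the function \<open>\<Xi>\<close>
takes the difference of the two expectations as its increment over \<open>[0, 1]\<close>, and its derivative is the expectation of \<open>\<phi>'\<close> times
the centered kernel. Subtracting \<open>m1 * \<theta>\<close> before the mean value theorem is applied removes the need to integrate
in \<open>t\<close>.\<close>

lemma stein_linear_part:
  fixes \<phi> \<phi>' :: "real \<Rightarrow> real"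
  assumes s: "0 < s"
    and d: "\<And>z. (\<phi> has_real_derivative \<phi>' z) (at z)" and c': "continuous_on UNIV \<phi>'"
    and B: "\<And>z. \<bar>\<phi> z\<bar> \<le> B" "\<And>z. \<bar>\<phi>' z\<bar> \<le> 2"
  shows "\<bar>expectation (\<lambda>\<omega>. fluct fg (ev \<omega>) * \<phi> ((quot (ev \<omega>) - \<mu>) / s))
     - expectation (\<lambda>\<omega>. \<phi>' ((quot (ev \<omega>) - \<mu>) / s)) / s * expectation (\<lambda>\<omega>. (fluct fg (ev \<omega>))\<^sup>2)\<bar>
    \<le> 2 / s * (kernel_const \<kappa> V * q ^ 3)"
proof -
  have [measurable]: "\<phi>' \<in> borel_measurable borel" using c' by (rule borel_measurable_continuous_onI)
  have "continuous_on UNIV \<phi>" using d by (intro DERIV_continuous_on) (auto intro: has_field_derivative_at_within)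
  then have [measurable]: "\<phi> \<in> borel_measurable borel" by (rule borel_measurable_continuous_onI)
  define F where "F u = (quot u - \<mu>) / s" for u
  have Fm[measurable]: "F \<in> borel_measurable Jborel" unfolding F_def by measurable
  define \<psi> where "\<psi> x t = expectation (\<lambda>\<omega>. \<phi> (F (tilt t x (ev \<omega>))))" for x t
  define m1 where "m1 = expectation (\<lambda>\<omega>. \<phi>' (F (ev \<omega>))) / s"
  define \<theta> where "\<theta> t = (\<Sum>x\<in>J. \<Sum>y\<in>J. p * p * fg x * fg y * (exp (t * c x y) - 1))" for t
  define \<Xi> where "\<Xi> t = (\<Sum>x\<in>J. p * fg x * \<psi> x t) - m1 * \<theta> t" for t
  have \<phi>'i: "integrable P (\<lambda>\<omega>. \<phi>' (F (ev \<omega>)))" by (rule integrable_const_bound[of _ 2]) (use B in auto)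
  have \<phi>i: "integrable P (\<lambda>\<omega>. \<phi> (F (ev \<omega>)))" by (rule integrable_const_bound[of _ B]) (use B in auto)
  have wdi: "integrable P (\<lambda>\<omega>. \<phi>' (F (ev \<omega>)) / s * (w t x \<omega> * quot_deriv x (ev \<omega>)))" if x: "x \<in> J" for t x
  proof (rule Bochner_Integration.integrable_bound[OF Bochner_Integration.integrable_mult_right[OF w_dQ_integrable[OF x, of t], of "2 / s"]])
    note [measurable] = w_measurable[OF x]
    show "(\<lambda>\<omega>. \<phi>' (F (ev \<omega>)) / s * (w t x \<omega> * quot_deriv x (ev \<omega>))) \<in> borel_measurable P" by measurable
    have "\<bar>\<phi>' z / s\<bar> \<le> \<bar>2 / s\<bar>" for z using B(2)[of z] s by (simp add: divide_right_mono)
    then show "AE \<omega> in P. norm (\<phi>' (F (ev \<omega>)) / s * (w t x \<omega> * quot_deriv x (ev \<omega>))) \<le> norm (2 / s * (w t x \<omega> * quot_deriv x (ev \<omega>)))"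
      unfolding real_norm_def abs_mult[of _ "w _ _ _ * _"] by (intro AE_I2 mult_right_mono) auto
  qed
  have d\<theta>: "(\<theta> has_real_derivative \<tau> t) (at t)" for t
    unfolding \<theta>_def[abs_def] \<tau>_alt by (auto intro!: derivative_eq_intros sum.cong simp: mult_ac)
  have d\<Xi>: "(\<Xi> has_real_derivative expectation (\<lambda>\<omega>. \<phi>' (F (ev \<omega>)) / s * (stein_kernel t \<omega> - \<tau> t))) (at t)" if t: "- 1 < t" "t < 2" for t
  proof -
    have "(\<Xi> has_real_derivative (\<Sum>x\<in>J. p * fg x * expectation (\<lambda>\<omega>. \<phi>' (F (ev \<omega>)) / s * (w t x \<omega> * quot_deriv x (ev \<omega>)))) - m1 * \<tau> t) (at t)"
      unfolding \<Xi>_def[abs_def] \<psi>_def F_def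
      by (intro DERIV_diff DERIV_sum DERIV_cmult d\<theta> tilted_expectation_deriv[OF _ t s d c' B])
    also have "(\<Sum>x\<in>J. p * fg x * expectation (\<lambda>\<omega>. \<phi>' (F (ev \<omega>)) / s * (w t x \<omega> * quot_deriv x (ev \<omega>)))) = expectation (\<lambda>\<omega>. \<phi>' (F (ev \<omega>)) / s * stein_kernel t \<omega>)"
    proof -
      have "\<phi>' (F (ev \<omega>)) / s * stein_kernel t \<omega> = (\<Sum>x\<in>J. p * fg x * (\<phi>' (F (ev \<omega>)) / s * (w t x \<omega> * quot_deriv x (ev \<omega>))))" for \<omega>
        unfolding stein_kernel_def sum_distrib_left by (intro sum.cong refl) (simp only: mult_ac)
      moreover have "expectation (\<lambda>\<omega>. \<Sum>x\<in>J. p * fg x * (\<phi>' (F (ev \<omega>)) / s * (w t x \<omega> * quot_deriv x (ev \<omega>))))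
        = (\<Sum>x\<in>J. expectation (\<lambda>\<omega>. p * fg x * (\<phi>' (F (ev \<omega>)) / s * (w t x \<omega> * quot_deriv x (ev \<omega>)))))"
        by (rule Bochner_Integration.integral_sum) (intro Bochner_Integration.integrable_mult_right wdi)
      ultimately show ?thesis by (simp only: integral_mult_right_zero)
    qed
    also have "expectation (\<lambda>\<omega>. \<phi>' (F (ev \<omega>)) / s * stein_kernel t \<omega>) - m1 * \<tau> t = expectation (\<lambda>\<omega>. \<phi>' (F (ev \<omega>)) / s * (stein_kernel t \<omega> - \<tau> t))"
    proof -
      have i: "integrable P (\<lambda>\<omega>. \<phi>' (F (ev \<omega>)) / s * stein_kernel t \<omega>)"
      proof -
        have "\<phi>' (F (ev \<omega>)) / s * stein_kernel t \<omega> = (\<Sum>x\<in>J. p * fg x * (\<phi>' (F (ev \<omega>)) / s * (w t x \<omega> * quot_deriv x (ev \<omega>))))" for \<omega>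
          unfolding stein_kernel_def sum_distrib_left by (intro sum.cong refl) (simp only: mult_ac)
        then show ?thesis by (simp only:) (intro Bochner_Integration.integrable_sum Bochner_Integration.integrable_mult_right wdi)
      qed
      have "expectation (\<lambda>\<omega>. \<phi>' (F (ev \<omega>)) / s * (stein_kernel t \<omega> - \<tau> t)) = expectation (\<lambda>\<omega>. \<phi>' (F (ev \<omega>)) / s * stein_kernel t \<omega> - (\<tau> t / s) * \<phi>' (F (ev \<omega>)))"
        by (intro Bochner_Integration.integral_cong refl) (simp add: algebra_simps)
      also have "\<dots> = expectation (\<lambda>\<omega>. \<phi>' (F (ev \<omega>)) / s * stein_kernel t \<omega>) - (\<tau> t / s) * expectation (\<lambda>\<omega>. \<phi>' (F (ev \<omega>)))"
        by (subst Bochner_Integration.integral_diff[OF i Bochner_Integration.integrable_mult_right[OF \<phi>'i]]) simp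
      finally show ?thesis by (simp add: m1_def)
    qed
    finally show ?thesis .
  qed
  have "norm (\<Xi> 1 - \<Xi> 0) \<le> 2 / s * (kernel_const \<kappa> V * q ^ 3) * norm (1 - 0 :: real)"
  proof (rule field_differentiable_bound[of "{0..1}"])
    fix t :: real assume t: "t \<in> {0..1}"
    show "(\<Xi> has_field_derivative expectation (\<lambda>\<omega>. \<phi>' (F (ev \<omega>)) / s * (stein_kernel t \<omega> - \<tau> t))) (at t within {0..1})"
      by (rule has_field_derivative_at_within, rule d\<Xi>) (use t in auto)
    have "\<bar>expectation (\<lambda>\<omega>. \<phi>' (F (ev \<omega>)) / s * (stein_kernel t \<omega> - \<tau> t))\<bar> \<le> expectation (\<lambda>\<omega>. \<bar>\<phi>' (F (ev \<omega>)) / s * (stein_kernel t \<omega> - \<tau> t)\<bar>)"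
      by (rule integral_abs_bound)
    also have "\<dots> \<le> expectation (\<lambda>\<omega>. 2 / s * \<bar>stein_kernel t \<omega> - \<tau> t\<bar>)"
    proof (rule integral_mono')
      show "integrable P (\<lambda>\<omega>. 2 / s * \<bar>stein_kernel t \<omega> - \<tau> t\<bar>)" using stein_kernel_integrable[of t] by simp
      show "\<bar>\<phi>' (F (ev \<omega>)) / s * (stein_kernel t \<omega> - \<tau> t)\<bar> \<le> 2 / s * \<bar>stein_kernel t \<omega> - \<tau> t\<bar>" for \<omega>
        unfolding abs_mult using B(2) s by (intro mult_right_mono) (auto simp: divide_right_mono)
    qed (use s in auto)
    also have "\<dots> = 2 / s * expectation (\<lambda>\<omega>. \<bar>stein_kernel t \<omega> - \<tau> t\<bar>)" by (rule integral_mult_right_zero)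
    also have "\<dots> \<le> 2 / s * (kernel_const \<kappa> V * q ^ 3)"
      using s t by (intro mult_left_mono stein_kernel_concentration) auto
    finally show "norm (expectation (\<lambda>\<omega>. \<phi>' (F (ev \<omega>)) / s * (stein_kernel t \<omega> - \<tau> t))) \<le> 2 / s * (kernel_const \<kappa> V * q ^ 3)" by simp
  qed auto
  moreover have "\<Xi> 1 - \<Xi> 0 = expectation (\<lambda>\<omega>. fluct fg (ev \<omega>) * \<phi> (F (ev \<omega>))) - m1 * expectation (\<lambda>\<omega>. (fluct fg (ev \<omega>))\<^sup>2)"
  proof -
    have \<phi>Fm: "(\<lambda>u. \<phi> (F u)) \<in> borel_measurable Jborel" by measurable
    have \<psi>0: "\<psi> x 0 = expectation (\<lambda>\<omega>. \<phi> (F (ev \<omega>)))" for x by (simp add: \<psi>_def tilt_0)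
    have \<psi>1: "\<psi> x 1 = expectation (\<lambda>\<omega>. w 1 x \<omega> * \<phi> (F (ev \<omega>)))" if "x \<in> J" for x
      unfolding \<psi>_def by (rule cameron_martin_exp(1)[OF that \<phi>Fm, symmetric])
    have wi: "integrable P (\<lambda>\<omega>. w 1 x \<omega> * \<phi> (F (ev \<omega>)))" if "x \<in> J" for x
      unfolding cameron_martin_exp(2)[OF that \<phi>Fm] by (rule integrable_const_bound[of _ B]) (use B in auto)
    have "expectation (\<lambda>\<omega>. fluct fg (ev \<omega>) * \<phi> (F (ev \<omega>))) = expectation (\<lambda>\<omega>. \<Sum>x\<in>J. p * fg x * (w 1 x \<omega> * \<phi> (F (ev \<omega>)) - \<phi> (F (ev \<omega>))))"
      unfolding fluct_alt sum_distrib_right by (intro Bochner_Integration.integral_cong refl sum.cong) (simp add: ev_eq algebra_simps)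
    also have "\<dots> = (\<Sum>x\<in>J. expectation (\<lambda>\<omega>. p * fg x * (w 1 x \<omega> * \<phi> (F (ev \<omega>)) - \<phi> (F (ev \<omega>)))))"
      by (rule Bochner_Integration.integral_sum) (intro Bochner_Integration.integrable_mult_right Bochner_Integration.integrable_diff wi \<phi>i)
    also have "\<dots> = (\<Sum>x\<in>J. p * fg x * (\<psi> x 1 - \<psi> x 0))"
      by (intro sum.cong refl) (simp only: integral_mult_right_zero Bochner_Integration.integral_diff[OF wi \<phi>i] \<psi>0 \<psi>1)
    finally have 1: "expectation (\<lambda>\<omega>. fluct fg (ev \<omega>) * \<phi> (F (ev \<omega>))) = (\<Sum>x\<in>J. p * fg x * \<psi> x 1) - (\<Sum>x\<in>J. p * fg x * \<psi> x 0)"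
      by (simp only: right_diff_distrib sum_subtractf)
    have "expectation (\<lambda>\<omega>. (fluct fg (ev \<omega>))\<^sup>2) = \<theta> 1" unfolding power2_eq_square fluct_product \<theta>_def by simp
    moreover have "\<theta> 0 = 0" by (simp add: \<theta>_def)
    ultimately show ?thesis unfolding \<Xi>_def 1 by simp
  qed
  ultimately show ?thesis by (simp add: m1_def F_def)
qed

definition remainder :: "'w \<Rightarrow> real" where "remainder \<omega> = avg f (ev \<omega>) * avg g (ev \<omega>) / mass (ev \<omega>)"

lemma remainder_measurable[measurable]: "remainder \<in> borel_measurable P" unfolding remainder_def[abs_def] by measurable

lemma remainder_bound: "\<bar>remainder \<omega>\<bar> \<le> \<kappa>\<^sup>2 * mass (ev \<omega>)"
proof -
  have "\<bar>remainder \<omega>\<bar> = \<bar>avg f (ev \<omega>) / mass (ev \<omega>)\<bar> * \<bar>avg g (ev \<omega>)\<bar>" by (simp add: remainder_def abs_mult)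
  also have "\<dots> \<le> \<kappa> * (\<kappa> * mass (ev \<omega>))"
    using kappa_pos by (intro mult_mono ratio_bound abs_S_ev_le g_bound ev_pos) auto
  finally show ?thesis by (simp add: power2_eq_square)
qed

text \<open>As in \<open>ratio_square_bound\<close>, the two cases depend on whether the mass is at least \<open>1 / 2\<close>.\<close>

lemma remainder_square_bound: "(remainder \<omega>)\<^sup>2 \<le> 2 * fluct f (ev \<omega>) ^ 4 + 2 * fluct g (ev \<omega>) ^ 4 + 4 * \<kappa> ^ 4 * fluct (\<lambda>_. 1) (ev \<omega>) ^ 4"
proof (cases "1 / 2 \<le> mass (ev \<omega>)")
  case True
  let ?m = "mass (ev \<omega>)" and ?A = "avg f (ev \<omega>)" and ?B = "avg g (ev \<omega>)"
  have "(1 / 2)\<^sup>2 \<le> ?m\<^sup>2" using True by (intro power_mono) auto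
  then have "(?A * ?B)\<^sup>2 * 1 \<le> (?A * ?B)\<^sup>2 * (4 * ?m\<^sup>2)" by (intro mult_left_mono) (auto simp: power2_eq_square)
  then have "(remainder \<omega>)\<^sup>2 \<le> 4 * (?A\<^sup>2 * ?B\<^sup>2)"
    using mass_ev_pos[of \<omega>] by (simp add: remainder_def power_divide divide_le_eq power_mult_distrib mult_ac)
  also have "\<dots> \<le> 2 * ?A ^ 4 + 2 * ?B ^ 4"
    using sum_squares_bound[of "?A\<^sup>2" "?B\<^sup>2"] by (simp add: power_mult[symmetric])
  finally show ?thesis unfolding fluct_f fluct_g by (simp add: add_increasing2)
next
  case False
  let ?m = "mass (ev \<omega>)"
  have m: "0 < ?m" by (rule mass_ev_pos)
  have "(1 / 2) ^ 4 \<le> (1 - ?m) ^ 4" using False by (intro power_mono) auto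
  then have "1 \<le> 16 * fluct (\<lambda>_. 1) (ev \<omega>) ^ 4" unfolding fluct_one by (simp add: power_divide power4_eq_xxxx algebra_simps)
  then have X1: "\<kappa> ^ 4 * 1 \<le> \<kappa> ^ 4 * (16 * fluct (\<lambda>_. 1) (ev \<omega>) ^ 4)" by (intro mult_left_mono) auto
  have "\<bar>remainder \<omega>\<bar> \<le> \<kappa>\<^sup>2 * (1 / 2)" using remainder_bound[of \<omega>] False by (meson less_imp_le mult_left_mono not_le order_trans zero_le_power2)
  then have "\<bar>remainder \<omega>\<bar>\<^sup>2 \<le> (\<kappa>\<^sup>2 * (1 / 2))\<^sup>2" by (intro power_mono) auto
  then have "(remainder \<omega>)\<^sup>2 \<le> \<kappa> ^ 4 / 4" by (simp add: power_mult_distrib power_mult[symmetric] power_divide)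
  moreover have "0 \<le> 2 * fluct f (ev \<omega>) ^ 4 + 2 * fluct g (ev \<omega>) ^ 4" by simp
  ultimately show ?thesis using X1 by linarith
qed

lemma remainder_second_moment:
  assumes hb: "\<eta> \<le> hb"
  shows "expectation (\<lambda>\<omega>. (remainder \<omega>)\<^sup>2) \<le> remainder_const \<kappa> V hb * q ^ 4"
proof -
  have i: "integrable P (\<lambda>\<omega>. fluct f (ev \<omega>) ^ 4)" "integrable P (\<lambda>\<omega>. fluct g (ev \<omega>) ^ 4)" "integrable P (\<lambda>\<omega>. fluct (\<lambda>_. 1) (ev \<omega>) ^ 4)"
    by (rule fluct_power_integrable, erule f_bound g_bound, simp)+ (rule fluct_power_integrable[where H=1], auto)
  have "expectation (\<lambda>\<omega>. (remainder \<omega>)\<^sup>2) \<le> expectation (\<lambda>\<omega>. 2 * fluct f (ev \<omega>) ^ 4 + 2 * fluct g (ev \<omega>) ^ 4 + 4 * \<kappa> ^ 4 * fluct (\<lambda>_. 1) (ev \<omega>) ^ 4)"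
    by (rule integral_mono') (use i remainder_square_bound in auto)
  also have "\<dots> = 2 * expectation (\<lambda>\<omega>. fluct f (ev \<omega>) ^ 4) + 2 * expectation (\<lambda>\<omega>. fluct g (ev \<omega>) ^ 4) + 4 * \<kappa> ^ 4 * expectation (\<lambda>\<omega>. fluct (\<lambda>_. 1) (ev \<omega>) ^ 4)"
    using i by simp
  also have "\<dots> \<le> 2 * (21 * \<kappa> ^ 4 * exp V ^ 6 * (1 + \<eta>) * \<eta>\<^sup>2) + 2 * (21 * \<kappa> ^ 4 * exp V ^ 6 * (1 + \<eta>) * \<eta>\<^sup>2)
      + 4 * \<kappa> ^ 4 * (21 * 1 ^ 4 * exp V ^ 6 * (1 + \<eta>) * \<eta>\<^sup>2)"
    using kappa_pos by (intro add_mono mult_left_mono fluct_fourth_moment f_bound g_bound) auto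
  also have "\<dots> = 168 * \<kappa> ^ 4 * exp V ^ 6 * \<eta>\<^sup>2 * (1 + \<eta>)" by simp
  also have "\<dots> \<le> 168 * \<kappa> ^ 4 * exp V ^ 6 * \<eta>\<^sup>2 * (1 + hb)" using hb by (intro mult_left_mono) auto
  also have "\<dots> = remainder_const \<kappa> V hb * q ^ 4" by (simp add: remainder_const_def eta_q power_mult[symmetric])
  finally show ?thesis .
qed

lemma quot_power_integrable: "n \<le> 4 \<Longrightarrow> integrable P (\<lambda>\<omega>. quot (ev \<omega>) ^ n)"
proof (rule integrable_poly_mass[where C="(2 * \<kappa>\<^sup>2) ^ n"])
  fix \<omega>
  have "\<bar>quot (ev \<omega>) ^ n\<bar> \<le> (2 * \<kappa>\<^sup>2 * (1 + mass (ev \<omega>))) ^ n"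
    unfolding power_abs by (intro power_mono order_trans[OF quot_bound]) (auto simp: distrib_left)
  then show "\<bar>quot (ev \<omega>) ^ n\<bar> \<le> (2 * \<kappa>\<^sup>2) ^ n * (1 + mass (ev \<omega>)) ^ n" by (simp only: power_mult_distrib)
qed auto

lemma quot_fourth_moment: "expectation (\<lambda>\<omega>. quot (ev \<omega>) ^ 4) \<le> 16 * \<kappa> ^ 8 * exp (6 * V)"
proof -
  have "expectation (\<lambda>\<omega>. quot (ev \<omega>) ^ 4) \<le> expectation (\<lambda>\<omega>. 16 * \<kappa> ^ 8 * mass (ev \<omega>) ^ 4)"
  proof (rule integral_mono')
    show "integrable P (\<lambda>\<omega>. 16 * \<kappa> ^ 8 * mass (ev \<omega>) ^ 4)" using mass_power4_integrable by simp
    fix \<omega>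
    have "\<bar>quot (ev \<omega>)\<bar> ^ 4 \<le> (2 * \<kappa>\<^sup>2 * mass (ev \<omega>)) ^ 4" by (intro power_mono quot_bound) auto
    then show "quot (ev \<omega>) ^ 4 \<le> 16 * \<kappa> ^ 8 * mass (ev \<omega>) ^ 4"
      by (simp add: power_mult_distrib power_mult[symmetric])
  qed (auto intro!: mult_nonneg_nonneg)
  also have "\<dots> \<le> 16 * \<kappa> ^ 8 * exp (6 * V)"
    unfolding integral_mult_right_zero by (intro mult_left_mono mass_power4_expectation) auto
  finally show ?thesis .
qed

text \<open>The functional is its linear part minus the remainder. The linear part contributes through \<open>stein_linear_part\<close>, the remainder
through its first absolute moment of order \<open>q\<^sup>2\<close>, and the variance of the linear part may be replaced by \<open>s\<^sup>2\<close> up to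
\<open>q ^ 3\<close>. Since \<open>s\<close> is at most of order \<open>q\<close>, all three terms are of order \<open>q ^ 3 / s\<^sup>2\<close>.\<close>

lemma stein_discrepancy:
  fixes \<phi> \<phi>' :: "real \<Rightarrow> real"
  defines "\<mu> \<equiv> expectation (\<lambda>\<omega>. quot (ev \<omega>))"
  assumes s: "0 < s" and s2: "s\<^sup>2 = expectation (\<lambda>\<omega>. (quot (ev \<omega>) - \<mu>)\<^sup>2)"
    and hb: "\<eta> \<le> hb"
    and d: "\<And>z. (\<phi> has_real_derivative \<phi>' z) (at z)" and c': "continuous_on UNIV \<phi>'"
    and B: "\<And>z. \<bar>\<phi> z\<bar> \<le> B" "\<And>z. \<bar>\<phi>' z\<bar> \<le> 2"
  shows "\<bar>expectation (\<lambda>\<omega>. \<phi>' ((quot (ev \<omega>) - \<mu>) / s) - (quot (ev \<omega>) - \<mu>) / s * \<phi> ((quot (ev \<omega>) - \<mu>) / s))\<bar>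
     \<le> stein_const \<kappa> V hb B * q ^ 3 / s\<^sup>2"
proof -
  have [measurable]: "\<phi>' \<in> borel_measurable borel" using c' by (rule borel_measurable_continuous_onI)
  have "continuous_on UNIV \<phi>" using d by (intro DERIV_continuous_on) (auto intro: has_field_derivative_at_within)
  then have [measurable]: "\<phi> \<in> borel_measurable borel" by (rule borel_measurable_continuous_onI)
  define F where "F \<omega> = (quot (ev \<omega>) - \<mu>) / s" for \<omega>
  have [measurable]: "F \<in> borel_measurable P" unfolding F_def by measurable
  define L where "L \<omega> = fluct fg (ev \<omega>)" for \<omega>
  define r where "r \<omega> = remainder \<omega> - expectation remainder" for \<omega>
  have [measurable]: "L \<in> borel_measurable P" "r \<in> borel_measurable P" unfolding L_def r_def by measurable
  define C2 where "C2 = remainder_const \<kappa> V hb"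
  have b0: "0 \<le> hb" using hb eta_pos by simp
  have C20: "0 \<le> C2" unfolding C2_def remainder_const_def using b0 by (intro mult_nonneg_nonneg) auto
  have Ri: "integrable P remainder"
    by (rule integrable_poly_mass[where C="\<kappa>\<^sup>2" and n=1]) (auto simp: distrib_left intro!: order_trans[OF remainder_bound])
  have R2i: "integrable P (\<lambda>\<omega>. (remainder \<omega>)\<^sup>2)"
  proof (rule integrable_poly_mass[where C="(\<kappa>\<^sup>2)\<^sup>2" and n=2])
    fix \<omega>
    have "\<bar>remainder \<omega>\<bar> \<le> \<kappa>\<^sup>2 * (1 + mass (ev \<omega>))" using remainder_bound[of \<omega>] zero_le_power2[of \<kappa>] unfolding distrib_left by linarith
    then have "\<bar>remainder \<omega>\<bar>\<^sup>2 \<le> (\<kappa>\<^sup>2 * (1 + mass (ev \<omega>)))\<^sup>2" by (intro power_mono) auto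
    then show "\<bar>(remainder \<omega>)\<^sup>2\<bar> \<le> (\<kappa>\<^sup>2)\<^sup>2 * (1 + mass (ev \<omega>))\<^sup>2" unfolding power_abs power_mult_distrib .
  qed auto
  have Li: "integrable P L" unfolding L_def[abs_def] using fluct_power_integrable[where n=1 and h=fg and H="\<kappa>\<^sup>2", OF fg_bound] by simp
  have L2i: "integrable P (\<lambda>\<omega>. (L \<omega>)\<^sup>2)" unfolding L_def using fluct_power_integrable[where n=2 and h=fg and H="\<kappa>\<^sup>2", OF fg_bound] by simp
  have ri: "integrable P r" unfolding r_def[abs_def] using Ri by simp
  have r2i: "integrable P (\<lambda>\<omega>. (r \<omega>)\<^sup>2)" unfolding r_def using Ri R2i by (simp add: power2_diff)
  have r2: "expectation (\<lambda>\<omega>. (r \<omega>)\<^sup>2) \<le> C2 * q ^ 4"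
  proof -
    have "expectation (\<lambda>\<omega>. (r \<omega>)\<^sup>2) = expectation (\<lambda>\<omega>. (remainder \<omega>)\<^sup>2) - (expectation remainder)\<^sup>2"
      unfolding r_def by (rule variance_eq[OF Ri R2i])
    then show ?thesis using remainder_second_moment[OF hb] zero_le_power2[of "expectation remainder"] unfolding C2_def by linarith
  qed
  have L2: "expectation (\<lambda>\<omega>. (L \<omega>)\<^sup>2) \<le> \<kappa> ^ 4 * exp V * q\<^sup>2"
    using fluct_second_moment[of fg "\<kappa>\<^sup>2", OF fg_bound] by (simp add: L_def eta_q power_mult[symmetric])
  have QL: "quot (ev \<omega>) = L \<omega> + avg fg (\<lambda>_. 1) - remainder \<omega>" for \<omega> by (simp add: quot_def L_def fluct_def remainder_def)
  have EL: "expectation L = 0"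
  proof -
    have "integrable P (\<lambda>\<omega>. L \<omega> + avg fg (\<lambda>_. 1))" using Li by simp
    then have "integrable P (\<lambda>\<omega>. avg fg (ev \<omega>))" by (simp add: L_def fluct_def)
    then show ?thesis using avg_expectation[of fg] by (simp add: L_def[abs_def] fluct_def prob_space)
  qed
  have \<mu>: "\<mu> = avg fg (\<lambda>_. 1) - expectation remainder" unfolding \<mu>_def QL using Li Ri EL by (simp add: prob_space)
  have FL: "quot (ev \<omega>) - \<mu> = L \<omega> - r \<omega>" for \<omega> by (simp add: QL \<mu> r_def)
  define Lr where "Lr = expectation (\<lambda>\<omega>. (L \<omega>)\<^sup>2)"
  have LRi: "integrable P (\<lambda>\<omega>. L \<omega> * r \<omega>)"
  proof (rule Bochner_Integration.integrable_bound[of P "\<lambda>\<omega>. (L \<omega>)\<^sup>2 + (r \<omega>)\<^sup>2"])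
    show "AE \<omega> in P. norm (L \<omega> * r \<omega>) \<le> norm ((L \<omega>)\<^sup>2 + (r \<omega>)\<^sup>2)"
    proof (rule AE_I2)
      fix \<omega>
      have "2 * (\<bar>L \<omega>\<bar> * \<bar>r \<omega>\<bar>) \<le> (L \<omega>)\<^sup>2 + (r \<omega>)\<^sup>2" using sum_squares_bound[of "\<bar>L \<omega>\<bar>" "\<bar>r \<omega>\<bar>"] by simp
      moreover have "0 \<le> \<bar>L \<omega>\<bar> * \<bar>r \<omega>\<bar>" by simp
      ultimately have "\<bar>L \<omega>\<bar> * \<bar>r \<omega>\<bar> \<le> (L \<omega>)\<^sup>2 + (r \<omega>)\<^sup>2" by linarith
      then show "norm (L \<omega> * r \<omega>) \<le> norm ((L \<omega>)\<^sup>2 + (r \<omega>)\<^sup>2)" by (simp add: abs_mult)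
    qed
  qed (use L2i r2i in simp_all)
  have s2': "s\<^sup>2 = Lr - 2 * expectation (\<lambda>\<omega>. L \<omega> * r \<omega>) + expectation (\<lambda>\<omega>. (r \<omega>)\<^sup>2)"
    unfolding s2 FL power2_diff Lr_def using L2i r2i LRi by (simp add: mult.assoc)
  have q3: "0 < q ^ 3" using q_pos by simp
  have cross: "\<bar>2 * expectation (\<lambda>\<omega>. L \<omega> * r \<omega>)\<bar> \<le> (\<kappa> ^ 4 * exp V + C2) * q ^ 3"
  proof -
    have "\<bar>2 * expectation (\<lambda>\<omega>. L \<omega> * r \<omega>)\<bar> = \<bar>expectation (\<lambda>\<omega>. 2 * (L \<omega> * r \<omega>))\<bar>" by simp
    also have "\<dots> \<le> expectation (\<lambda>\<omega>. \<bar>2 * (L \<omega> * r \<omega>)\<bar>)" by (rule integral_abs_bound)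
    also have "\<dots> \<le> expectation (\<lambda>\<omega>. q * (L \<omega>)\<^sup>2 + 1 / q * (r \<omega>)\<^sup>2)"
    proof (rule integral_mono)
      fix \<omega>
      show "\<bar>2 * (L \<omega> * r \<omega>)\<bar> \<le> q * (L \<omega>)\<^sup>2 + 1 / q * (r \<omega>)\<^sup>2"
        using weighted_AM_GM[OF q_pos, of "\<bar>L \<omega>\<bar>" "\<bar>r \<omega>\<bar>"] by (simp add: abs_mult)
    qed (use LRi L2i r2i in auto)
    also have "\<dots> = q * Lr + 1 / q * expectation (\<lambda>\<omega>. (r \<omega>)\<^sup>2)" unfolding Lr_def using L2i r2i by simp
    also have "\<dots> \<le> q * (\<kappa> ^ 4 * exp V * q\<^sup>2) + 1 / q * (C2 * q ^ 4)"
      unfolding Lr_def using q_pos by (intro add_mono mult_left_mono L2 r2) auto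
    also have "\<dots> = (\<kappa> ^ 4 * exp V + C2) * q ^ 3" using q_pos by (simp add: eval_nat_numeral algebra_simps)
    finally show ?thesis .
  qed
  \<comment> \<open>needed to lower the fourth power of \<open>q\<close> in \<open>r2\<close> to a third power\<close>
  have q1: "q \<le> 1 + hb"
  proof -
    have "q\<^sup>2 \<le> hb" using hb eta_q by simp
    also have "hb \<le> (1 + hb)\<^sup>2" using b0 by (simp add: power2_eq_square algebra_simps)
    finally show ?thesis by (rule power2_le_imp_le) (use b0 in simp)
  qed
  have var_diff: "\<bar>s\<^sup>2 - Lr\<bar> \<le> (C2 * (2 + hb) + \<kappa> ^ 4 * exp V) * q ^ 3"
  proof -
    have "expectation (\<lambda>\<omega>. (r \<omega>)\<^sup>2) \<le> C2 * q ^ 4" by (rule r2)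
    also have "\<dots> = C2 * (q * q ^ 3)" by (simp add: eval_nat_numeral)
    also have "\<dots> \<le> C2 * ((1 + hb) * q ^ 3)" using q1 q3 C20 by (intro mult_left_mono mult_right_mono) auto
    finally have "expectation (\<lambda>\<omega>. (r \<omega>)\<^sup>2) \<le> C2 * ((1 + hb) * q ^ 3)" .
    moreover have "0 \<le> expectation (\<lambda>\<omega>. (r \<omega>)\<^sup>2)" by simp
    ultimately have "\<bar>s\<^sup>2 - Lr\<bar> \<le> (\<kappa> ^ 4 * exp V + C2) * q ^ 3 + C2 * ((1 + hb) * q ^ 3)"
      using cross unfolding s2' by linarith
    then show ?thesis by (simp add: algebra_simps)
  qed
  define C4 where "C4 = 1 + 2 * (\<kappa> ^ 4 * exp V + C2 * hb)"
  have C41: "1 \<le> C4" unfolding C4_def using C20 b0 by simp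
  \<comment> \<open>needed to turn the contribution \<open>q\<^sup>2 / s\<close> of the remainder into \<open>q ^ 3 / s\<^sup>2\<close>\<close>
  have s_le: "s \<le> C4 * q"
  proof -
    have "s\<^sup>2 \<le> expectation (\<lambda>\<omega>. 2 * (L \<omega>)\<^sup>2 + 2 * (r \<omega>)\<^sup>2)"
      unfolding s2 FL
    proof (rule integral_mono')
      fix \<omega> show "(L \<omega> - r \<omega>)\<^sup>2 \<le> 2 * (L \<omega>)\<^sup>2 + 2 * (r \<omega>)\<^sup>2"
        using zero_le_power2[of "L \<omega> + r \<omega>"] by (simp add: power2_sum power2_diff)
    qed (use L2i r2i in auto)
    also have "\<dots> = 2 * Lr + 2 * expectation (\<lambda>\<omega>. (r \<omega>)\<^sup>2)" unfolding Lr_def using L2i r2i by simp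
    also have "\<dots> \<le> 2 * (\<kappa> ^ 4 * exp V * q\<^sup>2) + 2 * (C2 * q ^ 4)"
      unfolding Lr_def by (intro add_mono mult_left_mono L2 r2) auto
    also have "q ^ 4 = q\<^sup>2 * q\<^sup>2" by simp
    also have "C2 * (q\<^sup>2 * q\<^sup>2) \<le> C2 * (hb * q\<^sup>2)" using hb eta_q C20 by (intro mult_left_mono mult_right_mono) auto
    finally have "s\<^sup>2 \<le> 2 * (\<kappa> ^ 4 * exp V * q\<^sup>2) + 2 * (C2 * (hb * q\<^sup>2))" by simp
    also have "\<dots> \<le> C4 * q\<^sup>2" unfolding C4_def by (simp add: algebra_simps)
    also have "\<dots> \<le> (C4 * C4) * q\<^sup>2" using C41 by (intro mult_right_mono) (auto simp: mult_le_cancel_left1)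
    finally have "s\<^sup>2 \<le> (C4 * q)\<^sup>2" by (simp add: power2_eq_square mult_ac)
    then show ?thesis by (rule power2_le_imp_le) (use C41 q_pos in simp)
  qed
  have Er: "expectation (\<lambda>\<omega>. \<bar>r \<omega>\<bar>) \<le> (1 + C2) / 2 * q\<^sup>2"
  proof -
    have "expectation (\<lambda>\<omega>. \<bar>r \<omega>\<bar>) \<le> expectation (\<lambda>\<omega>. q\<^sup>2 / 2 + 1 / (2 * q\<^sup>2) * (r \<omega>)\<^sup>2)"
    proof (rule integral_mono)
      fix \<omega>
      show "\<bar>r \<omega>\<bar> \<le> q\<^sup>2 / 2 + 1 / (2 * q\<^sup>2) * (r \<omega>)\<^sup>2"
        using weighted_AM_GM[of "q\<^sup>2" 1 "\<bar>r \<omega>\<bar>"] q_pos by simp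
    qed (use ri r2i in auto)
    also have "\<dots> = q\<^sup>2 / 2 + 1 / (2 * q\<^sup>2) * expectation (\<lambda>\<omega>. (r \<omega>)\<^sup>2)" using r2i by (simp add: prob_space)
    also have "\<dots> \<le> q\<^sup>2 / 2 + 1 / (2 * q\<^sup>2) * (C2 * q ^ 4)" by (intro add_mono mult_left_mono r2) auto
    also have "\<dots> = (1 + C2) / 2 * q\<^sup>2" using q_pos by (simp add: eval_nat_numeral field_simps)
    finally show ?thesis .
  qed
  have B0: "0 \<le> B" using B(1)[of 0] by linarith
  have \<phi>Fi: "integrable P (\<lambda>\<omega>. \<phi> (F \<omega>))" by (rule integrable_const_bound[of _ B]) (use B in auto)
  have \<phi>'Fi: "integrable P (\<lambda>\<omega>. \<phi>' (F \<omega>))" by (rule integrable_const_bound[of _ 2]) (use B in auto)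
  have bi: "integrable P (\<lambda>\<omega>. Y \<omega> * \<phi> (F \<omega>))" if "integrable P Y" for Y
  proof (rule Bochner_Integration.integrable_bound[OF Bochner_Integration.integrable_mult_right[OF that, of B]])
    show "(\<lambda>\<omega>. Y \<omega> * \<phi> (F \<omega>)) \<in> borel_measurable P" using borel_measurable_integrable[OF that] by measurable
    show "AE \<omega> in P. norm (Y \<omega> * \<phi> (F \<omega>)) \<le> norm (B * Y \<omega>)"
      using B(1) B0 by (auto simp: abs_mult mult.commute[of "\<bar>Y _\<bar>"] intro!: AE_I2 mult_right_mono)
  qed
  define E' where "E' = expectation (\<lambda>\<omega>. \<phi>' (F \<omega>))"
  have E'2: "\<bar>E'\<bar> \<le> 2"
  proof -
    have "\<bar>E'\<bar> \<le> expectation (\<lambda>\<omega>. \<bar>\<phi>' (F \<omega>)\<bar>)" unfolding E'_def by (rule integral_abs_bound)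
    also have "\<dots> \<le> 2" using \<phi>'Fi B(2) by (intro integral_le_const) auto
    finally show ?thesis .
  qed
  define A1 where "A1 = expectation (\<lambda>\<omega>. L \<omega> * \<phi> (F \<omega>))"
  define A2 where "A2 = expectation (\<lambda>\<omega>. r \<omega> * \<phi> (F \<omega>))"
  have A1: "\<bar>A1 - E' / s * Lr\<bar> \<le> 2 / s * (kernel_const \<kappa> V * q ^ 3)"
    using stein_linear_part[OF s d c' B, of \<mu>] by (simp add: A1_def E'_def Lr_def L_def F_def)
  have A2: "\<bar>A2\<bar> \<le> B * ((1 + C2) / 2 * q\<^sup>2)"
  proof -
    have "\<bar>A2\<bar> \<le> expectation (\<lambda>\<omega>. \<bar>r \<omega> * \<phi> (F \<omega>)\<bar>)" unfolding A2_def by (rule integral_abs_bound)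
    also have "\<dots> \<le> expectation (\<lambda>\<omega>. B * \<bar>r \<omega>\<bar>)"
      using B(1) B0 ri by (intro integral_mono') (auto simp: abs_mult mult.commute[of "\<bar>r _\<bar>"] intro!: mult_right_mono)
    also have "\<dots> = B * expectation (\<lambda>\<omega>. \<bar>r \<omega>\<bar>)" by simp
    also have "\<dots> \<le> B * ((1 + C2) / 2 * q\<^sup>2)" using B0 Er by (intro mult_left_mono)
    finally show ?thesis .
  qed
  have main: "expectation (\<lambda>\<omega>. \<phi>' (F \<omega>) - F \<omega> * \<phi> (F \<omega>)) = E' - (A1 - A2) / s"
  proof -
    have eq: "F \<omega> * \<phi> (F \<omega>) = (1 / s) * (L \<omega> * \<phi> (F \<omega>) - r \<omega> * \<phi> (F \<omega>))" for \<omega>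
      by (simp add: F_def FL algebra_simps diff_divide_distrib)
    have i: "integrable P (\<lambda>\<omega>. (1 / s) * (L \<omega> * \<phi> (F \<omega>) - r \<omega> * \<phi> (F \<omega>)))"
      by (intro Bochner_Integration.integrable_mult_right Bochner_Integration.integrable_diff bi Li ri)
    show ?thesis unfolding eq
      by (subst Bochner_Integration.integral_diff[OF \<phi>'Fi i])
         (simp only: integral_mult_right_zero Bochner_Integration.integral_diff[OF bi[OF Li] bi[OF ri]] E'_def A1_def A2_def, simp)
  qed
  have "E' - (A1 - A2) / s = E' * (s\<^sup>2 - Lr) / s\<^sup>2 - (A1 - E' / s * Lr) / s + A2 / s"
    using s by (simp add: field_simps power2_eq_square)
  then have "\<bar>E' - (A1 - A2) / s\<bar> \<le> \<bar>E' * (s\<^sup>2 - Lr) / s\<^sup>2\<bar> + \<bar>(A1 - E' / s * Lr) / s\<bar> + \<bar>A2 / s\<bar>" by linarith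
  also have "\<dots> \<le> 2 * (C2 * (2 + hb) + \<kappa> ^ 4 * exp V) * q ^ 3 / s\<^sup>2 + 2 * kernel_const \<kappa> V * q ^ 3 / s\<^sup>2
      + B * ((1 + C2) / 2) * C4 * q ^ 3 / s\<^sup>2"
  proof (intro add_mono)
    have "\<bar>E' * (s\<^sup>2 - Lr)\<bar> \<le> 2 * ((C2 * (2 + hb) + \<kappa> ^ 4 * exp V) * q ^ 3)"
      unfolding abs_mult by (intro mult_mono E'2 var_diff) auto
    then show "\<bar>E' * (s\<^sup>2 - Lr) / s\<^sup>2\<bar> \<le> 2 * (C2 * (2 + hb) + \<kappa> ^ 4 * exp V) * q ^ 3 / s\<^sup>2"
      unfolding abs_divide abs_power2 mult.assoc by (rule divide_right_mono) simp
    have "\<bar>A1 - E' / s * Lr\<bar> / s \<le> 2 / s * (kernel_const \<kappa> V * q ^ 3) / s" using A1 s by (intro divide_right_mono) auto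
    then show "\<bar>(A1 - E' / s * Lr) / s\<bar> \<le> 2 * kernel_const \<kappa> V * q ^ 3 / s\<^sup>2"
      using s by (simp add: power2_eq_square)
    have "\<bar>A2 / s\<bar> = \<bar>A2\<bar> * s / s\<^sup>2" using s by (simp add: power2_eq_square)
    also have "\<dots> \<le> (B * ((1 + C2) / 2 * q\<^sup>2)) * (C4 * q) / s\<^sup>2"
      using A2 s_le s B0 C20 by (intro divide_right_mono mult_mono) auto
    finally show "\<bar>A2 / s\<bar> \<le> B * ((1 + C2) / 2) * C4 * q ^ 3 / s\<^sup>2" by (simp add: eval_nat_numeral mult_ac)
  qed
  also have "\<dots> = stein_const \<kappa> V hb B * q ^ 3 / s\<^sup>2"
    unfolding stein_const_def C2_def[symmetric] C4_def[symmetric] by (simp only: distrib_right add_divide_distrib)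
  finally show ?thesis using main by (simp add: F_def)
qed

end

section \<open>Stein equation and total variation distance\<close>

abbreviation (input) "std_normal \<equiv> std_normal_density"

lemma std_normal_minus: "std_normal (- x) = std_normal x"
  by (simp add: std_normal_density_def)

lemma std_normal_deriv: "(std_normal has_real_derivative (- x * std_normal x)) (at x)"
proof -
  have "((\<lambda>x::real. exp (- x\<^sup>2 / 2)) has_real_derivative - x * exp (- x\<^sup>2 / 2)) (at x)"
    by (auto intro!: derivative_eq_intros)
  from DERIV_cmult[OF this, of "1 / sqrt (2 * pi)"] show ?thesis
    unfolding std_normal_density_def[abs_def] by (simp add: mult_ac)
qed

lemma std_normal_antimono: "\<bar>x\<bar> \<le> \<bar>y\<bar> \<Longrightarrow> std_normal y \<le> std_normal x"
  by (auto simp: std_normal_density_def abs_le_square_iff intro!: divide_right_mono)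

text \<open>On \<open>{y..}\<close> the density is at most \<open>t / y\<close> times itself, and \<open>t * std_normal t\<close> has the primitive \<open>- std_normal\<close>.\<close>

lemma normal_tail_bound:
  assumes y: "0 < y"
  shows "y * (\<integral>t. indicator {y..} t * std_normal t \<partial>lborel) \<le> std_normal y"
proof -
  have "((\<lambda>x. - std_normal x) \<longlongrightarrow> - 0) at_top"
  proof (rule tendsto_minus)
    have "((\<lambda>x::real. exp (- x\<^sup>2 / 2)) \<longlongrightarrow> 0) at_top"
    proof (rule filterlim_compose[OF exp_at_bot])
      have "filterlim (\<lambda>x::real. (1/2) * x\<^sup>2) at_top at_top"
        by (intro filterlim_tendsto_pos_mult_at_top[OF tendsto_const] filterlim_pow_at_top filterlim_ident) auto
      then show "filterlim (\<lambda>x::real. - x\<^sup>2 / 2) at_bot at_top"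
        by (simp add: filterlim_uminus_at_bot)
    qed
    then have "((\<lambda>x::real. (1 / sqrt (2 * pi)) * exp (- x\<^sup>2 / 2)) \<longlongrightarrow> (1 / sqrt (2 * pi)) * 0) at_top"
      by (intro tendsto_mult tendsto_const)
    then show "(std_normal \<longlongrightarrow> 0) at_top" unfolding std_normal_density_def[abs_def] by simp
  qed
  then have nn: "(\<integral>\<^sup>+t. ennreal (t * std_normal t) * indicator {y..} t \<partial>lborel) = ennreal (- 0 - - std_normal y)"
    using y by (intro nn_integral_FTC_atLeast[where F="\<lambda>x. - std_normal x"])
       (auto intro!: derivative_eq_intros std_normal_deriv)
  have eq: "(\<lambda>t. ennreal (indicator {y..} t * (t * std_normal t))) = (\<lambda>t. ennreal (t * std_normal t) * indicator {y..} t)"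
    by (auto simp: fun_eq_iff indicator_def)
  have nn': "(\<integral>\<^sup>+t. ennreal (indicator {y..} t * (t * std_normal t)) \<partial>lborel) = ennreal (std_normal y)"
    using nn unfolding eq by simp
  have pos: "AE t in lborel. 0 \<le> indicator {y..} t * (t * std_normal t)" using y by (auto simp: indicator_def)
  have i: "integrable lborel (\<lambda>t. indicator {y..} t * (t * std_normal t))"
    by (rule integrableI_nonneg[OF _ pos]) (auto simp: nn')
  have v: "(\<integral>t. indicator {y..} t * (t * std_normal t) \<partial>lborel) = std_normal y"
    by (subst integral_eq_nn_integral[OF _ pos]) (auto simp: nn')
  have i2: "integrable lborel (\<lambda>t. indicator {y..} t * std_normal t)"
    by (rule Bochner_Integration.integrable_bound[OF integrable_normal_density[of 1 0]]) (auto simp: indicator_def)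
  have "y * (\<integral>t. indicator {y..} t * std_normal t \<partial>lborel) = (\<integral>t. y * (indicator {y..} t * std_normal t) \<partial>lborel)"
    by simp
  also have "\<dots> \<le> (\<integral>t. indicator {y..} t * (t * std_normal t) \<partial>lborel)"
    by (intro integral_mono i Bochner_Integration.integrable_mult_right i2) (auto simp: indicator_def intro!: mult_right_mono)
  finally show ?thesis by (simp add: v)
qed

text \<open>The solution is the primitive \<open>A\<close> of the centered \<open>h\<close> against the Gaussian density, divided by that density.
Since \<open>A\<close> vanishes at both ends of the line, it is bounded by the tail on the side of \<open>x\<close>, and \<open>normal_tail_bound\<close> gives the bound \<open>1\<close> on
\<open>x * \<phi> x\<close>. The constant in the bound on \<open>\<phi>\<close> comes from the interval \<open>[-1, 1]\<close>, where the density is smallest at the ends.\<close>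

lemma stein_solution:
  fixes h :: "real \<Rightarrow> real"
  assumes h: "continuous_on UNIV h" "\<And>x. 0 \<le> h x" "\<And>x. h x \<le> 1"
  obtains \<phi> \<phi>' where
    "\<And>x. (\<phi> has_real_derivative \<phi>' x) (at x)" "continuous_on UNIV \<phi>'"
    "\<And>x. \<phi>' x - x * \<phi> x = h x - (\<integral>z. h z \<partial>std_normal_distribution)"
    "\<And>x. \<bar>\<phi> x\<bar> \<le> 1 / std_normal 1" "\<And>x. \<bar>\<phi>' x\<bar> \<le> 2"
proof -
  interpret N: prob_space std_normal_distribution by (rule prob_space_normal_density) simp
  have [measurable]: "h \<in> borel_measurable borel" using h(1) by (rule borel_measurable_continuous_onI)
  define m where "m = (\<integral>z. h z \<partial>std_normal_distribution)"
  define k where "k x = h x - m" for x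
  have ih: "integrable std_normal_distribution h"
    by (rule N.integrable_const_bound[of _ 1]) (use h in auto)
  have m: "0 \<le> m" "m \<le> 1"
    unfolding m_def using h by (auto intro!: integral_nonneg N.integral_le_const[OF ih])
  have k1: "\<bar>k x\<bar> \<le> 1" for x using h(2)[of x] h(3)[of x] m by (auto simp: k_def)
  have [measurable]: "k \<in> borel_measurable borel" unfolding k_def by measurable
  have kc: "continuous_on UNIV k" unfolding k_def by (intro continuous_intros h)
  have nc: "continuous_on S std_normal" for S
    unfolding std_normal_density_def[abs_def] by (intro continuous_intros) auto
  have in0: "integrable lborel std_normal" by simp
  have ikn: "integrable lborel (\<lambda>t. k t * std_normal t)"
    by (rule Bochner_Integration.integrable_bound[OF in0]) (use k1 in \<open>auto simp: abs_mult intro!: mult_left_le_one_le\<close>)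
  have iS: "integrable lborel (\<lambda>t. indicator S t * (k t * std_normal t))" if "S \<in> sets borel" for S
    by (rule Bochner_Integration.integrable_bound[OF ikn]) (use that in \<open>auto simp: indicator_def\<close>)
  have nS: "integrable lborel (\<lambda>t. indicator S t * std_normal t)" if "S \<in> sets borel" for S
    by (rule Bochner_Integration.integrable_bound[OF in0]) (use that in \<open>auto simp: indicator_def\<close>)
  have zero: "(\<integral>t. k t * std_normal t \<partial>lborel) = 0"
  proof -
    have "(\<integral>t. k t * std_normal t \<partial>lborel) = (\<integral>t. k t \<partial>std_normal_distribution)"
      by (subst integral_density) (auto simp: mult.commute)
    also have "\<dots> = 0" unfolding k_def using ih N.prob_space by (simp add: m_def)
    finally show ?thesis .
  qed
  have bnd: "\<bar>\<integral>t. indicator S t * (k t * std_normal t) \<partial>lborel\<bar> \<le> (\<integral>t. indicator S t * std_normal t \<partial>lborel)"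
    if S: "S \<in> sets borel" for S
  proof -
    have "\<bar>\<integral>t. indicator S t * (k t * std_normal t) \<partial>lborel\<bar> \<le> (\<integral>t. \<bar>indicator S t * (k t * std_normal t)\<bar> \<partial>lborel)"
      by (rule integral_abs_bound)
    also have "\<dots> \<le> (\<integral>t. indicator S t * std_normal t \<partial>lborel)"
      using k1 by (intro integral_mono integrable_abs iS nS S) (auto simp: abs_mult indicator_def intro!: mult_left_le_one_le)
    finally show ?thesis .
  qed
  define A where "A x = (\<integral>t. indicator {..x} t * (k t * std_normal t) \<partial>lborel)" for x
  have dA: "(A has_real_derivative k x * std_normal x) (at x)" for x
  proof -
    let ?g = "\<lambda>t. k t * std_normal t"
    have gc: "continuous_on {x - 1..x + 1} ?g"
      by (intro continuous_intros nc continuous_on_subset[OF kc]) auto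
    have A_eq: "(\<integral>t. indicator {..<x - 1} t * ?g t \<partial>lborel) + integral {x - 1..u} ?g = A u" if "u \<in> {x - 1..x + 1}" for u
    proof -
      have "integral {x - 1..u} ?g = (\<integral>t. indicator {x - 1..u} t * ?g t \<partial>lborel)"
        using iS[of "{x - 1..u}"] by (subst set_borel_integral_eq_integral(2)[symmetric])
          (auto simp: set_integrable_def set_lebesgue_integral_def)
      then have "(\<integral>t. indicator {..<x - 1} t * ?g t \<partial>lborel) + integral {x - 1..u} ?g
        = (\<integral>t. indicator {..<x - 1} t * ?g t + indicator {x - 1..u} t * ?g t \<partial>lborel)"
        by (simp add: iS)
      also have "\<dots> = A u" unfolding A_def using that
        by (intro Bochner_Integration.integral_cong) (auto simp: indicator_def)
      finally show ?thesis .
    qed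
    have "((\<lambda>u. (\<integral>t. indicator {..<x - 1} t * ?g t \<partial>lborel) + integral {x - 1..u} ?g) has_real_derivative ?g x) (at x within {x - 1..x + 1})"
      using DERIV_add[OF DERIV_const integral_has_real_derivative[OF gc, of x]] by auto
    then have "(A has_real_derivative ?g x) (at x within {x - 1..x + 1})"
      by (rule has_field_derivative_transform_within[where d=1]) (use A_eq in auto)
    then show ?thesis by (simp add: at_within_Icc_at)
  qed
  have A_neg: "A x = - (\<integral>t. indicator {x<..} t * (k t * std_normal t) \<partial>lborel)" for x
  proof -
    have "A x + (\<integral>t. indicator {x<..} t * (k t * std_normal t) \<partial>lborel) = (\<integral>t. k t * std_normal t \<partial>lborel)"
      unfolding A_def by (subst Bochner_Integration.integral_add[OF iS iS, symmetric])
        (auto intro!: Bochner_Integration.integral_cong simp: indicator_def)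
    then show ?thesis by (simp add: zero)
  qed
  have pos: "\<bar>x\<bar> * \<bar>A x\<bar> \<le> std_normal x" if "0 < x" for x
  proof -
    have "\<bar>A x\<bar> \<le> (\<integral>t. indicator {x<..} t * std_normal t \<partial>lborel)" unfolding A_neg abs_minus by (rule bnd) simp
    also have "\<dots> \<le> (\<integral>t. indicator {x..} t * std_normal t \<partial>lborel)"
      by (intro integral_mono nS) (auto simp: indicator_def)
    finally have "\<bar>x\<bar> * \<bar>A x\<bar> \<le> x * (\<integral>t. indicator {x..} t * std_normal t \<partial>lborel)"
      using that by (auto intro!: mult_left_mono)
    then show ?thesis using normal_tail_bound[OF that] by simp
  qed
  have neg: "\<bar>x\<bar> * \<bar>A x\<bar> \<le> std_normal x" if "x < 0" for x
  proof -
    have "\<bar>A x\<bar> \<le> (\<integral>t. indicator {..x} t * std_normal t \<partial>lborel)" unfolding A_def by (rule bnd) simp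
    also have "\<dots> = (\<integral>t. indicator {- x..} t * std_normal t \<partial>lborel)"
      by (subst lborel_integral_real_affine[where c="-1" and t=0])
         (auto simp: std_normal_minus indicator_def intro!: Bochner_Integration.integral_cong)
    finally have "\<bar>x\<bar> * \<bar>A x\<bar> \<le> \<bar>x\<bar> * (\<integral>t. indicator {- x..} t * std_normal t \<partial>lborel)"
      by (intro mult_left_mono) auto
    also have "\<dots> \<le> std_normal x" using normal_tail_bound[of "- x"] that by (simp add: std_normal_minus abs_of_neg)
    finally show ?thesis .
  qed
  have A1: "\<bar>A x\<bar> \<le> 1" for x
  proof -
    have "\<bar>A x\<bar> \<le> (\<integral>t. indicator {..x} t * std_normal t \<partial>lborel)" unfolding A_def by (rule bnd) simp
    also have "\<dots> \<le> (\<integral>t. std_normal t \<partial>lborel)" by (intro integral_mono nS in0) (auto simp: indicator_def)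
    finally show ?thesis by simp
  qed
  have np: "0 < std_normal x" for x by (simp add: normal_density_pos)
  have n1: "1 \<le> 1 / std_normal 1"
  proof -
    have "std_normal 1 \<le> 1 / sqrt (2 * pi)" by (simp add: std_normal_density_def divide_right_mono)
    also have "\<dots> \<le> 1" using pi_ge_two by simp
    finally show ?thesis using np[of 1] by simp
  qed
  define \<phi> where "\<phi> x = A x / std_normal x" for x
  define \<phi>' where "\<phi>' x = k x + x * \<phi> x" for x
  have x\<phi>: "\<bar>x * \<phi> x\<bar> \<le> 1" for x
  proof (cases "x = 0")
    case False
    then have "\<bar>x\<bar> * \<bar>A x\<bar> \<le> std_normal x" using pos neg by (cases "x < 0") auto
    then show ?thesis using np[of x] by (simp add: \<phi>_def abs_mult abs_of_pos)
  qed auto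
  show thesis
  proof
    show d: "(\<phi> has_real_derivative \<phi>' x) (at x)" for x
      unfolding \<phi>_def[abs_def] \<phi>'_def using np[of x]
      by (auto intro!: derivative_eq_intros dA std_normal_deriv simp: field_simps power2_eq_square)
    have "continuous_on UNIV \<phi>" using d by (intro DERIV_continuous_on) (auto intro: has_field_derivative_at_within)
    then show "continuous_on UNIV \<phi>'" unfolding \<phi>'_def by (intro continuous_intros kc)
    show "\<phi>' x - x * \<phi> x = h x - (\<integral>z. h z \<partial>std_normal_distribution)" for x
      by (simp add: \<phi>'_def k_def m_def)
    show "\<bar>\<phi>' x\<bar> \<le> 2" for x using k1[of x] x\<phi>[of x] by (simp add: \<phi>'_def)
    show "\<bar>\<phi> x\<bar> \<le> 1 / std_normal 1" for x
    proof (cases "\<bar>x\<bar> \<le> 1")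
      case True
      have "\<bar>\<phi> x\<bar> = \<bar>A x\<bar> / std_normal x" using np[of x] by (simp add: \<phi>_def)
      also have "\<dots> \<le> 1 / std_normal 1" using A1[of x] np std_normal_antimono[of x 1] True by (intro frac_le) auto
      finally show ?thesis .
    next
      case False
      have "\<bar>\<phi> x\<bar> \<le> \<bar>x\<bar> * \<bar>\<phi> x\<bar>" using False by (simp add: mult_le_cancel_right1)
      then show ?thesis using x\<phi>[of x] n1 by (simp add: abs_mult)
    qed
  qed
qed

text \<open>Compact sets are reached through the functions \<open>max 0 (1 - n * infdist x K)\<close>, and Borel sets through inner regularity of one of
the two laws; monotonicity suffices for the other one. The absolute value requires both orders of the two laws.\<close>

lemma tv_dist_le_continuous:
  assumes "real_distribution \<mu>" "real_distribution \<nu>"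
    and h: "\<And>h. continuous_on UNIV h \<Longrightarrow> (\<And>x. 0 \<le> h x) \<Longrightarrow> (\<And>x. h x \<le> 1) \<Longrightarrow>
      \<bar>(\<integral>x. h x \<partial>\<mu>) - (\<integral>x. h x \<partial>\<nu>)\<bar> \<le> (B :: real)"
  shows "tv_dist \<mu> \<nu> \<le> B"
proof -
  have B0: "0 \<le> B" using h[of "\<lambda>_. 0"] by simp
  have half: "measure \<mu> A \<le> measure \<nu> A + B" if "A \<in> sets borel" and D: "real_distribution \<mu>" "real_distribution \<nu>"
    and h: "\<And>h. continuous_on UNIV h \<Longrightarrow> (\<And>x. 0 \<le> h x) \<Longrightarrow> (\<And>x. h x \<le> 1) \<Longrightarrow>
      \<bar>(\<integral>x. h x \<partial>\<mu>) - (\<integral>x. h x \<partial>\<nu>)\<bar> \<le> B" for \<mu> \<nu> :: "real measure" and A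
  proof -
    interpret \<mu>: real_distribution \<mu> by fact
    interpret \<nu>: real_distribution \<nu> by fact
    have K: "measure \<mu> K \<le> measure \<nu> K + B" if "compact K" for K
    proof (cases "K = {}")
      case False
      have cl: "closed K" using that by (rule compact_imp_closed)
      define f where "f n x = max 0 (1 - real n * infdist x K)" for n x
      have fm[measurable]: "f n \<in> borel_measurable borel" for n
        unfolding f_def by (intro borel_measurable_continuous_onI continuous_intros)
      have fb: "norm (f n x) \<le> 1" for n x unfolding f_def by (simp add: infdist_nonneg)
      have fl: "(\<lambda>n. f n x) \<longlonglongrightarrow> indicator K x" for x
      proof (cases "x \<in> K")
        case True
        then show ?thesis by (simp add: f_def)
      next
        case F: False
        then have p: "0 < infdist x K"
          using cl False by (metis in_closed_iff_infdist_zero infdist_nonneg order_le_less)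
        have "\<forall>\<^sub>F n in sequentially. f n x = 0"
        proof -
          obtain n0 where n0: "1 / infdist x K < real n0" using reals_Archimedean2 by blast
          have "f n x = 0" if "n \<ge> n0" for n
          proof -
            have "1 / infdist x K \<le> real n" using n0 that by linarith
            then have "1 \<le> real n * infdist x K" using p by (simp add: divide_le_eq)
            then show ?thesis by (simp add: f_def)
          qed
          then show ?thesis unfolding eventually_sequentially by blast
        qed
        then show ?thesis using F by (simp add: tendsto_eventually)
      qed
      have lim: "(\<lambda>n. \<integral>x. f n x \<partial>\<rho>) \<longlonglongrightarrow> measure \<rho> K" if "real_distribution \<rho>" for \<rho>
      proof -
        interpret \<rho>: real_distribution \<rho> by fact
        have "(\<lambda>n. \<integral>x. f n x \<partial>\<rho>) \<longlonglongrightarrow> (\<integral>x. indicator K x \<partial>\<rho>)"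
          by (rule integral_dominated_convergence[where w="\<lambda>_. 1"]) (use fl cl fb in auto)
        then show ?thesis using cl by simp
      qed
      have "(\<integral>x. f n x \<partial>\<mu>) - (\<integral>x. f n x \<partial>\<nu>) \<le> B" for n
        using h[of "f n"] unfolding f_def by (force intro!: continuous_intros simp: infdist_nonneg)
      then have "measure \<mu> K - measure \<nu> K \<le> B"
        by (intro LIMSEQ_le_const2[OF tendsto_diff[OF lim[OF D(1)] lim[OF D(2)]]]) auto
      then show ?thesis by simp
    qed (use B0 in auto)
    have "emeasure \<mu> A = (SUP K \<in> {K. K \<subseteq> A \<and> compact K}. emeasure \<mu> K)"
      by (rule inner_regular) (use that \<mu>.emeasure_finite in auto)
    also have "\<dots> \<le> ennreal (measure \<nu> A + B)"
    proof (rule SUP_least)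
      fix K assume Kd: "K \<in> {K. K \<subseteq> A \<and> compact K}"
      have "measure \<mu> K \<le> measure \<nu> K + B" using K Kd by auto
      also have "measure \<nu> K \<le> measure \<nu> A" using Kd that by (intro \<nu>.finite_measure_mono) auto
      finally show "emeasure \<mu> K \<le> ennreal (measure \<nu> A + B)" by (simp add: \<mu>.emeasure_eq_measure ennreal_leI)
    qed
    finally show ?thesis using B0 unfolding \<mu>.emeasure_eq_measure by (subst (asm) ennreal_le_iff) auto
  qed
  show ?thesis unfolding tv_dist_def
  proof (rule cSUP_least)
    fix A :: "real set" assume A: "A \<in> sets borel"
    have "measure \<mu> A \<le> measure \<nu> A + B" by (rule half[OF A assms(1,2) h])
    moreover have "measure \<nu> A \<le> measure \<mu> A + B"
      by (rule half[OF A assms(2,1)]) (subst abs_minus_commute, rule h)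
    ultimately show "\<bar>measure \<mu> A - measure \<nu> A\<bar> \<le> B" by linarith
  qed auto
qed

section \<open>The boundary value problem and midpoint sums\<close>

definition midpoint_of :: "nat \<Rightarrow> nat \<Rightarrow> real" where "midpoint_of n j = (real j + 1 / 2) / real n"

lemma midpoint_of_in: "j < n \<Longrightarrow> midpoint_of n j \<in> {0<..<1}"
  by (auto simp: midpoint_of_def divide_less_eq)

text \<open>By the mean value theorem each piece of the integral is a value of \<open>h\<close> at a nearby point, and \<open>h\<close> is uniformly
continuous. Midpoints are used because they avoid the end points, where \<open>deriv\<close> need not agree with the one-sided
derivative of a solution.\<close>

lemma midpoint_sums_tendsto:
  fixes h :: "real \<Rightarrow> real"
  assumes h: "continuous_on {0..1} h"
  shows "(\<lambda>n. \<Sum>j<n. 1 / real n * h (midpoint_of n j)) \<longlonglongrightarrow> integral {0..1} h"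
proof (rule LIMSEQ_I)
  fix e :: real assume e: "0 < e"
  have "uniformly_continuous_on {0..1} h" by (rule compact_uniformly_continuous[OF h]) simp
  then obtain d where d: "0 < d" and uc: "\<And>x y. x \<in> {0..1} \<Longrightarrow> y \<in> {0..1} \<Longrightarrow> dist y x < d \<Longrightarrow> dist (h y) (h x) < e / 2"
    using e unfolding uniformly_continuous_on_def by (metis half_gt_zero)
  obtain N where N: "1 / d < real N" using reals_Archimedean2 by blast
  define H where "H x = integral {0..x} h" for x
  have dH: "(H has_real_derivative h x) (at x within {0..1})" if "x \<in> {0..1}" for x
    unfolding H_def by (rule integral_has_real_derivative[OF h that])
  have "norm ((\<Sum>j<n. 1 / real n * h (midpoint_of n j)) - integral {0..1} h) < e" if n: "n \<ge> Suc N" for n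
  proof -
    have n0: "0 < real n" using n by simp
    have nd: "1 / real n < d"
    proof -
      have "1 / d < real n" using N n by linarith
      then show ?thesis using d n0 by (simp add: field_simps)
    qed
    have piece: "\<bar>1 / real n * h (midpoint_of n j) - (H (real (Suc j) / real n) - H (real j / real n))\<bar> \<le> 1 / real n * (e / 2)" if j: "j < n" for j
    proof -
      let ?a = "real j / real n" and ?b = "real (Suc j) / real n"
      have ab: "?a < ?b" "0 \<le> ?a" "?b \<le> 1" "?b - ?a = 1 / real n"
        using j n0 by (auto simp: divide_simps)
      have sub: "{?a..?b} \<subseteq> {0..1}" using ab by auto
      have "\<exists>x\<in>{?a<..<?b}. H ?b - H ?a = (\<lambda>y. y * h x) (?b - ?a)"
      proof (rule mvt_simple[OF ab(1)])
        fix x assume "?a \<le> x" "x \<le> ?b"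
        then have "x \<in> {0..1}" using sub by (meson atLeastAtMost_iff subsetD)
        then have "(H has_real_derivative h x) (at x within {?a..?b})" by (rule DERIV_subset[OF dH sub])
        moreover have "(*) (h x) = (\<lambda>y. y * h x)" by (simp add: fun_eq_iff)
        ultimately show "(H has_derivative (\<lambda>y. y * h x)) (at x within {?a..?b})"
          by (simp only: has_field_derivative_def)
      qed
      then obtain x where x: "?a < x" "x < ?b" and eq: "H ?b - H ?a = 1 / real n * h x" using ab(4) by auto
      have mj: "?a < midpoint_of n j" "midpoint_of n j < ?b" using n0 by (auto simp: midpoint_of_def divide_strict_right_mono)
      have "dist (midpoint_of n j) x < d" using x mj ab(4) nd by (simp add: dist_real_def abs_if)
      then have "dist (h (midpoint_of n j)) (h x) < e / 2"
      proof (rule uc[rotated 2])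
        have "0 \<le> x" "0 \<le> midpoint_of n j" "x \<le> 1" "midpoint_of n j \<le> 1" using x mj ab(2,3) by linarith+
        then show "x \<in> {0..1}" "midpoint_of n j \<in> {0..1}" by auto
      qed
      then have "1 / real n * \<bar>h (midpoint_of n j) - h x\<bar> \<le> 1 / real n * (e / 2)"
        by (intro mult_left_mono) (auto simp: dist_real_def)
      moreover have "\<bar>1 / real n * h (midpoint_of n j) - 1 / real n * h x\<bar> = 1 / real n * \<bar>h (midpoint_of n j) - h x\<bar>"
        unfolding right_diff_distrib[symmetric] abs_mult by simp
      ultimately show ?thesis unfolding eq by simp
    qed
    have "(\<Sum>j<n. H (real (Suc j) / real n) - H (real j / real n)) = H (real n / real n) - H (real 0 / real n)"
      by (rule sum_lessThan_telescope)
    then have tel: "integral {0..1} h = (\<Sum>j<n. H (real (Suc j) / real n) - H (real j / real n))"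
      using n0 by (simp add: H_def)
    have "norm ((\<Sum>j<n. 1 / real n * h (midpoint_of n j)) - integral {0..1} h)
       \<le> (\<Sum>j<n. \<bar>1 / real n * h (midpoint_of n j) - (H (real (Suc j) / real n) - H (real j / real n))\<bar>)"
      unfolding tel sum_subtractf[symmetric] real_norm_def by (rule sum_abs)
    also have "\<dots> \<le> (\<Sum>j<n. 1 / real n * (e / 2))" by (intro sum_mono piece) simp
    also have "\<dots> = e / 2" using n0 by simp
    also have "\<dots> < e" using e by simp
    finally show ?thesis .
  qed
  then show "\<exists>no. \<forall>n\<ge>no. norm ((\<Sum>j<n. 1 / real n * h (midpoint_of n j)) - integral {0..1} h) < e" by blast
qed

lemma C1_01_deriv:
  assumes "C1_01 u"
  obtains D where "continuous_on {0..1} D" "continuous_on {0..1} u"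
    "\<And>x. x \<in> {0..1} \<Longrightarrow> (u has_real_derivative D x) (at x within {0..1})"
    "\<And>x. x \<in> {0<..<1} \<Longrightarrow> (u has_real_derivative D x) (at x)"
    "\<And>x. x \<in> {0<..<1} \<Longrightarrow> deriv u x = D x"
proof -
  obtain D where D: "\<forall>x\<in>{0..1}. (u has_real_derivative D x) (at x within {0..1})" "continuous_on {0..1} D"
    using assms by (auto simp: C1_01_def)
  have i: "(u has_real_derivative D x) (at x)" if "x \<in> {0<..<1}" for x
  proof -
    have "at x within {0..1} = at x" using that by (intro at_within_interior) auto
    moreover have "(u has_real_derivative D x) (at x within {0..1})" using D(1) that by auto
    ultimately show ?thesis by (simp only:)
  qed
  have "continuous_on {0..1} u" using D(1) by (intro DERIV_continuous_on) auto
  then show thesis using that[of D] D i DERIV_imp_deriv[OF i] by blast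
qed

lemma grad_integral_eq:
  assumes D: "continuous_on {0..1} D" and g: "continuous_on {0..1} g"
    and eq: "\<And>x. x \<in> {0<..<1} \<Longrightarrow> deriv (u \<omega>) x = D x"
  shows "grad_integral u g \<omega> = integral {0..1} (\<lambda>x. D x * g x)"
proof -
  have c: "continuous_on {0..1} (\<lambda>x. D x * g x)" using D g by (intro continuous_intros)
  have co: "continuous_on {0<..<1} (\<lambda>x. D x * g x)" by (rule continuous_on_subset[OF c]) auto
  have m: "(\<lambda>x. indicator {0..1} x *\<^sub>R (deriv (u \<omega>) x * g x)) \<in> borel_measurable lborel"
  proof -
    have "(\<lambda>x. indicator {0<..<1} x *\<^sub>R (D x * g x)) \<in> borel_measurable borel"
      by (rule borel_measurable_continuous_on_indicator[OF _ co]) simp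
    then have "(\<lambda>x. if x = 0 then deriv (u \<omega>) 0 * g 0 else if x = 1 then deriv (u \<omega>) 1 * g 1
        else indicator {0<..<1} x *\<^sub>R (D x * g x)) \<in> borel_measurable borel" by measurable
    also have "(\<lambda>x. if x = 0 then deriv (u \<omega>) 0 * g 0 else if x = 1 then deriv (u \<omega>) 1 * g 1
        else indicator {0<..<1} x *\<^sub>R (D x * g x)) = (\<lambda>x. indicator {0..1} x *\<^sub>R (deriv (u \<omega>) x * g x))"
      using eq by (auto simp: fun_eq_iff indicator_def)
    finally show ?thesis by simp
  qed
  have m': "(\<lambda>x. indicator {0..1} x *\<^sub>R (D x * g x)) \<in> borel_measurable lborel"
    using borel_measurable_continuous_on_indicator[OF _ c] by simp
  have "grad_integral u g \<omega> = (LBINT x:{0..1}. D x * g x)"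
    unfolding grad_integral_def set_lebesgue_integral_def
  proof (rule integral_cong_AE[OF m m'])
    have "AE x in lborel. x \<noteq> (0::real)" "AE x in lborel. x \<noteq> (1::real)" by (rule AE_lborel_singleton)+
    then show "AE x in lborel. indicator {0..1} x *\<^sub>R (deriv (u \<omega>) x * g x) = indicator {0..1} x *\<^sub>R (D x * g x)"
      by eventually_elim (use eq in \<open>auto simp: indicator_def\<close>)
  qed
  also have "\<dots> = integral {0..1} (\<lambda>x. D x * g x)"
    by (rule set_borel_integral_eq_integral(2)) (rule borel_integrable_atLeastAtMost'[OF c])
  finally show ?thesis .
qed

text \<open>The flux \<open>a (x / \<epsilon>) * u' x\<close> equals \<open>f x + k\<close> for some constant \<open>k\<close>, and the boundary values determine \<open>k\<close>.\<close>

lemma grad_integral_solution: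
  assumes a: "continuous_on UNIV a" "\<And>x. 0 < a x" and \<epsilon>: "0 < \<epsilon>"
    and f: "C1_01 f" and g: "continuous_on {0..1} g" and u: "solves_bvp a \<epsilon> f (u \<omega>)"
  defines "b \<equiv> \<lambda>x. 1 / a (x / \<epsilon>)"
  shows "grad_integral u g \<omega> = integral {0..1} (\<lambda>x. b x * (f x * g x))
     - integral {0..1} (\<lambda>x. b x * f x) * integral {0..1} (\<lambda>x. b x * g x) / integral {0..1} b"
    and "continuous_on {0..1} b" and "0 < integral {0..1} b"
proof -
  obtain D where D: "continuous_on {0..1} D" "\<And>x. x \<in> {0..1} \<Longrightarrow> (u \<omega> has_real_derivative D x) (at x within {0..1})"
     "\<And>x. x \<in> {0<..<1} \<Longrightarrow> deriv (u \<omega>) x = D x"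
  proof -
    have "C1_01 (u \<omega>)" using u by (simp add: solves_bvp_def)
    from C1_01_deriv[OF this] show thesis using that by metis
  qed
  obtain Df where Df: "continuous_on {0..1} f" "\<And>x. x \<in> {0<..<1} \<Longrightarrow> (f has_real_derivative Df x) (at x)"
     "\<And>x. x \<in> {0<..<1} \<Longrightarrow> deriv f x = Df x"
    using C1_01_deriv[OF f] by metis
  have ac: "continuous_on {0..1} (\<lambda>x. a (x / \<epsilon>))"
    by (rule continuous_on_compose2[OF a(1)]) (use \<epsilon> in \<open>auto intro!: continuous_intros\<close>)
  show bc: "continuous_on {0..1} b"
    unfolding b_def by (intro continuous_intros ac) (use a(2) in \<open>auto simp: less_imp_neq[symmetric]\<close>)
  have bpos: "0 < b x" for x using a(2) by (simp add: b_def)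
  have ib: "S integrable_on {0..1}" if "continuous_on {0..1} S" for S :: "real \<Rightarrow> real"
    using that by (rule integrable_continuous_real)
  show bi: "0 < integral {0..1} b"
  proof -
    obtain x0 where x0: "x0 \<in> {0..1}" "\<And>y. y \<in> {0..1} \<Longrightarrow> b x0 \<le> b y"
      using continuous_attains_inf[OF _ _ bc] by force
    have "b x0 * (1 - 0) \<le> integral {0..1} b"
      using integral_le[of "\<lambda>_. b x0" "{0..1::real}" b] ib[OF bc] ib[OF continuous_on_const] x0 by simp
    then show ?thesis using bpos[of x0] by simp
  qed
  have "\<exists>k. \<forall>x\<in>{0<..<1}. a (x / \<epsilon>) * deriv (u \<omega>) x - f x = k"
  proof (rule has_field_derivative_zero_constant)
    fix x :: real assume x: "x \<in> {0<..<1}"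
    have "((\<lambda>y. a (y / \<epsilon>) * deriv (u \<omega>) y - f y) has_real_derivative deriv f x - Df x) (at x)"
      using u x by (intro DERIV_diff Df(2)) (auto simp: solves_bvp_def)
    then show "((\<lambda>y. a (y / \<epsilon>) * deriv (u \<omega>) y - f y) has_field_derivative 0) (at x within {0<..<1})"
      using Df(3)[OF x] by (auto intro: has_field_derivative_at_within)
  qed auto
  then obtain k where k: "\<And>x. x \<in> {0<..<1} \<Longrightarrow> a (x / \<epsilon>) * D x - f x = k" using D(3) by auto
  have Dx: "D x = b x * f x + k * b x" if "x \<in> {0<..<1}" for x
    using k[OF that] a(2)[of "x / \<epsilon>"] by (simp add: b_def field_simps)
  have Dint: "integral {0..1} (\<lambda>x. D x * h x) = integral {0..1} (\<lambda>x. b x * f x * h x) + k * integral {0..1} (\<lambda>x. b x * h x)"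
    if h: "continuous_on {0..1} h" for h
  proof -
    have "integral {0..1} (\<lambda>x. D x * h x) = integral {0..1} (\<lambda>x. b x * f x * h x + k * (b x * h x))"
      by (rule integral_spike[of "{0, 1}"]) (auto simp: Dx algebra_simps)
    also have "\<dots> = integral {0..1} (\<lambda>x. b x * f x * h x) + integral {0..1} (\<lambda>x. k * (b x * h x))"
      by (intro Henstock_Kurzweil_Integration.integral_add ib continuous_intros bc Df h)
    finally show ?thesis by simp
  qed
  have "(D has_integral u \<omega> 1 - u \<omega> 0) {0..1}"
    by (rule fundamental_theorem_of_calculus) (use D(2) in \<open>auto simp: has_real_derivative_iff_has_vector_derivative[symmetric]\<close>)
  then have "integral {0..1} D = 0" using u by (simp add: solves_bvp_def integral_unique)
  then have "0 = integral {0..1} (\<lambda>x. b x * f x) + k * integral {0..1} b" using Dint[of "\<lambda>_. 1"] by simp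
  then have keq: "k = - integral {0..1} (\<lambda>x. b x * f x) / integral {0..1} b" using bi by (simp add: field_simps)
  show "grad_integral u g \<omega> = integral {0..1} (\<lambda>x. b x * (f x * g x))
     - integral {0..1} (\<lambda>x. b x * f x) * integral {0..1} (\<lambda>x. b x * g x) / integral {0..1} b"
  proof -
    have "grad_integral u g \<omega> = integral {0..1} (\<lambda>x. D x * g x)" by (rule grad_integral_eq) (use D g in auto)
    then show ?thesis unfolding Dint[OF g] keq by (simp add: mult.assoc)
  qed
qed

text \<open>For every outcome the integral is the limit of midpoint sums, and the derivatives in these sums are limits of difference quotients.\<close>

lemma grad_integral_measurable:
  assumes u: "random_solution P G \<epsilon> f u" and g: "continuous_on {0..1} g"
  shows "grad_integral u g \<in> borel_measurable P"
proof (rule borel_measurable_LIMSEQ_real)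
  have um: "(\<lambda>\<omega>. u \<omega> x) \<in> borel_measurable P" if "x \<in> {0..1}" for x using u that by (auto simp: random_solution_def)
  have uC: "C1_01 (u \<omega>)" if "\<omega> \<in> space P" for \<omega> using u that by (auto simp: random_solution_def)
  have dm: "(\<lambda>\<omega>. deriv (u \<omega>) x) \<in> borel_measurable P" if x: "x \<in> {0<..<1}" for x
  proof (rule borel_measurable_LIMSEQ_real)
    define \<delta> where "\<delta> k = (1 - x) / real (Suc k)" for k
    have \<delta>: "0 < \<delta> k" "\<delta> k \<le> 1 - x" for k using x by (auto simp: \<delta>_def divide_le_eq)
    show "(\<lambda>\<omega>. (u \<omega> (x + \<delta> k) - u \<omega> x) / \<delta> k) \<in> borel_measurable P" for k
      using um[of "x + \<delta> k"] um[of x] \<delta>[of k] x by simp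
    have \<delta>0: "\<delta> \<longlonglongrightarrow> 0" unfolding \<delta>_def by (rule LIMSEQ_Suc[OF lim_const_over_n])
    fix \<omega> assume "\<omega> \<in> space P"
    from C1_01_deriv[OF uC[OF this]] obtain D where D: "\<And>x. x \<in> {0<..<1} \<Longrightarrow> (u \<omega> has_real_derivative D x) (at x)"
      "\<And>x. x \<in> {0<..<1} \<Longrightarrow> deriv (u \<omega>) x = D x" by metis
    have "(\<lambda>h. (u \<omega> (x + h) - u \<omega> x) / h) \<midarrow>0\<rightarrow> D x" using D(1)[OF x] by (simp add: DERIV_def)
    then show "(\<lambda>k. (u \<omega> (x + \<delta> k) - u \<omega> x) / \<delta> k) \<longlonglongrightarrow> deriv (u \<omega>) x"
      unfolding D(2)[OF x] using \<delta>0 \<delta>(1) unfolding tendsto_at_iff_sequentially comp_def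
      by (metis (no_types, lifting) UNIV_I insert_iff Diff_iff empty_iff less_irrefl)
  qed
  show "(\<lambda>\<omega>. \<Sum>j<n. 1 / real n * (deriv (u \<omega>) (midpoint_of n j) * g (midpoint_of n j))) \<in> borel_measurable P" for n
    using dm[OF midpoint_of_in] by (intro borel_measurable_sum borel_measurable_times borel_measurable_const) auto
  fix \<omega> assume "\<omega> \<in> space P"
  from C1_01_deriv[OF uC[OF this]] obtain D where D: "continuous_on {0..1} D"
    "\<And>x. x \<in> {0<..<1} \<Longrightarrow> deriv (u \<omega>) x = D x" by metis
  have c: "continuous_on {0..1} (\<lambda>x. D x * g x)" using D g by (intro continuous_intros)
  have "(\<Sum>j<n. 1 / real n * (deriv (u \<omega>) (midpoint_of n j) * g (midpoint_of n j))) = (\<Sum>j<n. 1 / real n * (D (midpoint_of n j) * g (midpoint_of n j)))" for n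
    by (intro sum.cong refl) (simp add: D(2)[OF midpoint_of_in])
  moreover have "grad_integral u g \<omega> = integral {0..1} (\<lambda>x. D x * g x)" by (rule grad_integral_eq) (use D g in auto)
  ultimately show "(\<lambda>n. \<Sum>j<n. 1 / real n * (deriv (u \<omega>) (midpoint_of n j) * g (midpoint_of n j))) \<longlonglongrightarrow> grad_integral u g \<omega>"
    using midpoint_sums_tendsto[OF c] by simp
qed

text \<open>Comparison with an integral, in the form of a telescoping sum of values of the primitive.\<close>

lemma powr_decay_sum:
  fixes \<beta> \<delta> :: real
  assumes \<beta>: "1 < \<beta>" and \<delta>: "0 < \<delta>"
  shows "(\<Sum>k<N. (1 + \<delta> * real (Suc k)) powr (- \<beta>)) \<le> 1 / (\<delta> * (\<beta> - 1))"
proof -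
  let ?\<psi> = "\<lambda>k. (1 + \<delta> * real k) powr (1 - \<beta>)"
  have step: "\<delta> * (\<beta> - 1) * (1 + \<delta> * real (Suc k)) powr (- \<beta>) \<le> ?\<psi> k - ?\<psi> (Suc k)" for k
  proof -
    let ?x = "1 + \<delta> * real k" and ?y = "1 + \<delta> * real (Suc k)"
    have xy: "0 < ?x" "?x < ?y" "?y - ?x = \<delta>" using \<delta> by (auto simp: algebra_simps add_pos_nonneg)
    have "\<exists>z. ?x < z \<and> z < ?y \<and> ?y powr (1 - \<beta>) - ?x powr (1 - \<beta>) = (?y - ?x) * ((1 - \<beta>) * z powr (1 - \<beta> - 1))"
      using xy by (intro MVT2) (auto intro!: derivative_eq_intros)
    then obtain z where z: "?x < z" "z < ?y" "?y powr (1 - \<beta>) - ?x powr (1 - \<beta>) = \<delta> * ((1 - \<beta>) * z powr (- \<beta>))"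
      using xy(3) by auto
    have "?y powr (- \<beta>) \<le> z powr (- \<beta>)" using z xy \<beta> by (intro powr_mono2') auto
    then have "\<delta> * (\<beta> - 1) * ?y powr (- \<beta>) \<le> \<delta> * (\<beta> - 1) * z powr (- \<beta>)" using \<delta> \<beta> by (intro mult_left_mono) auto
    also have "\<dots> = ?\<psi> k - ?\<psi> (Suc k)" using z(3) by (simp add: algebra_simps)
    finally show ?thesis .
  qed
  have "\<delta> * (\<beta> - 1) * (\<Sum>k<N. (1 + \<delta> * real (Suc k)) powr (- \<beta>)) \<le> (\<Sum>k<N. ?\<psi> k - ?\<psi> (Suc k))"
    unfolding sum_distrib_left by (intro sum_mono step)
  also have "\<dots> = ?\<psi> 0 - ?\<psi> N" by (rule sum_lessThan_telescope')
  also have "\<dots> \<le> 1" by simp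
  finally show ?thesis using \<delta> \<beta> by (simp add: field_simps)
qed

text \<open>The scaled points are at distances \<open>\<delta> * \<bar>i - j\<bar>\<close> with \<open>\<delta> = 1 / (n * \<epsilon>)\<close>, so that the sum is \<open>\<epsilon>\<close> times a Riemann sum of an
integrable function. The diagonal term \<open>1 / n\<close> is at most \<open>\<epsilon>\<close> by the choice of \<open>n\<close>.\<close>

lemma covariance_row_sum:
  fixes C :: "real \<Rightarrow> real"
  assumes \<beta>: "1 < \<beta>" and C: "\<And>x. \<bar>C x\<bar> \<le> K * (1 + \<bar>x\<bar>) powr (- \<beta>)"
    and \<epsilon>: "0 < \<epsilon>" and n: "1 / \<epsilon> \<le> real n" and i: "i < n"
  shows "(\<Sum>j<n. 1 / real n * \<bar>C (midpoint_of n i / \<epsilon> - midpoint_of n j / \<epsilon>)\<bar>) \<le> (\<bar>K\<bar> + 1) * (1 + 2 / (\<beta> - 1)) * \<epsilon>"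
proof -
  have n0: "0 < real n" using i by simp
  define \<delta> where "\<delta> = 1 / (real n * \<epsilon>)"
  have \<delta>: "0 < \<delta>" using n0 \<epsilon> by (simp add: \<delta>_def)
  define \<phi> where "\<phi> k = (1 + \<delta> * real k) powr (- \<beta>)" for k
  define L where "L = 1 / (\<delta> * (\<beta> - 1))"
  have sumL: "(\<Sum>k<N. \<phi> (Suc k)) \<le> L" for N unfolding \<phi>_def L_def by (rule powr_decay_sum[OF \<beta> \<delta>])
  have d: "\<bar>midpoint_of n i / \<epsilon> - midpoint_of n j / \<epsilon>\<bar> = \<delta> * \<bar>real i - real j\<bar>" for j
  proof -
    have "midpoint_of n i / \<epsilon> - midpoint_of n j / \<epsilon> = \<delta> * (real i - real j)"
      using n0 \<epsilon> by (simp add: midpoint_of_def \<delta>_def field_simps)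
    then show ?thesis using \<delta> by (simp add: abs_mult)
  qed
  have "(\<Sum>j<n. (1 + \<delta> * \<bar>real i - real j\<bar>) powr (- \<beta>)) = (\<Sum>j<i. (1 + \<delta> * \<bar>real i - real j\<bar>) powr (- \<beta>)) + (\<Sum>j=i..<n. (1 + \<delta> * \<bar>real i - real j\<bar>) powr (- \<beta>))"
    unfolding lessThan_atLeast0 by (rule sum.atLeastLessThan_concat[symmetric]) (use i in auto)
  also have "(\<Sum>j<i. (1 + \<delta> * \<bar>real i - real j\<bar>) powr (- \<beta>)) = (\<Sum>j<i. \<phi> (Suc (i - Suc j)))"
    by (intro sum.cong refl) (auto simp: \<phi>_def of_nat_diff)
  also have "\<dots> = (\<Sum>k<i. \<phi> (Suc k))" by (rule sum.nat_diff_reindex)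
  also have "\<dots> \<le> L" by (rule sumL)
  also have "(\<Sum>j=i..<n. (1 + \<delta> * \<bar>real i - real j\<bar>) powr (- \<beta>)) = (\<Sum>k=0..<n-i. \<phi> k)"
    by (subst sum.atLeastLessThan_shift_0) (auto simp: \<phi>_def intro!: sum.cong)
  also have "(\<Sum>k=0..<n-i. \<phi> k) = \<phi> 0 + (\<Sum>k<n-i-1. \<phi> (Suc k))"
  proof -
    obtain m where "n - i = Suc m" using i by (cases "n - i") auto
    then show ?thesis by (simp add: lessThan_atLeast0[symmetric] sum.lessThan_Suc_shift del: sum.lessThan_Suc)
  qed
  also have "\<dots> \<le> 1 + L" using sumL[of "n - i - 1"] by (simp add: \<phi>_def)
  finally have S: "(\<Sum>j<n. (1 + \<delta> * \<bar>real i - real j\<bar>) powr (- \<beta>)) \<le> 1 + 2 * L" by simp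
  have "(\<Sum>j<n. 1 / real n * \<bar>C (midpoint_of n i / \<epsilon> - midpoint_of n j / \<epsilon>)\<bar>) \<le> (\<Sum>j<n. 1 / real n * ((\<bar>K\<bar> + 1) * (1 + \<delta> * \<bar>real i - real j\<bar>) powr (- \<beta>)))"
  proof (intro sum_mono mult_left_mono)
    fix j
    have "\<bar>C (midpoint_of n i / \<epsilon> - midpoint_of n j / \<epsilon>)\<bar> \<le> K * (1 + \<delta> * \<bar>real i - real j\<bar>) powr (- \<beta>)" using C d by metis
    also have "\<dots> \<le> (\<bar>K\<bar> + 1) * (1 + \<delta> * \<bar>real i - real j\<bar>) powr (- \<beta>)" by (intro mult_right_mono) auto
    finally show "\<bar>C (midpoint_of n i / \<epsilon> - midpoint_of n j / \<epsilon>)\<bar> \<le> (\<bar>K\<bar> + 1) * (1 + \<delta> * \<bar>real i - real j\<bar>) powr (- \<beta>)" .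
  qed auto
  also have "\<dots> = 1 / real n * (\<bar>K\<bar> + 1) * (\<Sum>j<n. (1 + \<delta> * \<bar>real i - real j\<bar>) powr (- \<beta>))" by (simp add: sum_distrib_left mult.assoc)
  also have "\<dots> \<le> 1 / real n * (\<bar>K\<bar> + 1) * (1 + 2 * L)" using S by (intro mult_left_mono) auto
  also have "\<dots> = (\<bar>K\<bar> + 1) * (1 / real n + 2 * \<epsilon> / (\<beta> - 1))"
    using n0 \<epsilon> by (simp add: L_def \<delta>_def field_simps)
  also have "\<dots> \<le> (\<bar>K\<bar> + 1) * (\<epsilon> + 2 * \<epsilon> / (\<beta> - 1))"
  proof (intro mult_left_mono add_right_mono)
    show "1 / real n \<le> \<epsilon>" using n n0 \<epsilon> by (simp add: field_simps)
  qed auto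
  also have "\<dots> = (\<bar>K\<bar> + 1) * (1 + 2 / (\<beta> - 1)) * \<epsilon>" by (simp add: algebra_simps)
  finally show ?thesis .
qed

section \<open>Passage to the limit\<close>

text \<open>Bounded second moments make the sequence uniformly integrable: truncation at height \<open>R\<close> changes the
expectations by at most \<open>K / R\<close>.\<close>

lemma (in prob_space) expectation_tendsto_of_bounded_second_moment:
  fixes Z :: "nat \<Rightarrow> 'a \<Rightarrow> real"
  assumes Zm[measurable]: "\<And>n. Z n \<in> borel_measurable M" and Ym[measurable]: "Y \<in> borel_measurable M"
    and lim: "AE \<omega> in M. (\<lambda>n. Z n \<omega>) \<longlonglongrightarrow> Y \<omega>"
    and i2: "\<And>n. integrable M (\<lambda>\<omega>. (Z n \<omega>)\<^sup>2)" and K: "\<And>n. expectation (\<lambda>\<omega>. (Z n \<omega>)\<^sup>2) \<le> K"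
  shows "integrable M Y" and "(\<lambda>n. expectation (Z n)) \<longlonglongrightarrow> expectation Y"
proof -
  have K0: "0 \<le> K" using K[of 0] by (rule order_trans[rotated]) simp
  have i1: "integrable M W" if [measurable]: "W \<in> borel_measurable M" and "integrable M (\<lambda>\<omega>. (W \<omega>)\<^sup>2)" for W :: "'a \<Rightarrow> real"
    using square_integrable_imp_integrable[OF that] .
  have Y2nn: "(\<integral>\<^sup>+\<omega>. ennreal ((Y \<omega>)\<^sup>2) \<partial>M) \<le> ennreal K"
  proof -
    have "(\<integral>\<^sup>+\<omega>. ennreal ((Y \<omega>)\<^sup>2) \<partial>M) = (\<integral>\<^sup>+\<omega>. liminf (\<lambda>n. ennreal ((Z n \<omega>)\<^sup>2)) \<partial>M)"
    proof (rule nn_integral_cong_AE, use lim in eventually_elim)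
      fix \<omega> assume "(\<lambda>n. Z n \<omega>) \<longlonglongrightarrow> Y \<omega>"
      then have "(\<lambda>n. ennreal ((Z n \<omega>)\<^sup>2)) \<longlonglongrightarrow> ennreal ((Y \<omega>)\<^sup>2)" by (intro tendsto_intros)
      then show "ennreal ((Y \<omega>)\<^sup>2) = liminf (\<lambda>n. ennreal ((Z n \<omega>)\<^sup>2))"
        by (intro lim_imp_Liminf[symmetric]) auto
    qed
    also have "\<dots> \<le> liminf (\<lambda>n. \<integral>\<^sup>+\<omega>. ennreal ((Z n \<omega>)\<^sup>2) \<partial>M)" by (rule nn_integral_liminf) measurable
    also have "\<dots> \<le> ennreal K"
    proof (rule Liminf_le)
      show "\<forall>\<^sub>F n in sequentially. (\<integral>\<^sup>+\<omega>. ennreal ((Z n \<omega>)\<^sup>2) \<partial>M) \<le> ennreal K"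
        using K by (intro always_eventually allI) (simp add: nn_integral_eq_integral[OF i2] ennreal_leI)
    qed simp
    finally show ?thesis .
  qed
  have Y2i: "integrable M (\<lambda>\<omega>. (Y \<omega>)\<^sup>2)"
    by (rule integrableI_nonneg) (use Y2nn in \<open>auto intro: le_less_trans\<close>)
  have Y2: "expectation (\<lambda>\<omega>. (Y \<omega>)\<^sup>2) \<le> K"
    using Y2nn K0 by (simp add: nn_integral_eq_integral[OF Y2i])
  show Yi: "integrable M Y" by (rule i1[OF Ym Y2i])
  show "(\<lambda>n. expectation (Z n)) \<longlonglongrightarrow> expectation Y"
  proof (rule LIMSEQ_I)
    fix e :: real assume e: "0 < e"
    \<comment> \<open>the truncation then changes each of the two expectations by at most \<open>e / 4\<close>\<close>
    define R where "R = 4 * (K + 1) / e"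
    have R: "0 < R" using e K0 by (simp add: R_def)
    define T where "T x = max (- R) (min R x)" for x
    have Tm[measurable]: "T \<in> borel_measurable borel" unfolding T_def[abs_def] by measurable
    have Tb: "\<bar>T x\<bar> \<le> R" for x using R by (auto simp: T_def)
    have Tx: "\<bar>x - T x\<bar> \<le> x\<^sup>2 / R" for x
    proof (cases "\<bar>x\<bar> \<le> R")
      case True
      then have "T x = x" by (auto simp: T_def)
      then show ?thesis using R by simp
    next
      case False
      have "\<bar>x - T x\<bar> \<le> \<bar>x\<bar>" using False R by (auto simp: T_def abs_if split: if_splits)
      also have "\<dots> \<le> x\<^sup>2 / R"
        using mult_left_mono[of R "\<bar>x\<bar>" "\<bar>x\<bar>"] False R by (simp add: le_divide_eq power2_eq_square)
      finally show ?thesis .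
    qed
    have Ti: "integrable M (\<lambda>\<omega>. T (W \<omega>))" if [measurable]: "W \<in> borel_measurable M" for W
      by (rule integrable_const_bound[of _ R]) (use Tb in auto)
    have trunc: "\<bar>expectation W - expectation (\<lambda>\<omega>. T (W \<omega>))\<bar> \<le> e / 4"
      if [measurable]: "W \<in> borel_measurable M" and w2: "integrable M (\<lambda>\<omega>. (W \<omega>)\<^sup>2)" and wK: "expectation (\<lambda>\<omega>. (W \<omega>)\<^sup>2) \<le> K" for W
    proof -
      have wi: "integrable M W" by (rule i1[OF _ w2]) measurable
      have "\<bar>expectation W - expectation (\<lambda>\<omega>. T (W \<omega>))\<bar> = \<bar>expectation (\<lambda>\<omega>. W \<omega> - T (W \<omega>))\<bar>" using wi Ti by simp
      also have "\<dots> \<le> expectation (\<lambda>\<omega>. \<bar>W \<omega> - T (W \<omega>)\<bar>)" by (rule integral_abs_bound)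
      also have "\<dots> \<le> expectation (\<lambda>\<omega>. (W \<omega>)\<^sup>2 / R)" by (intro integral_mono) (use wi Ti w2 Tx in auto)
      also have "\<dots> \<le> (K + 1) / R" using wK R by (simp add: divide_right_mono)
      also have "\<dots> = e / 4"
      proof -
        have "R * e = 4 * (K + 1)" using e by (simp add: R_def)
        then show ?thesis using R by (simp add: field_simps)
      qed
      finally show ?thesis .
    qed
    have "(\<lambda>n. expectation (\<lambda>\<omega>. T (Z n \<omega>))) \<longlonglongrightarrow> expectation (\<lambda>\<omega>. T (Y \<omega>))"
    proof (rule integral_dominated_convergence[where w="\<lambda>_. R"])
      show "AE \<omega> in M. (\<lambda>n. T (Z n \<omega>)) \<longlonglongrightarrow> T (Y \<omega>)"
        using lim by eventually_elim (unfold T_def, intro tendsto_intros)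
    qed (use Tb in auto)
    then obtain N where N: "\<And>n. n \<ge> N \<Longrightarrow> norm (expectation (\<lambda>\<omega>. T (Z n \<omega>)) - expectation (\<lambda>\<omega>. T (Y \<omega>))) < e / 2"
      using LIMSEQ_D[of _ _ "e / 2"] e by (metis half_gt_zero)
    have "norm (expectation (Z n) - expectation Y) < e" if "n \<ge> N" for n
      using N[OF that] trunc[OF Zm i2 K, of n] trunc[OF Ym Y2i Y2] unfolding real_norm_def by linarith
    then show "\<exists>no. \<forall>n\<ge>no. norm (expectation (Z n) - expectation Y) < e" by blast
  qed
qed

lemma quotient_centering:
  fixes b f g :: "'i \<Rightarrow> real"
  assumes m: "(\<Sum>j\<in>J. p * b j) \<noteq> 0"
  shows "(\<Sum>j\<in>J. p * ((f j - x) * (g j - y)) * b j) - (\<Sum>j\<in>J. p * (f j - x) * b j) * (\<Sum>j\<in>J. p * (g j - y) * b j) / (\<Sum>j\<in>J. p * b j)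
    = (\<Sum>j\<in>J. p * (b j * (f j * g j))) - (\<Sum>j\<in>J. p * (b j * f j)) * (\<Sum>j\<in>J. p * (b j * g j)) / (\<Sum>j\<in>J. p * b j)"
proof -
  define A B D E where "A = (\<Sum>j\<in>J. p * (b j * (f j * g j)))" and "B = (\<Sum>j\<in>J. p * (b j * f j))"
    and "D = (\<Sum>j\<in>J. p * (b j * g j))" and "E = (\<Sum>j\<in>J. p * b j)"
  have 1: "(\<Sum>j\<in>J. p * ((f j - x) * (g j - y)) * b j) = A - y * B - x * D + x * y * E"
    unfolding A_def B_def D_def E_def sum_distrib_left sum_subtractf[symmetric] sum.distrib[symmetric]
    by (intro sum.cong refl) (simp add: algebra_simps)
  have 2: "(\<Sum>j\<in>J. p * (f j - x) * b j) = B - x * E" "(\<Sum>j\<in>J. p * (g j - y) * b j) = D - y * E"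
    unfolding B_def D_def E_def sum_distrib_left sum_subtractf[symmetric]
    by (intro sum.cong refl, simp add: algebra_simps)+
  have "E \<noteq> 0" using m by (simp add: E_def)
  then show ?thesis unfolding 1 2 A_def[symmetric] B_def[symmetric] D_def[symmetric] E_def[symmetric]
    by (simp add: field_simps)
qed

text \<open>Midpoint rule for the formula in \<open>grad_integral_solution\<close>.\<close>

definition discrete_functional ::
  "(real \<Rightarrow> 'w \<Rightarrow> real) \<Rightarrow> real \<Rightarrow> (real \<Rightarrow> real) \<Rightarrow> (real \<Rightarrow> real) \<Rightarrow> nat \<Rightarrow> 'w \<Rightarrow> real" where
  "discrete_functional G \<epsilon> f g n \<omega> =
     (let b = (\<lambda>x. exp (- G (x / \<epsilon>) \<omega>)); avg = (\<lambda>h. \<Sum>j<n. 1 / real n * h (midpoint_of n j))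
      in avg (\<lambda>x. b x * (f x * g x)) - avg (\<lambda>x. b x * f x) * avg (\<lambda>x. b x * g x) / avg b)"

definition row_const :: "real \<Rightarrow> real \<Rightarrow> real" where "row_const K \<beta> = (\<bar>K\<bar> + 1) * (1 + 2 / (\<beta> - 1))"

lemma row_const_pos: "1 < \<beta> \<Longrightarrow> 0 < row_const K \<beta>"
  unfolding row_const_def by (intro mult_pos_pos add_nonneg_pos add_pos_pos) auto

lemma lognormal_quotient_midpoints:
  assumes P: "prob_space P" and \<beta>: "1 < \<beta>"
    and G: "centered_gaussian_field P G" and C: "has_stationary_covariance P G C"
    and Cb: "\<And>x. \<bar>C x\<bar> \<le> K * (1 + \<bar>x\<bar>) powr (- \<beta>)"
    and \<kappa>: "0 < \<kappa>" and f: "\<And>x. x \<in> {0..1} \<Longrightarrow> \<bar>f x\<bar> \<le> \<kappa> / 2" and g: "\<And>x. x \<in> {0..1} \<Longrightarrow> \<bar>g x\<bar> \<le> \<kappa> / 2"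
    and \<epsilon>: "0 < \<epsilon>" and n: "1 / \<epsilon> \<le> real n"
  shows "lognormal_quotient P {..<n} (\<lambda>j. G (midpoint_of n j / \<epsilon>)) (\<lambda>i j. C (midpoint_of n i / \<epsilon> - midpoint_of n j / \<epsilon>)) (C 0)
      (1 / real n) (row_const K \<beta> * \<epsilon>)
      (\<lambda>j. f (midpoint_of n j) - (\<Sum>i<n. 1 / real n * f (midpoint_of n i)))
      (\<lambda>j. g (midpoint_of n j) - (\<Sum>i<n. 1 / real n * g (midpoint_of n i))) \<kappa> (sqrt (row_const K \<beta> * \<epsilon>))"
proof -
  have "0 < 1 / \<epsilon>" using \<epsilon> by simp
  then have n0: "0 < real n" using n by linarith
  have mi: "midpoint_of n j \<in> {0..1}" if "j < n" for j using midpoint_of_in[OF that] by auto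
  have centered: "(\<Sum>j<n. 1 / real n * (h (midpoint_of n j) - (\<Sum>i<n. 1 / real n * h (midpoint_of n i)))) = 0" for h :: "real \<Rightarrow> real"
    using n0 by (simp add: right_diff_distrib sum_subtractf)
  have bound: "\<bar>h (midpoint_of n j) - (\<Sum>i<n. 1 / real n * h (midpoint_of n i))\<bar> \<le> \<kappa>"
    if h: "\<And>x. x \<in> {0..1} \<Longrightarrow> \<bar>h x\<bar> \<le> \<kappa> / 2" and j: "j < n" for h :: "real \<Rightarrow> real" and j
  proof -
    have "\<bar>\<Sum>i<n. 1 / real n * h (midpoint_of n i)\<bar> \<le> (\<Sum>i<n. \<bar>1 / real n * h (midpoint_of n i)\<bar>)" by (rule sum_abs)
    also have "\<dots> \<le> (\<Sum>i<n. 1 / real n * (\<kappa> / 2))"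
      unfolding abs_mult using h[OF mi] by (intro sum_mono mult_mono) auto
    also have "\<dots> = \<kappa> / 2" using n0 by simp
    finally show ?thesis using h[OF mi[OF j]] by linarith
  qed
  show ?thesis
  proof (intro lognormal_quotient.intro lognormal_average.intro gaussian_vector.intro gaussian_vector_axioms.intro
      lognormal_average_axioms.intro lognormal_quotient_axioms.intro P)
    fix a :: "nat \<Rightarrow> real"
    let ?t = "\<lambda>j. midpoint_of n j / \<epsilon>"
    \<comment> \<open>linear combinations of the field are indexed by points, so the coefficients are moved from indices to points\<close>
    have inj: "inj_on ?t {..<n}" using n0 \<epsilon> by (auto simp: midpoint_of_def inj_on_def)
    have "(\<Sum>x\<in>?t ` {..<n}. a (the_inv_into {..<n} ?t x) * G x \<omega>) = (\<Sum>j<n. a j * G (?t j) \<omega>)" for \<omega>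
      by (subst sum.reindex[OF inj]) (auto intro!: sum.cong simp: the_inv_into_f_f[OF inj])
    then show "centered_gaussian_rv P (\<lambda>\<omega>. \<Sum>j<n. a j * G (?t j) \<omega>)"
      using G[unfolded centered_gaussian_field_def, rule_format, of "?t ` {..<n}" "\<lambda>x. a (the_inv_into {..<n} ?t x)"] by simp
  next
    fix i j
    show "(\<integral>\<omega>. G (midpoint_of n i / \<epsilon>) \<omega> * G (midpoint_of n j / \<epsilon>) \<omega> \<partial>P) = C (midpoint_of n i / \<epsilon> - midpoint_of n j / \<epsilon>)"
      using C by (simp add: has_stationary_covariance_def)
  next
    fix i assume "i \<in> {..<n}"
    then show "(\<Sum>j<n. 1 / real n * \<bar>C (midpoint_of n i / \<epsilon> - midpoint_of n j / \<epsilon>)\<bar>) \<le> row_const K \<beta> * \<epsilon>"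
      unfolding row_const_def by (intro covariance_row_sum \<beta> Cb \<epsilon> n) auto
  next
    show "0 < row_const K \<beta> * \<epsilon>" "0 < sqrt (row_const K \<beta> * \<epsilon>)" "row_const K \<beta> * \<epsilon> = (sqrt (row_const K \<beta> * \<epsilon>))\<^sup>2"
      using row_const_pos[OF \<beta>, of K] \<epsilon> by auto
    show "(\<Sum>j<n. 1 / real n) = 1" "0 < 1 / real n" using n0 by auto
  qed (use \<kappa> bound[of f, OF f] bound[of g, OF g] centered in auto)
qed

text \<open>The discrete functional is \<open>exp (C 0 / 2)\<close> times \<open>quot\<close> of the centered data. The discrepancy is invariant
under this scaling, except that \<open>s\<^sup>2\<close> acquires the factor \<open>exp (C 0)\<close>.\<close>

lemma discrete_functional_stein:
  fixes \<phi> \<phi>' :: "real \<Rightarrow> real"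
  assumes P: "prob_space P" and \<beta>: "1 < \<beta>"
    and G: "centered_gaussian_field P G" and C: "has_stationary_covariance P G C"
    and Cb: "\<And>x. \<bar>C x\<bar> \<le> K * (1 + \<bar>x\<bar>) powr (- \<beta>)"
    and \<kappa>: "0 < \<kappa>" and f: "\<And>x. x \<in> {0..1} \<Longrightarrow> \<bar>f x\<bar> \<le> \<kappa> / 2" and g: "\<And>x. x \<in> {0..1} \<Longrightarrow> \<bar>g x\<bar> \<le> \<kappa> / 2"
    and \<epsilon>: "0 < \<epsilon>" "\<epsilon> \<le> 1" and n: "1 / \<epsilon> \<le> real n"
  defines "Y \<equiv> discrete_functional G \<epsilon> f g n"
  shows "Y \<in> borel_measurable P"
    and "k \<le> 4 \<Longrightarrow> integrable P (\<lambda>\<omega>. Y \<omega> ^ k)"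
    and "(\<integral>\<omega>. Y \<omega> ^ 4 \<partial>P) \<le> exp (2 * C 0) * (16 * \<kappa> ^ 8 * exp (6 * C 0))"
    and "0 < s \<Longrightarrow> s\<^sup>2 = (\<integral>\<omega>. (Y \<omega> - (\<integral>\<omega>. Y \<omega> \<partial>P))\<^sup>2 \<partial>P) \<Longrightarrow>
      (\<And>z. (\<phi> has_real_derivative \<phi>' z) (at z)) \<Longrightarrow> continuous_on UNIV \<phi>' \<Longrightarrow>
      (\<And>z. \<bar>\<phi> z\<bar> \<le> B) \<Longrightarrow> (\<And>z. \<bar>\<phi>' z\<bar> \<le> 2) \<Longrightarrow>
      \<bar>\<integral>\<omega>. \<phi>' ((Y \<omega> - (\<integral>\<omega>. Y \<omega> \<partial>P)) / s) - (Y \<omega> - (\<integral>\<omega>. Y \<omega> \<partial>P)) / s * \<phi> ((Y \<omega> - (\<integral>\<omega>. Y \<omega> \<partial>P)) / s) \<partial>P\<bar>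
      \<le> stein_const \<kappa> (C 0) (row_const K \<beta>) B * sqrt (row_const K \<beta> * \<epsilon>) ^ 3 * exp (C 0) / s\<^sup>2"
proof -
  let ?V = "C 0" and ?\<eta> = "row_const K \<beta> * \<epsilon>"
  define mf where "mf = (\<Sum>i<n. 1 / real n * f (midpoint_of n i))"
  define mg where "mg = (\<Sum>i<n. 1 / real n * g (midpoint_of n i))"
  interpret L: lognormal_quotient P "{..<n}" "\<lambda>j. G (midpoint_of n j / \<epsilon>)" "\<lambda>i j. C (midpoint_of n i / \<epsilon> - midpoint_of n j / \<epsilon>)" "C 0"
      "1 / real n" "row_const K \<beta> * \<epsilon>" "\<lambda>j. f (midpoint_of n j) - mf" "\<lambda>j. g (midpoint_of n j) - mg" \<kappa> "sqrt (row_const K \<beta> * \<epsilon>)"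
    unfolding mf_def mg_def by (rule lognormal_quotient_midpoints[OF P \<beta> G C Cb \<kappa> f g \<epsilon>(1) n])
  define r where "r = exp (?V / 2)"
  have r0: "0 < r" by (simp add: r_def)
  have r2: "r\<^sup>2 = exp ?V" by (simp add: r_def power2_eq_square exp_add[symmetric])
  have YQ: "Y \<omega> = r * L.quot (L.ev \<omega>)" for \<omega>
  proof -
    define b where "b j = exp (- G (midpoint_of n j / \<epsilon>) \<omega>)" for j
    have ev: "L.ev \<omega> j = b j / r" if "j < n" for j
      using that by (simp add: L.ev_eq L.w_def b_def r_def exp_diff)
    have SS: "L.avg h (L.ev \<omega>) = (\<Sum>j<n. 1 / real n * h j * b j) / r" for h
      unfolding L.avg_def sum_divide_distrib by (intro sum.cong) (auto simp: ev)
    have m: "(\<Sum>j<n. 1 / real n * b j) \<noteq> 0"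
      using L.mass_ev_pos[of \<omega>] r0 unfolding SS by auto
    have "r * L.quot (L.ev \<omega>) = (\<Sum>j<n. 1 / real n * ((f (midpoint_of n j) - mf) * (g (midpoint_of n j) - mg)) * b j)
        - (\<Sum>j<n. 1 / real n * (f (midpoint_of n j) - mf) * b j) * (\<Sum>j<n. 1 / real n * (g (midpoint_of n j) - mg) * b j) / (\<Sum>j<n. 1 / real n * 1 * b j)"
      unfolding L.quot_def SS using r0 m by (simp add: right_diff_distrib)
    also have "\<dots> = Y \<omega>"
      unfolding mult_1_right quotient_centering[OF m] unfolding Y_def discrete_functional_def Let_def b_def ..
    finally show ?thesis ..
  qed
  have Yfun: "Y = (\<lambda>\<omega>. r * L.quot (L.ev \<omega>))" using YQ by auto
  show Ym: "Y \<in> borel_measurable P" unfolding Yfun by measurable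
  show "integrable P (\<lambda>\<omega>. Y \<omega> ^ k)" if "k \<le> 4"
    unfolding YQ power_mult_distrib using L.quot_power_integrable[OF that] by simp
  have "(\<integral>\<omega>. Y \<omega> ^ 4 \<partial>P) = r ^ 4 * (\<integral>\<omega>. L.quot (L.ev \<omega>) ^ 4 \<partial>P)" unfolding YQ power_mult_distrib by simp
  also have "\<dots> \<le> r ^ 4 * (16 * \<kappa> ^ 8 * exp (6 * ?V))" by (intro mult_left_mono L.quot_fourth_moment) auto
  also have "r ^ 4 = exp (2 * ?V)" by (simp add: r_def exp_of_nat_mult[symmetric])
  finally show "(\<integral>\<omega>. Y \<omega> ^ 4 \<partial>P) \<le> exp (2 * C 0) * (16 * \<kappa> ^ 8 * exp (6 * C 0))" .
  assume s: "0 < s" "s\<^sup>2 = (\<integral>\<omega>. (Y \<omega> - (\<integral>\<omega>. Y \<omega> \<partial>P))\<^sup>2 \<partial>P)"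
    and st: "\<And>z. (\<phi> has_real_derivative \<phi>' z) (at z)" "continuous_on UNIV \<phi>'" "\<And>z. \<bar>\<phi> z\<bar> \<le> B" "\<And>z. \<bar>\<phi>' z\<bar> \<le> 2"
  define \<mu> where "\<mu> = (\<integral>\<omega>. L.quot (L.ev \<omega>) \<partial>P)"
  have EY: "(\<integral>\<omega>. Y \<omega> \<partial>P) = r * \<mu>" unfolding YQ \<mu>_def by simp
  have diff: "Y \<omega> - (\<integral>\<omega>. Y \<omega> \<partial>P) = r * (L.quot (L.ev \<omega>) - \<mu>)" for \<omega> unfolding EY by (simp add: YQ right_diff_distrib)
  have nrm: "(Y \<omega> - (\<integral>\<omega>. Y \<omega> \<partial>P)) / s = (L.quot (L.ev \<omega>) - \<mu>) / (s / r)" for \<omega>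
    unfolding diff by (simp add: mult.commute)
  have s2: "(s / r)\<^sup>2 = (\<integral>\<omega>. (L.quot (L.ev \<omega>) - \<mu>)\<^sup>2 \<partial>P)"
    using s(2) r0 unfolding diff power_mult_distrib by (simp add: power_divide)
  have hb: "?\<eta> \<le> row_const K \<beta>" using row_const_pos[OF \<beta>, of K] \<epsilon> by (simp add: mult_left_le)
  have "\<bar>\<integral>\<omega>. \<phi>' ((L.quot (L.ev \<omega>) - \<mu>) / (s / r)) - (L.quot (L.ev \<omega>) - \<mu>) / (s / r) * \<phi> ((L.quot (L.ev \<omega>) - \<mu>) / (s / r)) \<partial>P\<bar>
      \<le> stein_const \<kappa> ?V (row_const K \<beta>) B * sqrt ?\<eta> ^ 3 / (s / r)\<^sup>2"
    using L.stein_discrepancy[of "s / r" "row_const K \<beta>" \<phi> \<phi>' B] s(1) r0 s2 hb st unfolding \<mu>_def by simp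
  then show "\<bar>\<integral>\<omega>. \<phi>' ((Y \<omega> - (\<integral>\<omega>. Y \<omega> \<partial>P)) / s) - (Y \<omega> - (\<integral>\<omega>. Y \<omega> \<partial>P)) / s * \<phi> ((Y \<omega> - (\<integral>\<omega>. Y \<omega> \<partial>P)) / s) \<partial>P\<bar>
      \<le> stein_const \<kappa> (C 0) (row_const K \<beta>) B * sqrt (row_const K \<beta> * \<epsilon>) ^ 3 * exp (C 0) / s\<^sup>2"
    unfolding nrm r2[symmetric] by (simp add: power_divide)
qed

lemma discrete_functional_tendsto:
  assumes cont: "continuous_on UNIV (\<lambda>x. G x \<omega>)" and \<epsilon>: "0 < \<epsilon>" and f: "C1_01 f" and g: "continuous_on {0..1} g"
    and u: "solves_bvp (coeff_field G \<omega>) \<epsilon> f (u \<omega>)"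
  shows "(\<lambda>n. discrete_functional G \<epsilon> f g n \<omega>) \<longlonglongrightarrow> grad_integral u g \<omega>"
proof -
  define b where "b x = exp (- G (x / \<epsilon>) \<omega>)" for x
  have a: "continuous_on UNIV (coeff_field G \<omega>)" unfolding coeff_field_def[abs_def] by (intro continuous_intros cont)
  have ap: "0 < coeff_field G \<omega> x" for x by (simp add: coeff_field_def)
  have beq: "1 / coeff_field G \<omega> (x / \<epsilon>) = b x" for x by (simp add: b_def coeff_field_def exp_minus inverse_eq_divide)
  note sol = grad_integral_solution[of "coeff_field G \<omega>" \<epsilon> f g u \<omega>, OF a ap \<epsilon> f g u, unfolded beq]
  obtain fc: "continuous_on {0..1} f" using C1_01_deriv[OF f] by metis
  have "(\<lambda>n. (\<Sum>j<n. 1 / real n * (b (midpoint_of n j) * (f (midpoint_of n j) * g (midpoint_of n j))))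
      - (\<Sum>j<n. 1 / real n * (b (midpoint_of n j) * f (midpoint_of n j))) * (\<Sum>j<n. 1 / real n * (b (midpoint_of n j) * g (midpoint_of n j)))
       / (\<Sum>j<n. 1 / real n * b (midpoint_of n j)))
    \<longlonglongrightarrow> integral {0..1} (\<lambda>x. b x * (f x * g x)) - integral {0..1} (\<lambda>x. b x * f x) * integral {0..1} (\<lambda>x. b x * g x) / integral {0..1} b"
    using sol(2,3) fc g by (intro tendsto_intros midpoint_sums_tendsto continuous_intros) auto
  then show ?thesis unfolding sol(1) discrete_functional_def Let_def b_def .
qed

text \<open>For a fixed continuous test function the bound for the discrete functional involves only its mean and variance, and
these converge by the fourth moment bound. The bound is therefore inherited by the limit, and it does not depend on
the test function.\<close>

lemma grad_integral_normal_approximation: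
  fixes P :: "'w measure"
  assumes P: "prob_space P" and \<beta>: "1 < \<beta>"
    and G: "centered_gaussian_field P G" and C: "has_stationary_covariance P G C"
    and cont: "AE \<omega> in P. continuous_on UNIV (\<lambda>x. G x \<omega>)"
    and Cb: "\<And>x. \<bar>C x\<bar> \<le> K * (1 + \<bar>x\<bar>) powr (- \<beta>)"
    and \<kappa>: "0 < \<kappa>" and f: "C1_01 f" "\<And>x. x \<in> {0..1} \<Longrightarrow> \<bar>f x\<bar> \<le> \<kappa> / 2"
    and g: "C1_01 g" "\<And>x. x \<in> {0..1} \<Longrightarrow> \<bar>g x\<bar> \<le> \<kappa> / 2"
    and \<epsilon>: "0 < \<epsilon>" "\<epsilon> \<le> 1" and u: "random_solution P G \<epsilon> f u"
  defines "I \<equiv> grad_integral u g"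
  defines "\<sigma> \<equiv> rescaled_sd P \<epsilon> I"
  assumes \<sigma>: "\<sigma> \<noteq> 0"
  shows "tv_dist (distr P borel (\<lambda>\<omega>. (I \<omega> - prob_space.expectation P I) / (sqrt \<epsilon> * \<sigma>))) std_normal_distribution
     \<le> stein_const \<kappa> (C 0) (row_const K \<beta>) (1 / std_normal 1) * sqrt (row_const K \<beta>) ^ 3 * exp (C 0) / \<sigma>\<^sup>2 * sqrt \<epsilon>"
proof -
  interpret prob_space P by fact
  obtain gc: "continuous_on {0..1} g" using C1_01_deriv[OF g(1)] by metis
  have Im[measurable]: "I \<in> borel_measurable P" unfolding I_def by (rule grad_integral_measurable[OF u gc])
  \<comment> \<open>the discrete estimates are available for meshes finer than \<open>\<epsilon>\<close>\<close>
  define N where "N = nat \<lceil>1 / \<epsilon>\<rceil>"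
  have N: "1 / \<epsilon> \<le> real (n + N)" for n unfolding N_def by linarith
  define Y where "Y n = discrete_functional G \<epsilon> f g (n + N)" for n
  note Yfacts = discrete_functional_stein[where f=f and g=g, OF P \<beta> G C Cb \<kappa> f(2) g(2) \<epsilon> N]
  have Ym[measurable]: "Y n \<in> borel_measurable P" for n unfolding Y_def by (rule Yfacts(1))
  have Yi: "k \<le> 4 \<Longrightarrow> integrable P (\<lambda>\<omega>. Y n \<omega> ^ k)" for n k unfolding Y_def by (rule Yfacts(2))
  define K4 where "K4 = exp (2 * C 0) * (16 * \<kappa> ^ 8 * exp (6 * C 0))"
  have Y4: "expectation (\<lambda>\<omega>. Y n \<omega> ^ 4) \<le> K4" for n unfolding Y_def K4_def by (rule Yfacts(3))
  have lim: "AE \<omega> in P. (\<lambda>n. Y n \<omega>) \<longlonglongrightarrow> I \<omega>"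
  proof -
    have "AE \<omega> in P. solves_bvp (coeff_field G \<omega>) \<epsilon> f (u \<omega>)" using u by (simp add: random_solution_def)
    with cont show ?thesis
    proof eventually_elim
      case (elim \<omega>)
      have "(\<lambda>n. discrete_functional G \<epsilon> f g n \<omega>) \<longlonglongrightarrow> grad_integral u g \<omega>"
        by (rule discrete_functional_tendsto[of G \<omega> \<epsilon> f g u, OF elim(1) \<epsilon>(1) f(1) gc elim(2)])
      then show ?case unfolding Y_def I_def by (rule LIMSEQ_ignore_initial_segment)
    qed
  qed
  have Y2: "expectation (\<lambda>\<omega>. (Y n \<omega>)\<^sup>2) \<le> 1 + K4" for n
  proof -
    have "expectation (\<lambda>\<omega>. (Y n \<omega>)\<^sup>2) \<le> expectation (\<lambda>\<omega>. 1 + Y n \<omega> ^ 4)"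
    proof (rule integral_mono)
      fix \<omega>
      have "2 * (Y n \<omega>)\<^sup>2 \<le> 1 + Y n \<omega> ^ 4"
        using sum_squares_bound[of 1 "(Y n \<omega>)\<^sup>2"] by (simp add: power_mult[symmetric])
      then show "(Y n \<omega>)\<^sup>2 \<le> 1 + Y n \<omega> ^ 4" using zero_le_power2[of "Y n \<omega>"] by linarith
    qed (use Yi in simp_all)
    also have "\<dots> \<le> 1 + K4" using Yi[of 4 n] Y4[of n] by (simp add: prob_space)
    finally show ?thesis .
  qed
  have Ii: "integrable P I" and EY: "(\<lambda>n. expectation (Y n)) \<longlonglongrightarrow> expectation I"
    by (rule expectation_tendsto_of_bounded_second_moment[OF Ym Im lim Yi Y2]; simp)+
  have Y4': "integrable P (\<lambda>\<omega>. ((Y n \<omega>)\<^sup>2)\<^sup>2)" "expectation (\<lambda>\<omega>. ((Y n \<omega>)\<^sup>2)\<^sup>2) \<le> K4" for n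
    using Yi[of 4 n] Y4[of n] by (simp_all add: power_mult[symmetric])
  have lim2: "AE \<omega> in P. (\<lambda>n. (Y n \<omega>)\<^sup>2) \<longlonglongrightarrow> (I \<omega>)\<^sup>2"
    using lim by eventually_elim (intro tendsto_intros)
  have I2i: "integrable P (\<lambda>\<omega>. (I \<omega>)\<^sup>2)" and EY2: "(\<lambda>n. expectation (\<lambda>\<omega>. (Y n \<omega>)\<^sup>2)) \<longlonglongrightarrow> expectation (\<lambda>\<omega>. (I \<omega>)\<^sup>2)"
    by (rule expectation_tendsto_of_bounded_second_moment[OF _ _ lim2 Y4'], measurable)+
  define S2 where "S2 n = expectation (\<lambda>\<omega>. (Y n \<omega> - expectation (Y n))\<^sup>2)" for n
  define s where "s = sqrt \<epsilon> * \<sigma>"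
  have varI: "s\<^sup>2 = variance I"
    using \<epsilon>(1) by (simp add: s_def \<sigma>_def rescaled_sd_def power_mult_distrib)
  have s0: "0 < s"
  proof -
    have "0 \<le> \<sigma>" unfolding \<sigma>_def rescaled_sd_def using \<epsilon>(1) by (intro real_sqrt_ge_zero mult_nonneg_nonneg) auto
    then show ?thesis using \<sigma> \<epsilon>(1) by (simp add: s_def)
  qed
  have S2: "S2 \<longlonglongrightarrow> s\<^sup>2"
  proof -
    have "S2 = (\<lambda>n. expectation (\<lambda>\<omega>. (Y n \<omega>)\<^sup>2) - (expectation (Y n))\<^sup>2)"
      unfolding S2_def using Yi[of 1] Yi[of 2] by (intro ext variance_eq) auto
    moreover have "s\<^sup>2 = expectation (\<lambda>\<omega>. (I \<omega>)\<^sup>2) - (expectation I)\<^sup>2" unfolding varI by (rule variance_eq[OF Ii I2i])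
    ultimately show ?thesis by (simp only:) (intro tendsto_intros EY2 EY)
  qed
  have sn: "(\<lambda>n. sqrt (S2 n)) \<longlonglongrightarrow> s" using tendsto_real_sqrt[OF S2] s0 by simp
  define F where "F n \<omega> = (Y n \<omega> - expectation (Y n)) / sqrt (S2 n)" for n \<omega>
  define Flim where "Flim \<omega> = (I \<omega> - expectation I) / s" for \<omega>
  have [measurable]: "F n \<in> borel_measurable P" "Flim \<in> borel_measurable P" for n unfolding F_def Flim_def by measurable
  have Flim: "AE \<omega> in P. (\<lambda>n. F n \<omega>) \<longlonglongrightarrow> Flim \<omega>"
    using lim unfolding F_def Flim_def by eventually_elim (use s0 in \<open>intro tendsto_intros EY sn, auto\<close>)
  define M where "M = stein_const \<kappa> (C 0) (row_const K \<beta>) (1 / std_normal 1) * sqrt (row_const K \<beta> * \<epsilon>) ^ 3 * exp (C 0)"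
  have key: "\<bar>(\<integral>x. h x \<partial>distr P borel Flim) - (\<integral>x. h x \<partial>std_normal_distribution)\<bar> \<le> M / s\<^sup>2"
    if h: "continuous_on UNIV h" "\<And>x. 0 \<le> h x" "\<And>x. h x \<le> 1" for h :: "real \<Rightarrow> real"
  proof -
    have [measurable]: "h \<in> borel_measurable borel" using h(1) by (rule borel_measurable_continuous_onI)
    obtain \<phi> \<phi>' where \<phi>: "\<And>x. (\<phi> has_real_derivative \<phi>' x) (at x)" "continuous_on UNIV \<phi>'"
      "\<And>x. \<phi>' x - x * \<phi> x = h x - (\<integral>z. h z \<partial>std_normal_distribution)"
      "\<And>x. \<bar>\<phi> x\<bar> \<le> 1 / std_normal 1" "\<And>x. \<bar>\<phi>' x\<bar> \<le> 2"
      using stein_solution[OF h] by metis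
    have hi: "integrable P (\<lambda>\<omega>. h (F n \<omega>))" for n
      by (rule integrable_const_bound[of _ 1]) (use h in auto)
    have ev: "\<forall>\<^sub>F n in sequentially. \<bar>expectation (\<lambda>\<omega>. h (F n \<omega>)) - (\<integral>z. h z \<partial>std_normal_distribution)\<bar> \<le> M / S2 n"
    proof -
      have "\<forall>\<^sub>F n in sequentially. 0 < S2 n" using S2 s0 by (intro order_tendstoD(1)[OF S2]) simp
      then show ?thesis
      proof eventually_elim
        case (elim n)
        have "\<bar>expectation (\<lambda>\<omega>. \<phi>' (F n \<omega>) - F n \<omega> * \<phi> (F n \<omega>))\<bar> \<le> M / (sqrt (S2 n))\<^sup>2"
          unfolding F_def M_def Y_def
          by (rule Yfacts(4)[OF _ _ _ _ \<phi>(1,2,4,5)]) (use elim in \<open>auto simp: S2_def Y_def\<close>)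
        moreover have "expectation (\<lambda>\<omega>. \<phi>' (F n \<omega>) - F n \<omega> * \<phi> (F n \<omega>)) = expectation (\<lambda>\<omega>. h (F n \<omega>)) - (\<integral>z. h z \<partial>std_normal_distribution)"
          unfolding \<phi>(3) using hi by (simp add: prob_space)
        ultimately show ?case using elim by simp
      qed
    qed
    have "(\<lambda>n. expectation (\<lambda>\<omega>. h (F n \<omega>))) \<longlonglongrightarrow> expectation (\<lambda>\<omega>. h (Flim \<omega>))"
    proof (rule integral_dominated_convergence[where w="\<lambda>_. 1"])
      show "AE \<omega> in P. (\<lambda>n. h (F n \<omega>)) \<longlonglongrightarrow> h (Flim \<omega>)"
        using Flim by eventually_elim (rule continuous_on_tendsto_compose[OF h(1)], auto)
    qed (use h in auto)
    then have l: "(\<lambda>n. \<bar>expectation (\<lambda>\<omega>. h (F n \<omega>)) - (\<integral>z. h z \<partial>std_normal_distribution)\<bar>)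
        \<longlonglongrightarrow> \<bar>expectation (\<lambda>\<omega>. h (Flim \<omega>)) - (\<integral>z. h z \<partial>std_normal_distribution)\<bar>"
      by (intro tendsto_intros)
    have r: "(\<lambda>n. M / S2 n) \<longlonglongrightarrow> M / s\<^sup>2" using s0 by (intro tendsto_intros S2) auto
    have "\<bar>expectation (\<lambda>\<omega>. h (Flim \<omega>)) - (\<integral>z. h z \<partial>std_normal_distribution)\<bar> \<le> M / s\<^sup>2"
      by (rule tendsto_le[OF _ r l ev]) simp
    then show ?thesis by (simp add: integral_distr)
  qed
  have "tv_dist (distr P borel Flim) std_normal_distribution \<le> M / s\<^sup>2"
  proof (rule tv_dist_le_continuous[OF _ _ key])
    show "real_distribution (distr P borel Flim)" by (rule real_distribution_distr) measurable
    show "real_distribution std_normal_distribution" by (rule real_dist_normal_dist)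
  qed
  moreover have "M / s\<^sup>2 = stein_const \<kappa> (C 0) (row_const K \<beta>) (1 / std_normal 1) * sqrt (row_const K \<beta>) ^ 3 * exp (C 0) / \<sigma>\<^sup>2 * sqrt \<epsilon>"
  proof -
    have "sqrt (row_const K \<beta> * \<epsilon>) ^ 3 = sqrt (row_const K \<beta>) ^ 3 * (\<epsilon> * sqrt \<epsilon>)"
    proof -
      have "sqrt \<epsilon> ^ 3 = \<epsilon> * sqrt \<epsilon>" using \<epsilon>(1) by (simp add: power3_eq_cube)
      then show ?thesis by (simp only: real_sqrt_mult power_mult_distrib)
    qed
    moreover have "s\<^sup>2 = \<epsilon> * \<sigma>\<^sup>2" using \<epsilon>(1) by (simp add: s_def power_mult_distrib)
    ultimately show ?thesis using \<epsilon>(1) by (simp add: M_def)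
  qed
  ultimately show ?thesis unfolding Flim_def s_def by simp
qed

lemma grad_integral_symmetric:
  assumes cont: "AE \<omega> in P. continuous_on UNIV (\<lambda>x. G x \<omega>)" and \<epsilon>: "0 < \<epsilon>" and f: "C1_01 f" and g: "C1_01 g"
    and u: "random_solution P G \<epsilon> f u" and v: "random_solution P G \<epsilon> g v"
  shows "AE \<omega> in P. grad_integral u g \<omega> = grad_integral v f \<omega>"
proof -
  obtain fc: "continuous_on {0..1} f" using C1_01_deriv[OF f] by metis
  obtain gc: "continuous_on {0..1} g" using C1_01_deriv[OF g] by metis
  have "AE \<omega> in P. solves_bvp (coeff_field G \<omega>) \<epsilon> f (u \<omega>)" "AE \<omega> in P. solves_bvp (coeff_field G \<omega>) \<epsilon> g (v \<omega>)"
    using u v by (simp_all add: random_solution_def)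
  with cont show ?thesis
  proof eventually_elim
    case (elim \<omega>)
    have "(\<lambda>n. discrete_functional G \<epsilon> f g n \<omega>) \<longlonglongrightarrow> grad_integral u g \<omega>"
      by (rule discrete_functional_tendsto[of G \<omega> \<epsilon> f g u, OF elim(1) \<epsilon> f gc elim(2)])
    moreover have "(\<lambda>n. discrete_functional G \<epsilon> g f n \<omega>) \<longlonglongrightarrow> grad_integral v f \<omega>"
      by (rule discrete_functional_tendsto[of G \<omega> \<epsilon> g f v, OF elim(1) \<epsilon> g fc elim(3)])
    moreover have "discrete_functional G \<epsilon> g f n \<omega> = discrete_functional G \<epsilon> f g n \<omega>" for n
      by (simp add: discrete_functional_def Let_def mult_ac)
    ultimately show ?case by (simp add: LIMSEQ_unique)
  qed
qed

theorem proposition5p4: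
  fixes P :: "'w measure"
    and G :: "real \<Rightarrow> 'w \<Rightarrow> real"
    and C C0 :: "real \<Rightarrow> real"
    and \<beta> K :: real
  assumes "prob_space P"
    and "\<beta> > 1"
    and "centered_gaussian_field P G"
    and "has_stationary_covariance P G C"
    and "AE \<omega> in P. continuous_on UNIV (\<lambda>x. G x \<omega>)"
    and "holder_continuous_at_zero C"
    and "\<And>x. \<bar>C x\<bar> \<le> K * (1 + \<bar>x\<bar>) powr (- \<beta>)"
    and "C0 \<in> borel_measurable lebesgue"
    and "C = fun_convolution C0 C0"
    and "\<And>x y. y \<in> ball x 1 \<Longrightarrow> \<bar>C0 y\<bar> \<le> K * (1 + \<bar>x\<bar>) powr (- ((1 + \<beta>) / 2))"
  shows "\<exists>c::real. \<forall>f g. C1_01 f \<and> C1_01 g \<longrightarrow>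
           (\<exists>M::real. \<forall>\<epsilon> u v. 0 < \<epsilon> \<and> \<epsilon> \<le> 1 / 2 \<and>
              random_solution P G \<epsilon> f u \<and> random_solution P G \<epsilon> g v \<longrightarrow>
                (AE \<omega> in P. grad_integral u g \<omega> = grad_integral v f \<omega>) \<and>
                (let I = grad_integral u g; \<sigma> = rescaled_sd P \<epsilon> I in
                   \<sigma> \<noteq> 0 \<longrightarrow>
                   tv_dist
                     (distr P borel
                        (\<lambda>\<omega>. (I \<omega> - prob_space.expectation P I) / (sqrt \<epsilon> * \<sigma>)))
                     std_normal_distribution
                   \<le> M / \<sigma>\<^sup>2 * sqrt \<epsilon> * exp (c * sqrt \<bar>ln \<epsilon>\<bar>)))"
proof (rule exI[of _ 0], intro allI impI)
  fix f g assume fg: "C1_01 f \<and> C1_01 g"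
  have bounded: "\<exists>b. \<forall>x\<in>{0..1}. \<bar>h x\<bar> \<le> b" if h: "C1_01 h" for h
  proof -
    obtain hc: "continuous_on {0..1} h" using C1_01_deriv[OF h] by metis
    then have "bounded (h ` {0..1})" by (intro compact_imp_bounded compact_continuous_image) auto
    then show ?thesis by (auto simp: bounded_iff)
  qed
  obtain bf bg where b: "\<forall>x\<in>{0..1}. \<bar>f x\<bar> \<le> bf" "\<forall>x\<in>{0..1}. \<bar>g x\<bar> \<le> bg" using bounded fg by metis
  \<comment> \<open>the factor 2 leaves room for the centering of the data\<close>
  define \<kappa> where "\<kappa> = 2 * (\<bar>bf\<bar> + \<bar>bg\<bar> + 1)"
  have \<kappa>: "0 < \<kappa>" "\<And>x. x \<in> {0..1} \<Longrightarrow> \<bar>f x\<bar> \<le> \<kappa> / 2" "\<And>x. x \<in> {0..1} \<Longrightarrow> \<bar>g x\<bar> \<le> \<kappa> / 2"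
    using b by (force simp: \<kappa>_def)+
  let ?M = "stein_const \<kappa> (C 0) (row_const K \<beta>) (1 / std_normal 1) * sqrt (row_const K \<beta>) ^ 3 * exp (C 0)"
  show "\<exists>M::real. \<forall>\<epsilon> u v. 0 < \<epsilon> \<and> \<epsilon> \<le> 1 / 2 \<and>
              random_solution P G \<epsilon> f u \<and> random_solution P G \<epsilon> g v \<longrightarrow>
                (AE \<omega> in P. grad_integral u g \<omega> = grad_integral v f \<omega>) \<and>
                (let I = grad_integral u g; \<sigma> = rescaled_sd P \<epsilon> I in
                   \<sigma> \<noteq> 0 \<longrightarrow>
                   tv_dist
                     (distr P borel
                        (\<lambda>\<omega>. (I \<omega> - prob_space.expectation P I) / (sqrt \<epsilon> * \<sigma>)))
                     std_normal_distribution
                   \<le> M / \<sigma>\<^sup>2 * sqrt \<epsilon> * exp (0 * sqrt \<bar>ln \<epsilon>\<bar>))"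
  proof (rule exI[of _ ?M], intro allI impI conjI)
    fix \<epsilon> :: real and u v :: "'w \<Rightarrow> real \<Rightarrow> real"
    assume A: "0 < \<epsilon> \<and> \<epsilon> \<le> 1 / 2 \<and> random_solution P G \<epsilon> f u \<and> random_solution P G \<epsilon> g v"
    show "AE \<omega> in P. grad_integral u g \<omega> = grad_integral v f \<omega>"
      by (rule grad_integral_symmetric[OF assms(5)]) (use A fg in auto)
    show "let I = grad_integral u g; \<sigma> = rescaled_sd P \<epsilon> I in \<sigma> \<noteq> 0 \<longrightarrow>
        tv_dist (distr P borel (\<lambda>\<omega>. (I \<omega> - prob_space.expectation P I) / (sqrt \<epsilon> * \<sigma>))) std_normal_distribution
        \<le> ?M / \<sigma>\<^sup>2 * sqrt \<epsilon> * exp (0 * sqrt \<bar>ln \<epsilon>\<bar>)"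
      unfolding Let_def mult_zero_left exp_zero mult_1_right
      by (intro impI grad_integral_normal_approximation[OF assms(1,2,3,4,5,7) \<kappa>(1) _ \<kappa>(2) _ \<kappa>(3)]) (use A fg in auto)
  qed
qed

end
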